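(* Assume (A), (B) and (C). Let $(Y,Z)\in\mathcal{L}^1_{\alpha,\beta}$ (with $\alpha,\beta$ as in (B)) be the solution of the BSDE $$Y_t+\int_{(t,T]}\int_E Z(s,x)\,\mu(ds,dx)=\xi+\int_{(t,T]}f\bigl(s,Z_s(\cdot)\bigr)\,dA_s,\qquad t\in[0,T],$$ where $\xi$ is the terminal cost and $f$ the Hamiltonian function, and let $u^*=\underline{u}^Z$ be the corresponding admissible control given by (C). Then the admissible control $u^*(\cdot)$ is optimal, and $$Y_0=J(u^*(\cdot))=\inf_{u(\cdot)\in\mathcal{A}}J(u(\cdot))$$ is the minimal cost.
   Context: Point process. $(\Omega,\mathcal{F},\mathbb{P})$ is a probability space, $T\in(0,\infty)$ is fixed, $(E,\mathcal{E})$ is a Lusin space with its Borel $\sigma$-field, $\Delta\in E$ a distinguished point. $(S_n,X_n)_{n\ge1}$ is a nonexplosive multivariate point process: $S_n$ takes values in $(0,T]\cup\{\infty\}$, $X_n$ in $E$, $S_n\le S_{n+1}$ everywhere, $S_n<S_{n+1}$ if $S_n\le T$, $X_n=\Delta$ if $S_n=\infty$, and $\Omega=\bigcup_n\{S_n>T\}$; put $S_0=0$. The associated random measure is $\mu(dt,dx)=\sum_{n\ge1:\,S_n\le T}\varepsilon_{(S_n,X_n)}(dt,dx)$ ($\varepsilon$ = Dirac measure), and $N_t=\mu([0,t]\times E)$. $(\mathcal{F}_t)_{t\ge0}$ is the filtration generated by the point process (the smallest one for which each $S_n$ is a stopping time and $X_n$ is $\mathcal{F}_{S_n}$-measurable).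 A function on $\Omega\times[0,T]\times G$, with $(G,\mathcal{G})$ measurable, is called predictable if it is measurable with respect to $\mathcal{P}\otimes\mathcal{G}$, $\mathcal{P}$ being the predictable $\sigma$-field on $\Omega\times[0,T]$. $\nu$ is the predictable compensator of $\mu$, disintegrated as $\nu(\omega,dt,dx)=dA_t(\omega)\,\phi_{\omega,t}(dx)$, where $\phi$ is a transition probability from $(\Omega\times[0,T],\mathcal{P})$ into $(E,\mathcal{E})$ and $A$ is increasing, c\`adl\`ag, predictable, $A_0=0$ ($A$ is the compensator of $N$). Assumption (A): (A$_1$) the process $A$ is continuous; (A$_2$) $\mathbb{P}(S_{n+1}>T\mid\mathcal{F}_{S_n})>0$ for all $n\ge0$. Control problem data: a terminal cost $\xi$ ($\mathcal{F}_T$-measurable real random variable); an action space $(U,\mathcal{U})$ (measurable space); a predictable real function $r$ on $\Omega\times[0,T]\times E\times U$; a running cost $l$, a predictable real function on $\Omega\times[0,T]\times U$. Assumption (B): there is a constant $C>0$ with $0\le r(\omega,t,x,u)\le C$ and $\mathbb{E}(e^{A_T}C^{N_T})<\infty$, and there are constants $\alpha\in[1,\infty)\cap(C,\infty)$ and $\beta>1+C$ with $$\mathbb{E}\Bigl(e^{\beta A_T}\alpha^{N_T}|\xi|+\int_0^Te^{\beta A_s}\alpha^{N_s}\bigl|\inf_{u\in U}l(s,u)\bigr|\,dA_s+\int_0^Te^{A_s}C^{N_s}\sup_{u\in U}|l(s,u)|\,dA_s\Bigr)<\infty.$$ Admissible controls and cost: $\mathcal{A}$ is the set of $U$-valued predictable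 processes. For $u\in\mathcal{A}$ let $$L^u_t=\exp\Bigl(\int_0^t\!\int_E(1-r(s,x,u_s))\,\nu(ds,dx)\Bigr)\prod_{n\ge1:\,S_n\le t}r(S_n,X_n,u_{S_n}),\qquad t\in[0,T]$$ (empty product $=1$); under (B) it is a uniformly integrable martingale with $\mathbb{E}(L^u_T)=1$, and $\mathbb{P}_u$ is the probability with $d\mathbb{P}_u=L^u_T\,d\mathbb{P}$; $\mathbb{E}_u$ is the expectation under $\mathbb{P}_u$. The cost is $J(u(\cdot))=\mathbb{E}_u\bigl(\int_0^Tl(t,u_t)\,dA_t+\xi\bigr)$, and a control is optimal if it minimizes $J$ over $\mathcal{A}$. Hamiltonian: $\mathcal{B}(E)$ is the set of Borel real functions on $E$. For $\zeta\in\mathcal{B}(E)$, $$f(\omega,t,\zeta)=\inf_{u\in U}\Bigl(l(\omega,t,u)+\int_E\zeta(x)\,r(\omega,t,x,u)\,\phi_{\omega,t}(dx)\Bigr)\ \text{ if }\int_E|\zeta(x)|\,\phi_{\omega,t}(dx)<\infty,$$ and $f(\omega,t,\zeta)=0$ otherwise. For a function $Z$ on $\Omega\times[0,T]\times E$ write $Z_{\omega,t}(x)=Z(\omega,t,x)$, $Z_t(\cdot)=Z_{\omega,t}$. Assumption (C): for every predictable function $Z$ on $\Omega\times[0,T]\times E$ there is a $U$-valued predictable process (admissible control) $\underline{u}^Z$ such that, $dA_t(\omega)\mathbb{P}(d\omega)$-almost everywhere, $$f(\omega,t,Z_{\omega,t}(\cdot))=l(\omega,t,\underline{u}^Z(\omega,t))+\int_EZ_{\omega,t}(x)\,r(\omega,t,x,\underline{u}^Z(\omega,t))\,\phi_{\omega,t}(dx),$$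 where the right-hand side is understood as $0$ at points $(\omega,t)$ with $\int_E|Z_{\omega,t}(x)|\,\phi_{\omega,t}(dx)=\infty$. Solution of the BSDE: a pair $(Y,Z)$ with $Y$ adapted c\`adl\`ag, $Z$ predictable on $\Omega\times[0,T]\times E$, $\int_0^T\int_E|Z(t,x)|\,\nu(dt,dx)<\infty$ a.s., such that the equation holds for all $t\in[0,T]$ outside a $\mathbb{P}$-null set. $\mathcal{L}^1_{\alpha,\beta}$ is the set of pairs $(Y,Z)$, $Y$ c\`adl\`ag adapted and $Z$ predictable, with $\mathbb{E}\bigl(\int_0^T\int_E(|Y_t|+|Z(t,x)|)e^{\beta A_t}\alpha^{N_t}\,\nu(dt,dx)\bigr)<\infty$. *)

theory Defs
  imports "HOL-Probability.Probability"
begin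

text \<open>
  A Lusin space is a Hausdorff space whose topology is coarser than some Polish topology on the
  same set.  (Borel subsets of compact metrizable spaces are of this kind.)
\<close>

definition lusin_space :: "'e topology \<Rightarrow> bool" where
  "lusin_space X \<longleftrightarrow> Hausdorff_space X \<and>
     (\<exists>X'. topspace X' = topspace X \<and> (\<forall>V. openin X V \<longrightarrow> openin X' V) \<and>
           completely_metrizable_space X' \<and> second_countable X')"

definition cadlag_on :: "real \<Rightarrow> (real \<Rightarrow> real) \<Rightarrow> bool" where
  "cadlag_on T f \<longleftrightarrow>
     (\<forall>t\<in>{0..<T}. (f \<longlongrightarrow> f t) (at_right t)) \<and> (\<forall>t\<in>{0<..T}. \<exists>y. (f \<longlongrightarrow> y) (at_left t))"

text \<open>
  The points are indexed by \<open>n \<ge> 1\<close>; \<open>S 0\<close> is the constant \<open>0\<close> and \<open>X 0\<close> is never used.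
  Times take values in \<^typ>\<open>ennreal\<close>, so that \<open>\<infinity>\<close> is available and the library's
  stopping times can be used.
\<close>

locale marked_point_process = prob_space M
  for M :: "'a measure" +
  fixes T :: real
    and \<Delta> :: "'e :: topological_space"
    and S :: "nat \<Rightarrow> 'a \<Rightarrow> ennreal"
    and X :: "nat \<Rightarrow> 'a \<Rightarrow> 'e"
  assumes T_pos: "0 < T"
    and lusin: "lusin_space (euclidean :: 'e topology)"
    and S_0: "\<And>\<omega>. \<omega> \<in> space M \<Longrightarrow> S 0 \<omega> = 0"
    and S_measurable: "\<And>n. 1 \<le> n \<Longrightarrow> S n \<in> M \<rightarrow>\<^sub>M borel"
    and X_measurable: "\<And>n. 1 \<le> n \<Longrightarrow> X n \<in> M \<rightarrow>\<^sub>M borel"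
    and S_range: "\<And>n \<omega>. 1 \<le> n \<Longrightarrow> \<omega> \<in> space M \<Longrightarrow> S n \<omega> \<in> {0<..ennreal T} \<union> {\<infinity>}"
    and S_mono: "\<And>n \<omega>. 1 \<le> n \<Longrightarrow> \<omega> \<in> space M \<Longrightarrow> S n \<omega> \<le> S (Suc n) \<omega>"
    and S_strict: "\<And>n \<omega>. 1 \<le> n \<Longrightarrow> \<omega> \<in> space M \<Longrightarrow> S n \<omega> \<le> ennreal T \<Longrightarrow> S n \<omega> < S (Suc n) \<omega>"
    and X_infinity: "\<And>n \<omega>. 1 \<le> n \<Longrightarrow> \<omega> \<in> space M \<Longrightarrow> S n \<omega> = \<infinity> \<Longrightarrow> X n \<omega> = \<Delta>"
    and nonexplosive: "\<And>\<omega>. \<omega> \<in> space M \<Longrightarrow> \<exists>n\<ge>1. ennreal T < S n \<omega>"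
begin

text \<open>
  The filtration generated by the point process; the lemmas below show that it is the smallest one
  for which every \<open>S n\<close> is a stopping time and \<open>X n\<close> is measurable at time \<open>S n\<close>.
\<close>

definition history :: "ennreal \<Rightarrow> 'a measure" where
  "history t = sigma (space M)
     {{\<omega> \<in> space M. S n \<omega> \<le> s \<and> X n \<omega> \<in> B} | n s B. 1 \<le> n \<and> s \<le> t \<and> B \<in> sets borel}"

lemma space_history [simp]: "space (history t) = space M"
  unfolding history_def by (rule space_measure_of) auto

lemma sets_history:
  "sets (history t) = sigma_sets (space M)
     {{\<omega> \<in> space M. S n \<omega> \<le> s \<and> X n \<omega> \<in> B} | n s B. 1 \<le> n \<and> s \<le> t \<and> B \<in> sets borel}"
  unfolding history_def by (rule sets_measure_of) auto

lemma history_generator: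
  "1 \<le> n \<Longrightarrow> s \<le> t \<Longrightarrow> B \<in> sets borel \<Longrightarrow> {\<omega> \<in> space M. S n \<omega> \<le> s \<and> X n \<omega> \<in> B} \<in> sets (history t)"
  unfolding sets_history by (rule sigma_sets.Basic) blast

sublocale filtration "space M" history
proof
  show "space (history i) = space M" for i by simp
next
  fix i j :: ennreal assume "i \<le> j"
  then show "sets (history i) \<subseteq> sets (history j)"
    unfolding sets_history by (intro sigma_sets_mono') (blast intro: order_trans)
qed

lemma stopping_time_S: "stopping_time history (S n)"
proof (cases "n = 0")
  case True
  then show ?thesis
    using stopping_time_cong[of history "S n" "\<lambda>_. 0"] stopping_time_const[of history 0] S_0
    by simp
next
  case False
  then show ?thesis
    using history_generator[of n _ _ UNIV] by (intro stopping_timeI) (simp add: pred_def)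
qed

lemma measurable_X_pre_sigma: "1 \<le> n \<Longrightarrow> X n \<in> pre_sigma (S n) \<rightarrow>\<^sub>M borel"
proof (rule measurableI)
  fix B :: "'e set" assume n: "1 \<le> n" and B: "B \<in> sets borel"
  have "{\<omega> \<in> X n -` B \<inter> space (pre_sigma (S n)). S n \<omega> \<le> t}
      = {\<omega> \<in> space M. S n \<omega> \<le> t \<and> X n \<omega> \<in> B}" for t
    by (auto simp: space_pre_sigma)
  then show "X n -` B \<inter> space (pre_sigma (S n)) \<in> sets (pre_sigma (S n))"
    using history_generator[OF n _ B] by (intro sets_pre_sigmaI stopping_time_S) auto
qed simp

lemma history_least:
  assumes G: "filtration (space M) G"
    and S: "\<And>n. 1 \<le> n \<Longrightarrow> stopping_time G (S n)"
    and X: "\<And>n. 1 \<le> n \<Longrightarrow> X n \<in> filtration.pre_sigma (space M) G (S n) \<rightarrow>\<^sub>M borel"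
  shows "sets (history t) \<subseteq> sets (G t)"
proof -
  interpret G: filtration "space M" G by fact
  have "{\<omega> \<in> space M. S n \<omega> \<le> s \<and> X n \<omega> \<in> B} \<in> sets (G t)"
    if "1 \<le> n" "s \<le> t" "B \<in> sets borel" for n s B
  proof -
    have "X n -` B \<inter> space M \<in> sets (G.pre_sigma (S n))"
      using measurable_sets[OF X[OF that(1)] that(3)] by (simp add: G.space_pre_sigma)
    then have "{\<omega> \<in> X n -` B \<inter> space M. S n \<omega> \<le> s} \<in> sets (G s)"
      by (rule G.sets_pre_sigmaD[OF S[OF that(1)]])
    also have "{\<omega> \<in> X n -` B \<inter> space M. S n \<omega> \<le> s} = {\<omega> \<in> space M. S n \<omega> \<le> s \<and> X n \<omega> \<in> B}"
      by auto
    finally show ?thesis using G.sets_F_mono[OF that(2)] by auto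
  qed
  then have "sigma_sets (space (G t))
      {{\<omega> \<in> space M. S n \<omega> \<le> s \<and> X n \<omega> \<in> B} | n s B. 1 \<le> n \<and> s \<le> t \<and> B \<in> sets borel} \<subseteq> sets (G t)"
    by (intro sets.sigma_sets_subset) auto
  then show ?thesis by (simp add: sets_history G.space_F)
qed

definition predictable_sigma :: "('a \<times> real) measure" where
  "predictable_sigma = sigma (space M \<times> {0..T})
     ({B \<times> {0} | B. B \<in> sets (history 0)} \<union>
      {B \<times> {s<..t} | s t B. 0 \<le> s \<and> s < t \<and> t \<le> T \<and> B \<in> sets (history (ennreal s))})"

definition predictable_process :: "'b measure \<Rightarrow> ('a \<Rightarrow> real \<Rightarrow> 'b) \<Rightarrow> bool" where
  "predictable_process N V \<longleftrightarrow> (\<lambda>(\<omega>, t). V \<omega> t) \<in> predictable_sigma \<rightarrow>\<^sub>M N"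

definition predictable_function :: "'g measure \<Rightarrow> ('a \<Rightarrow> real \<Rightarrow> 'g \<Rightarrow> real) \<Rightarrow> bool" where
  "predictable_function G H \<longleftrightarrow>
     (\<lambda>((\<omega>, t), g). H \<omega> t g) \<in> predictable_sigma \<Otimes>\<^sub>M G \<rightarrow>\<^sub>M borel"

definition adapted_process :: "('a \<Rightarrow> real \<Rightarrow> real) \<Rightarrow> bool" where
  "adapted_process V \<longleftrightarrow> (\<forall>t\<in>{0..T}. (\<lambda>\<omega>. V \<omega> t) \<in> history (ennreal t) \<rightarrow>\<^sub>M borel)"

definition mark_space :: "(real \<times> 'e) measure" where
  "mark_space = restrict_space borel {0..T} \<Otimes>\<^sub>M borel"

text \<open>
  The random measure of the process: the push-forward of counting measure on the set of indices
  is the sum of the Dirac measures at the points.  The counting process \<open>N\<close> is real valued because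
  it is a measure of a set, so powers with exponent \<open>N\<close> are written with \<^const>\<open>powr\<close>.
\<close>

definition \<mu> :: "'a \<Rightarrow> (real \<times> 'e) measure" where
  "\<mu> \<omega> = distr (count_space {n. 1 \<le> n \<and> S n \<omega> \<le> ennreal T}) mark_space
            (\<lambda>n. (enn2real (S n \<omega>), X n \<omega>))"

definition N :: "'a \<Rightarrow> real \<Rightarrow> real" where
  "N \<omega> t = measure (\<mu> \<omega>) ({0..t} \<times> UNIV)"

end

definition stieltjes_measure :: "real \<Rightarrow> (real \<Rightarrow> real) \<Rightarrow> real measure" where
  "stieltjes_measure T a = restrict_space (interval_measure (\<lambda>t. a (max 0 (min T t)))) {0..T}"

definition disintegrated_measure ::
    "real \<Rightarrow> ('a \<Rightarrow> real \<Rightarrow> real) \<Rightarrow> ('a \<Rightarrow> real \<Rightarrow> 'e::topological_space measure) \<Rightarrow> 'a \<Rightarrow> (real \<times> 'e) measure" where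
  "disintegrated_measure T A \<phi> \<omega> = stieltjes_measure T (A \<omega>) \<bind>
     (\<lambda>t. distr (\<phi> \<omega> t) (restrict_space borel {0..T} \<Otimes>\<^sub>M borel) (Pair t))"

text \<open>
  A random measure of the form \<open>dA\<^sub>t \<phi>\<^sub>t(dx)\<close> with \<open>A\<close> and \<open>\<phi>\<close> predictable is predictable; it is the
  compensator of \<open>\<mu>\<close> iff it gives every nonnegative predictable function the same expected integral.
\<close>

locale compensated_point_process = marked_point_process M T \<Delta> S X
  for M :: "'a measure" and T and \<Delta> :: "'e :: topological_space" and S X +
  fixes A :: "'a \<Rightarrow> real \<Rightarrow> real"
    and \<phi> :: "'a \<Rightarrow> real \<Rightarrow> 'e measure"
  assumes A_predictable: "predictable_process borel A"
    and A_0: "\<And>\<omega>. \<omega> \<in> space M \<Longrightarrow> A \<omega> 0 = 0"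
    and A_mono: "\<And>\<omega>. \<omega> \<in> space M \<Longrightarrow> mono_on {0..T} (A \<omega>)"
    and A_cadlag: "\<And>\<omega>. \<omega> \<in> space M \<Longrightarrow> cadlag_on T (A \<omega>)"
    and \<phi>_kernel: "predictable_process (prob_algebra borel) \<phi>"
    and compensator: "\<And>H :: ('a \<times> real) \<times> 'e \<Rightarrow> ennreal.
      H \<in> predictable_sigma \<Otimes>\<^sub>M borel \<rightarrow>\<^sub>M borel \<Longrightarrow>
      (\<integral>\<^sup>+\<omega>. (\<integral>\<^sup>+(t, x). H ((\<omega>, t), x) \<partial>\<mu> \<omega>) \<partial>M) =
      (\<integral>\<^sup>+\<omega>. (\<integral>\<^sup>+(t, x). H ((\<omega>, t), x) \<partial>disintegrated_measure T A \<phi> \<omega>) \<partial>M)"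
begin

abbreviation dA :: "'a \<Rightarrow> real measure" where
  "dA \<omega> \<equiv> stieltjes_measure T (A \<omega>)"

abbreviation \<nu> :: "'a \<Rightarrow> (real \<times> 'e) measure" where
  "\<nu> \<equiv> disintegrated_measure T A \<phi>"

definition assumption_A :: bool where
  "assumption_A \<longleftrightarrow>
     (\<forall>\<omega>\<in>space M. continuous_on {0..T} (A \<omega>)) \<and>
     (\<forall>n. AE \<omega> in M. 0 < real_cond_exp M (pre_sigma (S n))
            (indicator {\<omega>' \<in> space M. ennreal T < S (Suc n) \<omega>'}) \<omega>)"

definition weighted_L1 :: "real \<Rightarrow> real \<Rightarrow> (('a \<Rightarrow> real \<Rightarrow> real) \<times> ('a \<Rightarrow> real \<Rightarrow> 'e \<Rightarrow> real)) set" where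
  "weighted_L1 \<alpha> \<beta> = {(Y, Z).
     adapted_process Y \<and> (\<forall>\<omega>\<in>space M. cadlag_on T (Y \<omega>)) \<and> predictable_function borel Z \<and>
     (\<integral>\<^sup>+\<omega>. (\<integral>\<^sup>+(t, x). ennreal ((\<bar>Y \<omega> t\<bar> + \<bar>Z \<omega> t x\<bar>) * exp (\<beta> * A \<omega> t) * \<alpha> powr N \<omega> t) \<partial>\<nu> \<omega>) \<partial>M) < \<infinity>}"

end

locale control_problem = compensated_point_process M T \<Delta> S X A \<phi>
  for M :: "'a measure" and T and \<Delta> :: "'e :: topological_space" and S X A \<phi> +
  fixes \<xi> :: "'a \<Rightarrow> real"
    and U :: "'u measure"
    and r :: "'a \<Rightarrow> real \<Rightarrow> 'e \<Rightarrow> 'u \<Rightarrow> real"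
    and l :: "'a \<Rightarrow> real \<Rightarrow> 'u \<Rightarrow> real"
  assumes \<xi>_measurable: "\<xi> \<in> history (ennreal T) \<rightarrow>\<^sub>M borel"
    and r_predictable: "predictable_function (borel \<Otimes>\<^sub>M U) (\<lambda>\<omega> t (x, u). r \<omega> t x u)"
    and l_predictable: "predictable_function U l"
begin

text \<open>
  Infima and suprema over the action space are taken in the extended reals; the integrals of the
  possibly non-measurable functions \<open>inf l\<close> and \<open>sup \<bar>l\<bar>\<close> are lower integrals.
\<close>

definition assumption_B :: "real \<Rightarrow> real \<Rightarrow> real \<Rightarrow> bool" where
  "assumption_B C \<alpha> \<beta> \<longleftrightarrow>
     0 < C \<and>
     (\<forall>\<omega>\<in>space M. \<forall>t\<in>{0..T}. \<forall>x. \<forall>u\<in>space U. 0 \<le> r \<omega> t x u \<and> r \<omega> t x u \<le> C) \<and>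
     (\<integral>\<^sup>+\<omega>. ennreal (exp (A \<omega> T) * C powr N \<omega> T) \<partial>M) < \<infinity> \<and>
     1 \<le> \<alpha> \<and> C < \<alpha> \<and> 1 + C < \<beta> \<and>
     (\<integral>\<^sup>+\<omega>. (ennreal (exp (\<beta> * A \<omega> T) * \<alpha> powr N \<omega> T * \<bar>\<xi> \<omega>\<bar>)
        + (\<integral>\<^sup>+s. ennreal (exp (\<beta> * A \<omega> s) * \<alpha> powr N \<omega> s) *
                  e2ennreal \<bar>INF u\<in>space U. ereal (l \<omega> s u)\<bar> \<partial>dA \<omega>)
        + (\<integral>\<^sup>+s. ennreal (exp (A \<omega> s) * C powr N \<omega> s) *
                  (SUP u\<in>space U. ennreal \<bar>l \<omega> s u\<bar>) \<partial>dA \<omega>)) \<partial>M) < \<infinity>"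

definition admissible :: "('a \<Rightarrow> real \<Rightarrow> 'u) set" where
  "admissible = {u. predictable_process U u}"

definition L :: "('a \<Rightarrow> real \<Rightarrow> 'u) \<Rightarrow> 'a \<Rightarrow> real \<Rightarrow> real" where
  "L u \<omega> t =
     exp (set_lebesgue_integral (\<nu> \<omega>) ({0<..t} \<times> UNIV) (\<lambda>(s, x). 1 - r \<omega> s x (u \<omega> s))) *
     (\<Prod>n | 1 \<le> n \<and> S n \<omega> \<le> ennreal t.
        r \<omega> (enn2real (S n \<omega>)) (X n \<omega>) (u \<omega> (enn2real (S n \<omega>))))"

definition controlled_prob :: "('a \<Rightarrow> real \<Rightarrow> 'u) \<Rightarrow> 'a measure" where
  "controlled_prob u = density M (\<lambda>\<omega>. ennreal (L u \<omega> T))"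

definition cost :: "('a \<Rightarrow> real \<Rightarrow> 'u) \<Rightarrow> real" where
  "cost u = (LINT \<omega>|controlled_prob u. (LINT t|dA \<omega>. l \<omega> t (u \<omega> t)) + \<xi> \<omega>)"

definition optimal :: "('a \<Rightarrow> real \<Rightarrow> 'u) \<Rightarrow> bool" where
  "optimal u \<longleftrightarrow> u \<in> admissible \<and> (\<forall>v\<in>admissible. cost u \<le> cost v)"

definition hamiltonian :: "'a \<Rightarrow> real \<Rightarrow> ('e \<Rightarrow> real) \<Rightarrow> ereal" where
  "hamiltonian \<omega> t \<zeta> =
     (if integrable (\<phi> \<omega> t) \<zeta>
      then (INF u\<in>space U. ereal (l \<omega> t u + (LINT x|\<phi> \<omega> t. \<zeta> x * r \<omega> t x u)))
      else 0)"

text \<open>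
  The admissible controls \<open>u\<close> that may serve as the process attaining the infimum along \<open>Z\<close>.
  The nested quantifiers express ``\<open>dA\<^sub>t(\<omega>) P(d\<omega>)\<close>-almost everywhere''.
\<close>

definition hamiltonian_minimizer :: "('a \<Rightarrow> real \<Rightarrow> 'e \<Rightarrow> real) \<Rightarrow> ('a \<Rightarrow> real \<Rightarrow> 'u) \<Rightarrow> bool" where
  "hamiltonian_minimizer Z u \<longleftrightarrow> u \<in> admissible \<and>
     (AE \<omega> in M. AE t in dA \<omega>. hamiltonian \<omega> t (Z \<omega> t) =
        ereal (if integrable (\<phi> \<omega> t) (Z \<omega> t)
               then l \<omega> t (u \<omega> t) + (LINT x|\<phi> \<omega> t. Z \<omega> t x * r \<omega> t x (u \<omega> t))
               else 0))"

definition assumption_C :: bool where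
  "assumption_C \<longleftrightarrow> (\<forall>Z. predictable_function borel Z \<longrightarrow> (\<exists>u. hamiltonian_minimizer Z u))"

text \<open>
  The Hamiltonian along \<open>Z\<close> is only known to agree \<open>dA\<close>-almost everywhere with a measurable
  function, hence the completion of \<open>dA\<close>.
\<close>

definition bsde_solution :: "('a \<Rightarrow> real \<Rightarrow> real) \<Rightarrow> ('a \<Rightarrow> real \<Rightarrow> 'e \<Rightarrow> real) \<Rightarrow> bool" where
  "bsde_solution Y Z \<longleftrightarrow>
     adapted_process Y \<and> (\<forall>\<omega>\<in>space M. cadlag_on T (Y \<omega>)) \<and> predictable_function borel Z \<and>
     (AE \<omega> in M. (\<integral>\<^sup>+(t, x). ennreal \<bar>Z \<omega> t x\<bar> \<partial>\<nu> \<omega>) < \<infinity>) \<and>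
     (AE \<omega> in M. \<forall>t\<in>{0..T}.
        Y \<omega> t + set_lebesgue_integral (\<mu> \<omega>) ({t<..T} \<times> UNIV) (\<lambda>(s, x). Z \<omega> s x) =
        \<xi> \<omega> + set_lebesgue_integral (completion (dA \<omega>)) {t<..T}
                 (\<lambda>s. real_of_ereal (hamiltonian \<omega> s (Z \<omega> s))))"

end

end

theory Submission
  imports Defs
begin

text \<open>
  Why the value of the backward equation is the minimal cost.  Fix an admissible control \<open>u\<close> and
  write \<open>\<rho>\<close> for the rate \<open>r(s, x, u\<^sub>s)\<close>.  Under the controlled probability the compensator of \<open>\<mu>\<close> is
  \<open>\<rho> \<nu>\<close>, so the expectation of \<open>\<integral> Z d\<mu>\<close> equals that of \<open>\<integral> Z \<rho> d\<nu>\<close>.  The equation at time \<open>0\<close> then says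
  that \<open>Y\<^sub>0\<close>, which is deterministic because nothing is observed at time \<open>0\<close>, is the controlled
  expectation of \<open>\<xi> + \<integral> (f(s, Z\<^sub>s) - \<integral> Z \<rho> d\<phi>) dA\<close>.  As \<open>f\<close> is the infimum of
  \<open>l(s, u) + \<integral> Z r(s, x, u) d\<phi>\<close>, the integrand is at most \<open>l(s, u\<^sub>s)\<close>, with equality for the minimizing
  control.  Hence \<open>Y\<^sub>0\<close> is at most the cost of \<open>u\<close>, and it equals the cost of \<open>u_star\<close>; this is
  \<open>solution_le_payoff\<close> together with \<open>verification\<close>.

  The main work is the change of intensity: the density has mean one (\<open>density_mean\<close>) and changes the
  compensator (\<open>change_of_intensity_\<mu>\<close>, \<open>change_of_intensity_\<nu>\<close>, \<open>girsanov\<close>).  Pathwise the density \<open>L\<close>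
  solves the Doleans-Dade equation \<open>dL = L\<^sub>- (\<rho> - 1) (d\<mu> - d\<nu>)\<close> (\<open>doleans_equation\<close>).  To pass to
  expectations one writes the equation between \<open>t\<close> and \<open>T\<close>, integrates it against \<open>H\<^sub>t\<close> for a
  predictable \<open>H \<ge> 0\<close> with respect to \<open>\<mu>\<close> or \<open>\<nu>\<close>, and exchanges the order of integration.  The increments of \<open>L\<close>
  are thereby integrated against the predictable processes \<open>\<integral>\<^bsub>(0,s)\<^esub> H\<close>, and the defining property of the
  compensator cancels the \<open>\<mu>\<close>- and \<open>\<nu>\<close>-parts, provided that they are finite.

  Finiteness is the point where the assumptions on the survival probabilities enter.  Between two consecutive
  points the history is generated by the past points (\<open>history_between_jumps\<close>), so the increase of \<open>A\<close>
  up to the next point is bounded by a quantity known at the last point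
  (\<open>bounded_hazard_sets\<close>).  Therefore, given the history at \<open>S n\<close>, the mean of \<open>exp (A\<^sub>T - A\<^bsub>S n\<^esub>)\<close> on the
  event of no further point is one (\<open>survival_identity\<close>).  Summing over \<open>n\<close> with weights \<open>C\<^sup>n\<close> turns
  \<open>E (exp A\<^sub>T C^N\<^sub>T) < \<infinity>\<close> into \<open>E \<integral> exp A\<^sub>s C^N\<^sub>s dA\<^sub>s < \<infinity>\<close> (\<open>exp_A_power_count_integrable\<close>), and
  \<open>exp A\<^sub>s C^N\<^sub>s\<close> dominates \<open>L\<^sub>s\<close>.  For \<open>C < 1\<close> this cannot be seen
  pathwise, because \<open>exp A\<^sub>s C^N\<^sub>s\<close> need not be bounded by its value at \<open>T\<close>.
\<close>

section \<open>Jump times, marks and the jump measure\<close>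

lemma ennreal_less_rational_between:
  assumes "a < ennreal t"
  obtains q where "q \<in> \<rat>" "0 \<le> q" "q < t" "a \<le> ennreal q"
proof -
  have fin: "a = ennreal (enn2real a)" using assms by (cases a) auto
  have lt: "enn2real a < t"
    using assms by (subst (asm) fin) (simp add: ennreal_less_iff)
  obtain q where q: "q \<in> \<rat>" "enn2real a < q" "q < t" using Rats_dense_in_real[OF lt] by blast
  have "0 \<le> q" using q(2) enn2real_nonneg[of a] by linarith
  moreover have "a \<le> ennreal q" by (subst fin) (use q in \<open>auto intro!: ennreal_leI\<close>)
  ultimately show ?thesis using that q by blast
qed

context marked_point_process
begin

lemma S_less_S_Suc:
  assumes "\<omega> \<in> space M" "S n \<omega> \<le> ennreal T"
  shows "S n \<omega> < S (Suc n) \<omega>"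
proof (cases n)
  case 0
  then show ?thesis using S_range[of "Suc 0" \<omega>] assms S_0 by auto
next
  case (Suc m)
  then show ?thesis using S_strict assms by auto
qed

lemma S_incseq:
  assumes \<omega>: "\<omega> \<in> space M" and "i \<le> j"
  shows "S i \<omega> \<le> S j \<omega>"
  using assms(2)
proof (induction j rule: dec_induct)
  case (step j)
  have "S j \<omega> \<le> S (Suc j) \<omega>"
    using S_mono[of j \<omega>] S_0[of \<omega>] \<omega> by (cases j) auto
  then show ?case using step by auto
qed simp

lemma S_less_S:
  assumes "\<omega> \<in> space M" "i < j" "S i \<omega> \<le> ennreal T"
  shows "S i \<omega> < S j \<omega>"
  using S_less_S_Suc[OF assms(1,3)] S_incseq[OF assms(1), of "Suc i" j] assms(2) by auto

definition jumps :: "'a \<Rightarrow> nat set" where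
  "jumps \<omega> = {n. 1 \<le> n \<and> S n \<omega> \<le> ennreal T}"

text \<open>
  Points at infinity get the value \<open>0\<close>; the function is only meant for indices in \<open>jumps\<close>, and for
  \<open>n = 0\<close>.
\<close>

definition time :: "nat \<Rightarrow> 'a \<Rightarrow> real" where
  "time n \<omega> = enn2real (S n \<omega>)"

lemma finite_jumps: "\<omega> \<in> space M \<Longrightarrow> finite (jumps \<omega>)"
proof -
  assume \<omega>: "\<omega> \<in> space M"
  obtain n where n: "n \<ge> 1" "ennreal T < S n \<omega>" using nonexplosive[OF \<omega>] by blast
  have "jumps \<omega> \<subseteq> {..<n}"
    unfolding jumps_def using n S_incseq[OF \<omega>, of n] by (force simp: not_le[symmetric])
  then show ?thesis by (rule finite_subset) simp
qed

lemma S_eq_time: "S n \<omega> \<le> ennreal t \<Longrightarrow> S n \<omega> = ennreal (time n \<omega>)"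
  unfolding time_def by (cases "S n \<omega>") (auto simp: top_unique)

lemma time_nonneg: "0 \<le> time n \<omega>" unfolding time_def by simp

lemma time_le: "0 \<le> t \<Longrightarrow> S n \<omega> \<le> ennreal t \<Longrightarrow> time n \<omega> \<le> t"
  using S_eq_time[of n \<omega> t] by (simp add: time_nonneg ennreal_le_iff)

lemma time_less: "S n \<omega> < ennreal t \<Longrightarrow> time n \<omega> < t"
  using S_eq_time[of n \<omega> t] by (metis ennreal_less_iff less_imp_le time_nonneg)

lemma S_le_iff: "0 \<le> t \<Longrightarrow> n \<in> jumps \<omega> \<Longrightarrow> S n \<omega> \<le> ennreal t \<longleftrightarrow> time n \<omega> \<le> t"
  using S_eq_time[of n \<omega> T] by (auto simp: jumps_def time_nonneg ennreal_le_iff)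

lemma S_less_iff: "n \<in> jumps \<omega> \<Longrightarrow> S n \<omega> < ennreal t \<longleftrightarrow> time n \<omega> < t"
  using S_eq_time[of n \<omega> T] by (auto simp: jumps_def time_nonneg ennreal_less_iff)

lemma less_S_iff: "0 \<le> t \<Longrightarrow> n \<in> jumps \<omega> \<Longrightarrow> ennreal t < S n \<omega> \<longleftrightarrow> t < time n \<omega>"
  using S_eq_time[of n \<omega> T] by (auto simp: jumps_def time_nonneg ennreal_less_iff)

lemma time_jumps: 
  assumes "\<omega> \<in> space M" "n \<in> jumps \<omega>"
  shows "0 < time n \<omega>" "time n \<omega> \<le> T"
  using assms S_range[of n \<omega>] S_eq_time[of n \<omega> T] time_le[of T n \<omega>] T_pos time_nonneg[of n \<omega>]
  by (auto simp: jumps_def ennreal_less_iff)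

lemma jumps_downward: "\<omega> \<in> space M \<Longrightarrow> n \<in> jumps \<omega> \<Longrightarrow> 1 \<le> m \<Longrightarrow> m \<le> n \<Longrightarrow> m \<in> jumps \<omega>"
  unfolding jumps_def using S_incseq by (auto intro: order_trans)

lemma time_strict: "\<omega> \<in> space M \<Longrightarrow> n \<in> jumps \<omega> \<Longrightarrow> m \<in> jumps \<omega> \<Longrightarrow> time m \<omega> < time n \<omega> \<longleftrightarrow> m < n"
proof -
  assume \<omega>: "\<omega> \<in> space M" and n: "n \<in> jumps \<omega>" and m: "m \<in> jumps \<omega>"
  have "S m \<omega> < S n \<omega> \<longleftrightarrow> m < n"
    using S_less_S[OF \<omega>, of m n] S_incseq[OF \<omega>, of n m] n m unfolding jumps_def
    by (metis mem_Collect_eq not_le)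
  then show ?thesis
    using S_eq_time[of n \<omega> T] S_eq_time[of m \<omega> T] n m
    by (auto simp: jumps_def ennreal_less_iff time_nonneg)
qed

lemma jumpsI: "1 \<le> n \<Longrightarrow> S n \<omega> < ennreal t \<Longrightarrow> t \<le> T \<Longrightarrow> n \<in> jumps \<omega>"
  unfolding jumps_def using order.trans[OF less_imp_le ennreal_leI, of "S n \<omega>" t T] by simp

lemma space_mark_space: "space mark_space = {0..T} \<times> UNIV"
  by (simp add: mark_space_def space_pair_measure space_restrict_space)

lemma sets_\<mu> [simp, measurable_cong]: "sets (\<mu> \<omega>) = sets mark_space"
  and space_\<mu>: "space (\<mu> \<omega>) = {0..T} \<times> UNIV"
  by (simp_all add: \<mu>_def space_mark_space)

lemma jump_map_measurable:
  "\<omega> \<in> space M \<Longrightarrow> (\<lambda>n. (enn2real (S n \<omega>), X n \<omega>)) \<in> count_space {n. 1 \<le> n \<and> S n \<omega> \<le> ennreal T} \<rightarrow>\<^sub>M mark_space"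
  using time_jumps by (auto simp: space_mark_space jumps_def time_def less_imp_le)

lemma nn_integral_\<mu>:
  assumes "\<omega> \<in> space M" "f \<in> borel_measurable mark_space"
  shows "(\<integral>\<^sup>+z. f z \<partial>\<mu> \<omega>) = (\<Sum>n\<in>jumps \<omega>. f (time n \<omega>, X n \<omega>))"
  unfolding \<mu>_def using finite_jumps[OF assms(1)] assms
  by (subst nn_integral_distr[OF jump_map_measurable])
     (simp_all add: nn_integral_count_space_finite jumps_def time_def)

lemma finite_measure_\<mu>: "\<omega> \<in> space M \<Longrightarrow> finite_measure (\<mu> \<omega>)"
proof
  assume \<omega>: "\<omega> \<in> space M"
  have "emeasure (\<mu> \<omega>) (space (\<mu> \<omega>)) = (\<integral>\<^sup>+z. 1 \<partial>\<mu> \<omega>)" by simp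
  also have "\<dots> = (\<Sum>n\<in>jumps \<omega>. 1)" using nn_integral_\<mu>[OF \<omega>, of "\<lambda>_. 1"] by simp
  finally show "emeasure (\<mu> \<omega>) (space (\<mu> \<omega>)) \<noteq> \<infinity>" by simp
qed

lemma integrable_\<mu>:
  fixes f :: "_ \<Rightarrow> real"
  assumes "\<omega> \<in> space M" "f \<in> borel_measurable mark_space"
  shows "integrable (\<mu> \<omega>) f"
    and "(\<integral>z. f z \<partial>\<mu> \<omega>) = (\<Sum>n\<in>jumps \<omega>. f (time n \<omega>, X n \<omega>))"
proof -
  show "integrable (\<mu> \<omega>) f"
    unfolding \<mu>_def using finite_jumps[OF assms(1)] assms
    by (subst integrable_distr_eq[OF jump_map_measurable])
       (simp_all add: integrable_count_space jumps_def)
  show "(\<integral>z. f z \<partial>\<mu> \<omega>) = (\<Sum>n\<in>jumps \<omega>. f (time n \<omega>, X n \<omega>))"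
    unfolding \<mu>_def using finite_jumps[OF assms(1)] assms
    by (subst integral_distr[OF jump_map_measurable])
       (simp_all add: lebesgue_integral_count_space_finite jumps_def time_def)
qed

lemma AE_\<mu>:
  assumes "\<omega> \<in> space M" "{z\<in>space mark_space. P z} \<in> sets mark_space"
  shows "(AE z in \<mu> \<omega>. P z) \<longleftrightarrow> (\<forall>n\<in>jumps \<omega>. P (time n \<omega>, X n \<omega>))"
  unfolding \<mu>_def using assms
  by (subst AE_distr_iff[OF jump_map_measurable]) (simp_all add: AE_count_space jumps_def time_def)

lemma N_eq_card:
  assumes "\<omega> \<in> space M" "t \<in> {0..T}"
  shows "N \<omega> t = card {n \<in> jumps \<omega>. time n \<omega> \<le> t}"
proof -
  have m: "{0..t} \<times> UNIV \<in> sets mark_space"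
    unfolding mark_space_def by (intro pair_measureI) (use assms in \<open>auto simp: sets_restrict_space_iff\<close>)
  interpret finite_measure "\<mu> \<omega>" by (rule finite_measure_\<mu>[OF assms(1)])
  have "N \<omega> t = (\<integral>z. indicator ({0..t} \<times> UNIV) z \<partial>\<mu> \<omega>)"
    unfolding N_def using m assms by (simp add: space_\<mu> Int_absorb2 Times_subset_cancel2)
  also have "\<dots> = (\<Sum>n\<in>jumps \<omega>. indicator ({0..t} \<times> UNIV) (time n \<omega>, X n \<omega>))"
    using m assms by (intro integrable_\<mu>(2)) auto
  also have "\<dots> = (\<Sum>n\<in>{n \<in> jumps \<omega>. time n \<omega> \<le> t}. 1)"
    using finite_jumps[OF assms(1)]
    by (intro sum.mono_neutral_cong_right) (auto simp: indicator_def time_nonneg split: if_splits)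
  finally show ?thesis by simp
qed

text \<open>
  All points are strictly later than \<open>0\<close>, so every generator of the history at time \<open>0\<close> is empty.
  This makes the initial value of an adapted process deterministic.
\<close>

lemma history_0_trivial:
  assumes "B \<in> sets (history 0)"
  shows "B = {} \<or> B = space M"
  using assms unfolding sets_history
proof (induction rule: sigma_sets.induct)
  case (Basic a)
  then obtain n s B where n: "1 \<le> n" "s \<le> 0" "a = {\<omega> \<in> space M. S n \<omega> \<le> s \<and> X n \<omega> \<in> B}" by auto
  have "S n x \<noteq> 0" if "x \<in> space M" for x using S_range[OF n(1) that] by auto
  then have "a = {}" using n by auto
  then show ?case by simp
next
  case (Union a)
  then show ?case by (cases "\<exists>i. a i = space M") auto
qed auto

lemma sets_history_subset: "sets (history t) \<subseteq> sets M"
proof -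
  have "{\<omega> \<in> space M. S n \<omega> \<le> s \<and> X n \<omega> \<in> B} \<in> sets M" if "1 \<le> n" "B \<in> sets borel" for n s B
  proof -
    note S_measurable[OF that(1), measurable] X_measurable[OF that(1), measurable]
    note that(2)[measurable]
    show ?thesis by measurable
  qed
  then show ?thesis unfolding sets_history by (intro sets.sigma_sets_subset) auto
qed

lemma measurable_history: "f \<in> history t \<rightarrow>\<^sub>M K \<Longrightarrow> f \<in> M \<rightarrow>\<^sub>M K"
  using sets_history_subset[of t] by (auto simp: measurable_def)

lemma S_measurable_all [measurable]: "S n \<in> borel_measurable M"
proof (cases "n = 0")
  case True
  then show ?thesis using S_0 by (subst measurable_cong[of M _ "\<lambda>_. 0"]) auto
qed (use S_measurable in auto)

lemma sets_pre_sigma_subset: "sets (pre_sigma (S n)) \<subseteq> sets M"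
proof
  fix B assume B: "B \<in> sets (pre_sigma (S n))"
  have "{\<omega>\<in>B. S n \<omega> \<le> top} \<in> sets (history top)"
    using sets_pre_sigmaD[OF stopping_time_S B] .
  then show "B \<in> sets M" using sets_history_subset[of top] by simp blast
qed

section \<open>Predictable sets and functions\<close>

lemma predictable_generator_subset:
  "{B \<times> {0} | B. B \<in> sets (history 0)} \<union>
    {B \<times> {s<..t} | s t B. 0 \<le> s \<and> s < t \<and> t \<le> T \<and> B \<in> sets (history (ennreal s))}
    \<subseteq> Pow (space M \<times> {0..T})" (is "?G1 \<union> ?G2 \<subseteq> _")
proof -
  have *: "B \<subseteq> space M" if "B \<in> sets (history t)" for B t
    using sets.sets_into_space[OF that] by simp
  have 1: "B \<times> {0} \<subseteq> space M \<times> {0..T}" if "B \<in> sets (history 0)" for B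
    using *[OF that] T_pos by (intro Sigma_mono) auto
  have 2: "B \<times> {s<..t} \<subseteq> space M \<times> {0..T}" if "B \<in> sets (history (ennreal s))" "0 \<le> s" "t \<le> T" for B s t
    using *[OF that(1)] that(2,3) by (intro Sigma_mono) auto
  show ?thesis
  proof (rule subsetI, rule PowI)
    fix D assume "D \<in> ?G1 \<union> ?G2"
    then show "D \<subseteq> space M \<times> {0..T}"
    proof
      assume "D \<in> ?G1"
      then obtain B where "D = B \<times> {0}" "B \<in> sets (history 0)" by (elim CollectE exE conjE)
      then show ?thesis using 1 by simp
    next
      assume "D \<in> ?G2"
      then obtain s t B where "D = B \<times> {s<..t}" "0 \<le> s" "t \<le> T" "B \<in> sets (history (ennreal s))"
        by (elim CollectE exE conjE)
      then show ?thesis using 2 by simp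
    qed
  qed
qed

lemma space_predictable [simp]: "space predictable_sigma = space M \<times> {0..T}"
  unfolding predictable_sigma_def
  by (rule space_measure_of[OF predictable_generator_subset])

lemma sets_predictable_sigma:
  "sets predictable_sigma = sigma_sets (space M \<times> {0..T})
     ({B \<times> {0} | B. B \<in> sets (history 0)} \<union>
      {B \<times> {s<..t} | s t B. 0 \<le> s \<and> s < t \<and> t \<le> T \<and> B \<in> sets (history (ennreal s))})"
  unfolding predictable_sigma_def
  by (rule sets_measure_of[OF predictable_generator_subset])

lemma predictable_rectangle:
  "0 \<le> s \<Longrightarrow> s < t \<Longrightarrow> t \<le> T \<Longrightarrow> B \<in> sets (history (ennreal s)) \<Longrightarrow> B \<times> {s<..t} \<in> sets predictable_sigma"
  unfolding sets_predictable_sigma by (rule sigma_sets.Basic) blast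

lemma measurable_predictableI:
  assumes "f \<in> space K \<rightarrow> space M \<times> {0..T}"
    and "\<And>B. B \<in> sets (history 0) \<Longrightarrow> f -` (B \<times> {0}) \<inter> space K \<in> sets K"
    and "\<And>s t B. 0 \<le> s \<Longrightarrow> s < t \<Longrightarrow> t \<le> T \<Longrightarrow> B \<in> sets (history (ennreal s)) \<Longrightarrow>
        f -` (B \<times> {s<..t}) \<inter> space K \<in> sets K"
  shows "f \<in> K \<rightarrow>\<^sub>M predictable_sigma"
  unfolding predictable_sigma_def
  by (rule measurable_measure_of[OF predictable_generator_subset assms(1)]) (use assms(2,3) in blast)

lemma measurable_predictable_path:
  assumes "\<omega> \<in> space M"
  shows "(\<lambda>t. (\<omega>, t)) \<in> restrict_space borel {0..T} \<rightarrow>\<^sub>M predictable_sigma"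
proof (rule measurable_predictableI)
  have *: "(\<lambda>t. (\<omega>, t)) -` (B \<times> I) \<inter> {0..T} \<in> sets (restrict_space borel {0..T})"
    if "I \<in> sets borel" "I \<subseteq> {0..T}" for B I
    using that by (cases "\<omega> \<in> B") (auto simp: sets_restrict_space_iff Int_absorb2)
  show "(\<lambda>t. (\<omega>, t)) -` (B \<times> {0}) \<inter> space (restrict_space borel {0..T}) \<in> sets (restrict_space borel {0..T})" for B
    using *[of "{0}" B] T_pos by (simp add: space_restrict_space)
  show "(\<lambda>t. (\<omega>, t)) -` (B \<times> {s<..t}) \<inter> space (restrict_space borel {0..T}) \<in> sets (restrict_space borel {0..T})"
    if "0 \<le> s" "t \<le> T" for B s t
    using *[of "{s<..t}" B] that by (simp add: space_restrict_space subset_eq)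
qed (use assms in \<open>auto simp: space_restrict_space\<close>)

lemma measurable_predictable_section:
  assumes "t \<in> {0..T}"
  shows "(\<lambda>\<omega>. (\<omega>, t)) \<in> history (ennreal t) \<rightarrow>\<^sub>M predictable_sigma"
proof (rule measurable_predictableI)
  fix B assume B: "B \<in> sets (history 0)"
  have "B \<subseteq> space M" using sets.sets_into_space[OF B] by simp
  moreover have "B \<in> sets (history (ennreal t))" using sets_F_mono[of 0 "ennreal t"] B by auto
  ultimately show "(\<lambda>\<omega>. (\<omega>, t)) -` (B \<times> {0}) \<inter> space (history (ennreal t)) \<in> sets (history (ennreal t))"
    by (cases "t = 0") (auto simp: vimage_def Int_absorb2 Collect_conj_eq)
next
  fix a b B assume ab: "0 \<le> a" "a < b" and B: "B \<in> sets (history (ennreal a))"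
  have "B \<subseteq> space M" using sets.sets_into_space[OF B] by simp
  moreover have "B \<in> sets (history (ennreal t))" if "a < t"
    using sets_F_mono[of "ennreal a" "ennreal t"] B that by (auto simp: ennreal_leI)
  ultimately show "(\<lambda>\<omega>. (\<omega>, t)) -` (B \<times> {a<..b}) \<inter> space (history (ennreal t)) \<in> sets (history (ennreal t))"
    by (cases "a < t \<and> t \<le> b") (auto simp: vimage_def Int_absorb2 Collect_conj_eq)
qed (use assms in auto)

lemma measurable_predictable_section_M:
  "t \<in> {0..T} \<Longrightarrow> (\<lambda>\<omega>. (\<omega>, t)) \<in> M \<rightarrow>\<^sub>M predictable_sigma"
  by (rule measurable_history[OF measurable_predictable_section])

text \<open>
  What is known at the \<open>n\<close>-th point may be used by a predictable process strictly after that point: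
  the set is the union of the generating rectangles \<open>(B \<inter> {S n \<le> q}) \<times> {q<..T}\<close> over rational \<open>q\<close>.
\<close>

lemma predictable_after_jump:
  assumes "\<And>q. q \<in> \<rat> \<Longrightarrow> 0 \<le> q \<Longrightarrow> q < T \<Longrightarrow> {\<omega>\<in>B. S n \<omega> \<le> ennreal q} \<in> sets (history (ennreal q))"
    and "B \<subseteq> space M"
  shows "{z \<in> space predictable_sigma. fst z \<in> B \<and> S n (fst z) < ennreal (snd z)} \<in> sets predictable_sigma"
proof -
  have "{z \<in> space predictable_sigma. fst z \<in> B \<and> S n (fst z) < ennreal (snd z)}
      = (\<Union>q\<in>{q\<in>\<rat>. 0 \<le> q \<and> q < T}. {\<omega>\<in>B. S n \<omega> \<le> ennreal q} \<times> {q<..T})" (is "?L = ?R")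
  proof
    show "?L \<subseteq> ?R"
    proof
      fix z assume z: "z \<in> ?L"
      then obtain q where "q \<in> \<rat>" "0 \<le> q" "q < snd z" "S n (fst z) \<le> ennreal q"
        using ennreal_less_rational_between by blast
      with z show "z \<in> ?R" by (auto simp: mem_Times_iff intro!: bexI[of _ q])
    qed
    show "?R \<subseteq> ?L"
    proof
      fix z assume "z \<in> ?R"
      then obtain q where q: "0 \<le> q" "fst z \<in> B" "S n (fst z) \<le> ennreal q" "q < snd z" "snd z \<le> T"
        by (auto simp: mem_Times_iff)
      then have "ennreal q < ennreal (snd z)" by (simp add: ennreal_less_iff)
      with q(3) have "S n (fst z) < ennreal (snd z)" by (rule le_less_trans)
      with q assms(2) show "z \<in> ?L" by (auto simp: mem_Times_iff)
    qed
  qed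
  moreover have "countable {q\<in>\<rat>. 0 \<le> q \<and> q < T}"
    by (rule countable_subset[OF _ countable_rat]) auto
  ultimately show ?thesis
    by (simp only:, intro sets.countable_UN' subsetI)
       (use assms(1) in \<open>auto intro!: predictable_rectangle\<close>)
qed

lemma predictable_pre_sigma:
  assumes "B \<in> sets (pre_sigma (S n))"
  shows "{z \<in> space predictable_sigma. fst z \<in> B \<and> S n (fst z) < ennreal (snd z)} \<in> sets predictable_sigma"
proof (rule predictable_after_jump)
  show "B \<subseteq> space M" using sets.sets_into_space[OF assms] by (simp add: space_pre_sigma)
qed (rule sets_pre_sigmaD[OF stopping_time_S assms])

lemma predictable_S_less [measurable]:
  "Measurable.pred predictable_sigma (\<lambda>z. S n (fst z) < ennreal (snd z))"
proof -
  have "{z \<in> space predictable_sigma. S n (fst z) < ennreal (snd z)}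
     = {z \<in> space predictable_sigma. fst z \<in> space M \<and> S n (fst z) < ennreal (snd z)}" by auto
  then show ?thesis
    unfolding pred_def using predictable_pre_sigma[of "space M" n] sets.top[of "pre_sigma (S n)"]
    by (simp only: space_pre_sigma)
qed

text \<open>
  Evaluating a predictable function at the \<open>n\<close>-th point and its mark gives a value known at that
  point.  Restricting to \<open>S n < t\<close> turns it into a predictable process; this is the reason why
  integrals over the strict past \<open>(0, t)\<close> are predictable.
\<close>

lemma measurable_predictable_at_jump:
  assumes "1 \<le> n"
  shows "(\<lambda>z. ((fst z, time n (fst z)), X n (fst z))) \<in>
    restrict_space predictable_sigma {z. S n (fst z) < ennreal (snd z)} \<rightarrow>\<^sub>M predictable_sigma \<Otimes>\<^sub>M borel"
    (is "_ \<in> ?R \<rightarrow>\<^sub>M _")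
proof (rule measurable_Pair)
  let ?P = "{z. S n (fst z) < ennreal (snd z)}"
  have sp: "space ?R = {z \<in> space predictable_sigma. S n (fst z) < ennreal (snd z)}"
    by (auto simp: space_restrict_space)
  have *: "{z \<in> space ?R. fst z \<in> B} \<in> sets ?R" 
    if "\<And>q. q \<in> \<rat> \<Longrightarrow> 0 \<le> q \<Longrightarrow> q < T \<Longrightarrow> {\<omega>\<in>B. S n \<omega> \<le> ennreal q} \<in> sets (history (ennreal q))" "B \<subseteq> space M" for B
  proof -
    have "{z \<in> space ?R. fst z \<in> B} = {z \<in> space predictable_sigma. fst z \<in> B \<and> S n (fst z) < ennreal (snd z)}"
      by (auto simp: sp)
    moreover have "?P \<inter> space predictable_sigma \<in> sets predictable_sigma"
      using predictable_S_less[of n] unfolding pred_def by (simp add: Int_def conj_commute)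
    ultimately show ?thesis
      using predictable_after_jump[OF that] by (auto simp: sets_restrict_space_iff)
  qed
  show "(\<lambda>z. X n (fst z)) \<in> ?R \<rightarrow>\<^sub>M borel"
  proof (rule measurableI)
    fix B :: "'e set" assume B: "B \<in> sets borel"
    have "{\<omega> \<in> space M. X n \<omega> \<in> B \<and> S n \<omega> \<le> ennreal q} \<in> sets (history (ennreal q))" for q
      using history_generator[OF assms _ B, of "ennreal q" "ennreal q"] by (simp add: conj_commute)
    then have "{z \<in> space ?R. fst z \<in> {\<omega> \<in> space M. X n \<omega> \<in> B}} \<in> sets ?R"
      by (intro *) (auto simp: conj_assoc)
    also have "{z \<in> space ?R. fst z \<in> {\<omega> \<in> space M. X n \<omega> \<in> B}} = (\<lambda>z. X n (fst z)) -` B \<inter> space ?R"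
      by (auto simp: sp)
    finally show "(\<lambda>z. X n (fst z)) -` B \<inter> space ?R \<in> sets ?R" .
  qed simp
  show "(\<lambda>z. (fst z, time n (fst z))) \<in> ?R \<rightarrow>\<^sub>M predictable_sigma"
  proof (rule measurable_predictableI)
    show "(\<lambda>z. (fst z, time n (fst z))) \<in> space ?R \<rightarrow> space M \<times> {0..T}"
      by (auto simp: sp time_nonneg dest!: time_less)
  next
    fix B assume "B \<in> sets (history 0)"
    have "time n \<omega> \<noteq> 0" if "\<omega> \<in> space M" "S n \<omega> < ennreal t" "t \<le> T" for \<omega> t
      using time_jumps(1)[OF that(1) jumpsI[OF assms that(2,3)]] by simp
    then have "(\<lambda>z. (fst z, time n (fst z))) -` (B \<times> {0}) \<inter> space ?R = {}" by (auto simp: sp)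
    then show "(\<lambda>z. (fst z, time n (fst z))) -` (B \<times> {0}) \<inter> space ?R \<in> sets ?R" by (metis sets.empty_sets)
  next
    fix s t B assume st: "0 \<le> s" "s < t" "t \<le> T" and B: "B \<in> sets (history (ennreal s))"
    have BM: "B \<subseteq> space M" using sets.sets_into_space[OF B] by simp
    let ?B = "{\<omega>\<in>B. ennreal s < S n \<omega> \<and> S n \<omega> \<le> ennreal t}"
    have "{z \<in> space ?R. fst z \<in> ?B} \<in> sets ?R"
    proof (rule *)
      fix q :: real assume q: "q \<in> \<rat>" "0 \<le> q" "q < T"
      show "{\<omega> \<in> ?B. S n \<omega> \<le> ennreal q} \<in> sets (history (ennreal q))"
      proof (cases "s \<le> q")
        case True
        have [measurable]: "B \<in> sets (history (ennreal q))"
          using sets_F_mono[of "ennreal s" "ennreal q"] B True by (auto simp: ennreal_leI)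
        have [measurable]: "Measurable.pred (history (ennreal q)) (\<lambda>\<omega>. S n \<omega> \<le> ennreal s)"
           "Measurable.pred (history (ennreal q)) (\<lambda>\<omega>. S n \<omega> \<le> ennreal (min q t))"
          by (rule stopping_time_le_const[OF stopping_time_S ennreal_leI], use True in simp)+
        have "ennreal (min q t) = min (ennreal q) (ennreal t)"
          by (rule min_of_mono[symmetric]) (simp add: mono_def ennreal_leI)
        then        have "{\<omega> \<in> ?B. S n \<omega> \<le> ennreal q} = {\<omega>\<in>space (history (ennreal q)). \<omega> \<in> B \<and> \<not> S n \<omega> \<le> ennreal s \<and> S n \<omega> \<le> ennreal (min q t)}"
          using BM by (auto simp: not_le)
        also have "\<dots> \<in> sets (history (ennreal q))" by measurable
        finally show ?thesis .
      next
        case False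
        then have "ennreal q \<le> ennreal s" by (intro ennreal_leI) simp
        then have "\<not> (ennreal s < S n \<omega> \<and> S n \<omega> \<le> ennreal q)" for \<omega> by (meson leD order_trans)
        then have "{\<omega> \<in> ?B. S n \<omega> \<le> ennreal q} = {}" by blast
        then show ?thesis by (metis sets.empty_sets)
      qed
    qed (use BM in auto)
    also have "{z \<in> space ?R. fst z \<in> ?B} = (\<lambda>z. (fst z, time n (fst z))) -` (B \<times> {s<..t}) \<inter> space ?R"
    proof -
      have "n \<in> jumps (fst z)" if "z \<in> space ?R" for z
        using that jumpsI[OF assms, of "fst z" "snd z"] by (auto simp: sp)
      then have "ennreal s < S n (fst z) \<and> S n (fst z) \<le> ennreal t \<longleftrightarrow> s < time n (fst z) \<and> time n (fst z) \<le> t" 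
        if "z \<in> space ?R" for z
        using that S_le_iff[of t n "fst z"] less_S_iff[of s n "fst z"] st(1,2) by simp
      then show ?thesis unfolding vimage_def by (intro set_eqI) (simp, blast)
    qed
    finally show "(\<lambda>z. (fst z, time n (fst z))) -` (B \<times> {s<..t}) \<inter> space ?R \<in> sets ?R" .
  qed
qed

lemma measurable_predictable_compose_jump:
  assumes "1 \<le> n" and H: "H \<in> predictable_sigma \<Otimes>\<^sub>M borel \<rightarrow>\<^sub>M borel"
  shows "(\<lambda>z. if S n (fst z) < ennreal (snd z) then H ((fst z, time n (fst z)), X n (fst z)) else c)
     \<in> predictable_sigma \<rightarrow>\<^sub>M borel"
proof (subst measurable_If_restrict_space_iff, goal_cases)
  case 1
  show ?case using predictable_S_less[of n] by (simp add: pred_def)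
next
  case 2
  show ?case using measurable_compose[OF measurable_predictable_at_jump[OF assms(1)] H] by simp
qed

lemma measurable_mark_section:
  assumes "\<omega> \<in> space M" "H \<in> predictable_sigma \<Otimes>\<^sub>M borel \<rightarrow>\<^sub>M K"
  shows "(\<lambda>z. H ((\<omega>, fst z), snd z)) \<in> mark_space \<rightarrow>\<^sub>M K"
proof -
  have "(\<lambda>z. ((\<omega>, fst z), snd z)) \<in> mark_space \<rightarrow>\<^sub>M predictable_sigma \<Otimes>\<^sub>M borel"
    unfolding mark_space_def
    by (intro measurable_Pair measurable_compose[OF measurable_fst measurable_predictable_path[OF assms(1)]]
          measurable_snd)
  then show ?thesis using measurable_compose[OF _ assms(2)] by auto
qed

lemma measurable_mark_time [measurable]: "fst \<in> mark_space \<rightarrow>\<^sub>M borel"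
  unfolding mark_space_def 
  using measurable_compose[OF measurable_fst measurable_restrict_space1[OF measurable_ident_sets[OF refl]]]
  by auto

text \<open>
  A point at time \<open>t\<close> itself is not foreseeable, so only the strict past \<open>fst y < t\<close> gives a
  predictable process.
\<close>

lemma predictable_integral_\<mu>:
  assumes H: "H \<in> predictable_sigma \<Otimes>\<^sub>M borel \<rightarrow>\<^sub>M (borel :: ennreal measure)"
  shows "(\<lambda>z. \<integral>\<^sup>+y. (if fst y < snd z then H ((fst z, fst y), snd y) else 0) \<partial>\<mu> (fst z)) \<in> predictable_sigma \<rightarrow>\<^sub>M borel"
proof -
  define h where "h n z = (if S n (fst z) < ennreal (snd z) then H ((fst z, time n (fst z)), X n (fst z)) else 0)" for n z
  have [measurable]: "h n \<in> predictable_sigma \<rightarrow>\<^sub>M borel" if "1 \<le> n" for n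
    unfolding h_def by (rule measurable_predictable_compose_jump[OF that H])
  have "(\<lambda>z. \<Sum>n. h (Suc n) z) \<in> predictable_sigma \<rightarrow>\<^sub>M borel" by measurable
  moreover have "(\<integral>\<^sup>+y. (if fst y < snd z then H ((fst z, fst y), snd y) else 0) \<partial>\<mu> (fst z)) = (\<Sum>n. h (Suc n) z)"
    if z: "z \<in> space predictable_sigma" for z
  proof -
    have \<omega>: "fst z \<in> space M" and t: "0 \<le> snd z" "snd z \<le> T" using z by auto
    note measurable_mark_section[OF \<omega> H, measurable]
    have "(\<integral>\<^sup>+y. (if fst y < snd z then H ((fst z, fst y), snd y) else 0) \<partial>\<mu> (fst z))
      = (\<Sum>n\<in>jumps (fst z). if time n (fst z) < snd z then H ((fst z, time n (fst z)), X n (fst z)) else 0)"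
      by (subst nn_integral_\<mu>[OF \<omega>]) (measurable, simp cong: if_cong)
    also have "\<dots> = (\<Sum>n\<in>jumps (fst z). h n z)"
      by (intro sum.cong refl) (auto simp: h_def S_less_iff)
    also have "\<dots> = (\<Sum>n\<in>(\<lambda>n. n - 1) ` jumps (fst z). h (Suc n) z)"
      by (subst sum.reindex) (auto simp: jumps_def inj_on_def)
    also have "\<dots> = (\<Sum>n. h (Suc n) z)"
    proof (rule suminf_finite[symmetric])
      fix n assume n: "n \<notin> (\<lambda>n. n - 1) ` jumps (fst z)"
      have "Suc n \<notin> jumps (fst z)" using n by (metis diff_Suc_1 image_eqI)
      then have "\<not> S (Suc n) (fst z) < ennreal (snd z)"
        using jumpsI[of "Suc n" "fst z" "snd z"] t by auto
      then show "h (Suc n) z = 0" by (simp add: h_def)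
    qed (use finite_jumps[OF \<omega>] in simp)
    finally show ?thesis .
  qed
  ultimately show ?thesis by (subst measurable_cong) auto
qed

text \<open>
  Between two consecutive points nothing new is observed.  On \<open>S n \<le> t < S (Suc n)\<close> a generator that
  refers to a point with index at most \<open>n\<close> is known at \<open>S n\<close>, and a generator that refers to a later
  point is empty.  This is specific to the filtration generated by the point process.
\<close>

lemma history_between_jumps:
  assumes "E \<in> sets (history t)"
  shows "\<exists>E'\<in>sets (pre_sigma (S n)). \<forall>\<omega>\<in>space M. S n \<omega> \<le> t \<and> t < S (Suc n) \<omega> \<longrightarrow> (\<omega> \<in> E \<longleftrightarrow> \<omega> \<in> E')"
  using assms unfolding sets_history
proof (induction rule: sigma_sets.induct)
  case (Basic a)
  then obtain m s B where m: "1 \<le> m" "s \<le> t" "B \<in> sets borel" "a = {\<omega> \<in> space M. S m \<omega> \<le> s \<and> X m \<omega> \<in> B}" by auto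
  show ?case
  proof (cases "m \<le> n")
    case True
    have "a \<in> sets (pre_sigma (S n))"
    proof (rule sets_pre_sigmaI[OF stopping_time_S])
      fix q
      have [measurable]: "{\<omega> \<in> space M. S m \<omega> \<le> min s q \<and> X m \<omega> \<in> B} \<in> sets (history q)"
        by (rule history_generator) (use m in auto)
      have [measurable]: "Measurable.pred (history q) (\<lambda>\<omega>. S n \<omega> \<le> q)"
        by (rule stopping_timeD[OF stopping_time_S])
      have "{\<omega> \<in> a. S n \<omega> \<le> q} = {\<omega>\<in>space (history q). \<omega> \<in> {\<omega> \<in> space M. S m \<omega> \<le> min s q \<and> X m \<omega> \<in> B} \<and> S n \<omega> \<le> q}"
        using S_incseq[OF _ True] by (auto simp: m(4) intro: order_trans)
      also have "\<dots> \<in> sets (history q)" by measurable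
      finally show "{\<omega> \<in> a. S n \<omega> \<le> q} \<in> sets (history q)" .
    qed
    then show ?thesis by blast
  next
    case False
    have "\<omega> \<notin> a" if "\<omega> \<in> space M" "t < S (Suc n) \<omega>" for \<omega>
      using S_incseq[OF that(1), of "Suc n" m] False that m(2,4) by (auto simp: not_le)
    then show ?thesis by (intro bexI[of _ "{}"]) auto
  qed
next
  case (Compl a)
  then obtain E' where E': "E' \<in> sets (pre_sigma (S n))" "\<forall>\<omega>\<in>space M. S n \<omega> \<le> t \<and> t < S (Suc n) \<omega> \<longrightarrow> (\<omega> \<in> a \<longleftrightarrow> \<omega> \<in> E')" by blast
  have "space M - E' \<in> sets (pre_sigma (S n))" 
    using sets.compl_sets[OF E'(1)] by (simp add: space_pre_sigma)
  then show ?case by (rule bexI[rotated]) (use E'(2) in auto)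
next
  case (Union a)
  then obtain E' where "\<And>i. E' i \<in> sets (pre_sigma (S n))" "\<And>i. \<forall>\<omega>\<in>space M. S n \<omega> \<le> t \<and> t < S (Suc n) \<omega> \<longrightarrow> (\<omega> \<in> a i \<longleftrightarrow> \<omega> \<in> E' i)" by metis
  then show ?case by (intro bexI[of _ "\<Union>i. E' i"]) auto
qed (auto intro: bexI[of _ "{}"])

end

section \<open>Integration along the compensator\<close>

locale continuous_compensator = compensated_point_process M T \<Delta> S X A \<phi>
  for M :: "'a measure" and T and \<Delta> :: "'e :: topological_space" and S X A \<phi> +
  assumes A_continuous: "\<And>\<omega>. \<omega> \<in> space M \<Longrightarrow> continuous_on {0..T} (A \<omega>)"
begin

lemma A_le: "\<omega> \<in> space M \<Longrightarrow> 0 \<le> s \<Longrightarrow> s \<le> t \<Longrightarrow> t \<le> T \<Longrightarrow> A \<omega> s \<le> A \<omega> t"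
  using A_mono by (auto simp: mono_on_def)

lemma A_nonneg: "\<omega> \<in> space M \<Longrightarrow> 0 \<le> t \<Longrightarrow> t \<le> T \<Longrightarrow> 0 \<le> A \<omega> t"
  using A_le[of \<omega> 0 t] A_0 by simp

lemma space_dA [simp]: "space (dA \<omega>) = {0..T}"
  by (simp add: stieltjes_measure_def space_restrict_space)

lemma sets_dA [measurable_cong]: "sets (dA \<omega>) = sets (restrict_space borel {0..T})"
  unfolding stieltjes_measure_def by (intro sets_restrict_space_cong) simp

lemma emeasure_dA_Icc:
  assumes "\<omega> \<in> space M" "0 \<le> a" "a \<le> b" "b \<le> T"
  shows "emeasure (dA \<omega>) {a..b} = ennreal (A \<omega> b - A \<omega> a)"
proof -
  let ?F = "\<lambda>t. A \<omega> (max 0 (min T t))"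
  have "continuous_on UNIV ?F"
    by (rule continuous_on_compose2[OF A_continuous[OF assms(1)]])
       (use T_pos in \<open>auto intro!: continuous_intros\<close>)
  moreover have "?F x \<le> ?F y" if "x \<le> y" for x y
    using that T_pos by (intro A_le assms) auto
  ultimately have "emeasure (interval_measure ?F) {a..b} = ennreal (?F b - ?F a)"
    by (intro emeasure_interval_measure_Icc assms) auto
  then show ?thesis
    unfolding stieltjes_measure_def using assms
    by (subst emeasure_restrict_space) (auto simp: min_def max_def)
qed

lemma dA_singleton: "\<omega> \<in> space M \<Longrightarrow> emeasure (dA \<omega>) {t} = 0"
proof (cases "t \<in> {0..T}")
  case True
  assume "\<omega> \<in> space M"
  then show ?thesis using emeasure_dA_Icc[of \<omega> t t] True by simp
next
  case False
  then show ?thesis by (intro emeasure_notin_sets) (auto simp: sets_dA sets_restrict_space)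
qed

lemma sets_dA_I: "I \<in> sets borel \<Longrightarrow> I \<subseteq> {0..T} \<Longrightarrow> I \<in> sets (dA \<omega>)"
  by (auto simp: sets_dA sets_restrict_space_iff Int_absorb2)

lemma finite_measure_dA: "\<omega> \<in> space M \<Longrightarrow> finite_measure (dA \<omega>)"
  using emeasure_dA_Icc[of \<omega> 0 T] T_pos by (intro finite_measureI) simp

lemma AE_dA_neq: "\<omega> \<in> space M \<Longrightarrow> AE s in dA \<omega>. s \<noteq> t"
proof (cases "t \<in> {0..T}")
  case True
  assume "\<omega> \<in> space M"
  then show ?thesis using True
    by (intro AE_I[of _ _ "{t}"] sets_dA_I dA_singleton) auto
next
  case False
  then show ?thesis by (intro AE_I2) auto
qed

lemma AE_dA_not_finite: "\<omega> \<in> space M \<Longrightarrow> finite F \<Longrightarrow> AE s in dA \<omega>. s \<notin> F"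
  using AE_finite_allI[of F "\<lambda>t s. s \<noteq> t" "dA \<omega>"] AE_dA_neq[of \<omega>]
  by (simp add: Ball_def) (metis (mono_tags, lifting) eventually_mono)

lemma emeasure_dA_Ioo:
  assumes "\<omega> \<in> space M" "0 \<le> a" "a \<le> b" "b \<le> T"
  shows "emeasure (dA \<omega>) ({a<..<b}) = ennreal (A \<omega> b - A \<omega> a)"
proof -
  have "emeasure (dA \<omega>) {a<..<b} = emeasure (dA \<omega>) {a..b}"
    using AE_dA_not_finite[OF assms(1), of "{a,b}"] assms
    by (intro emeasure_eq_AE sets_dA_I) (auto elim: eventually_mono)
  then show ?thesis using emeasure_dA_Icc[OF assms] by simp
qed

text \<open>
  Stopping at a deterministic time maps predictable sets to predictable sets; it is applied to \<open>A\<close> in order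
  to write \<open>A\<^bsub>b\<and>t\<^esub>\<close> as a predictable process.
\<close>

lemma measurable_predictable_stop:
  assumes b: "0 \<le> b" "b \<le> T"
  shows "(\<lambda>z. (fst z, min b (snd z))) \<in> predictable_sigma \<rightarrow>\<^sub>M predictable_sigma"
proof (rule measurable_predictableI)
  show "(\<lambda>z. (fst z, min b (snd z))) \<in> space predictable_sigma \<rightarrow> space M \<times> {0..T}"
    using b by auto
next
  fix B assume B: "B \<in> sets (history 0)"
  have BM: "B \<subseteq> space M" using sets.sets_into_space[OF B] by simp
  have B0: "B \<times> {0} \<in> sets predictable_sigma"
    unfolding sets_predictable_sigma using B by (intro sigma_sets.Basic) blast
  show "(\<lambda>z. (fst z, min b (snd z))) -` (B \<times> {0}) \<inter> space predictable_sigma \<in> sets predictable_sigma"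
  proof (cases "b = 0")
    case True
    then have "(\<lambda>z. (fst z, min b (snd z))) -` (B \<times> {0}) \<inter> space predictable_sigma = B \<times> {0} \<union> B \<times> {0<..T}"
      using BM T_pos by auto
    then show ?thesis using B0 predictable_rectangle[of 0 T B] B T_pos by auto
  next
    case False
    then have "(\<lambda>z. (fst z, min b (snd z))) -` (B \<times> {0}) \<inter> space predictable_sigma = B \<times> {0}"
      using BM T_pos b by (auto simp: min_def split: if_splits)
    then show ?thesis using B0 by simp
  qed
next
  fix s t B assume st: "0 \<le> s" "s < t" "t \<le> T" and B: "B \<in> sets (history (ennreal s))"
  have BM: "B \<subseteq> space M" using sets.sets_into_space[OF B] by simp
  consider "b \<le> s" | "s < b" "b \<le> t" | "t < b" by linarith
  then show "(\<lambda>z. (fst z, min b (snd z))) -` (B \<times> {s<..t}) \<inter> space predictable_sigma \<in> sets predictable_sigma"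
  proof cases
    case 1
    then have "(\<lambda>z. (fst z, min b (snd z))) -` (B \<times> {s<..t}) \<inter> space predictable_sigma = {}" by auto
    then show ?thesis by simp
  next
    case 2
    then have "(\<lambda>z. (fst z, min b (snd z))) -` (B \<times> {s<..t}) \<inter> space predictable_sigma = B \<times> {s<..T}"
      using BM st by auto
    then show ?thesis using predictable_rectangle[of s T B] B st by simp
  next
    case 3
    then have "(\<lambda>z. (fst z, min b (snd z))) -` (B \<times> {s<..t}) \<inter> space predictable_sigma = B \<times> {s<..t}"
      using BM st by auto
    then show ?thesis using predictable_rectangle[of s t B] B st by simp
  qed
qed

lemma A_measurable [measurable]: "(\<lambda>z. A (fst z) (snd z)) \<in> borel_measurable predictable_sigma"
  using A_predictable by (simp add: predictable_process_def split_beta')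

lemma Int_stable_predictable_generator:
  "Int_stable ({B \<times> {0} | B. B \<in> sets (history 0)} \<union>
      {B \<times> {s<..t} | s t B. 0 \<le> s \<and> s < t \<and> t \<le> T \<and> B \<in> sets (history (ennreal s))})"
  (is "Int_stable (?G1 \<union> ?G2)")
proof (rule Int_stableI)
  have empty: "{} \<in> ?G1" by (intro CollectI exI[of _ "{}"]) auto
  have 11: "a \<inter> b \<in> ?G1" if "a \<in> ?G1" "b \<in> ?G1" for a b
  proof -
    from that obtain B B' where "a = B \<times> {0}" "b = B' \<times> {0}" "B \<in> sets (history 0)" "B' \<in> sets (history 0)"
      by (elim CollectE exE conjE)
    then show ?thesis by (intro CollectI exI[of _ "B \<inter> B'"]) auto
  qed
  have 12: "a \<inter> b = {}" if "a \<in> ?G1" "b \<in> ?G2" for a b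
    using that by (elim CollectE exE conjE) auto
  have 22: "a \<inter> b \<in> ?G1 \<union> ?G2" if a: "a \<in> ?G2" and b: "b \<in> ?G2" for a b
  proof -
    from a obtain s t B where a: "a = B \<times> {s<..t}" "0 \<le> s" "s < t" "t \<le> T" "B \<in> sets (history (ennreal s))"
      by (elim CollectE exE conjE)
    from b obtain s' t' B' where b: "b = B' \<times> {s'<..t'}" "0 \<le> s'" "s' < t'" "t' \<le> T" "B' \<in> sets (history (ennreal s'))"
      by (elim CollectE exE conjE)
    have eq: "a \<inter> b = (B \<inter> B') \<times> {max s s' <.. min t t'}" using a b by auto
    show ?thesis
    proof (cases "max s s' < min t t'")
      case True
      have "B \<in> sets (history (ennreal (max s s')))" "B' \<in> sets (history (ennreal (max s s')))"
        using sets_F_mono[OF ennreal_leI[of s "max s s'"]] sets_F_mono[OF ennreal_leI[of s' "max s s'"]] a b by auto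
      then have "a \<inter> b \<in> ?G2" unfolding eq using True a b
        by (intro CollectI exI[of _ "max s s'"] exI[of _ "min t t'"] exI[of _ "B \<inter> B'"]) auto
      then show ?thesis by blast
    next
      case False
      then have "a \<inter> b = {}" unfolding eq by auto
      then show ?thesis using empty by simp
    qed
  qed
  fix a b assume "a \<in> ?G1 \<union> ?G2" "b \<in> ?G1 \<union> ?G2"
  then show "a \<inter> b \<in> ?G1 \<union> ?G2"
    by (elim UnE) (use 11 12[of a b] 12[of b a] 22 empty in \<open>simp_all add: Int_commute\<close>)
qed

text \<open>
  By the \<open>\<pi>\<close>-\<open>\<lambda>\<close> theorem it suffices to treat the generators.  For the rectangle
  \<open>B \<times> {a<..b}\<close> the mass is \<open>A\<^bsub>b\<and>t\<^esub> - A\<^bsub>a\<and>t\<^esub>\<close> on \<open>B\<close>; by continuity of \<open>A\<close> the endpoint \<open>t\<close>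
  carries no mass.
\<close>

lemma predictable_emeasure_dA:
  assumes "Q \<in> sets predictable_sigma"
  shows "(\<lambda>z. emeasure (dA (fst z)) {s \<in> {0..T}. s < snd z \<and> (fst z, s) \<in> Q}) \<in> borel_measurable predictable_sigma"
proof -
  define V where "V Q \<omega> t = {s \<in> {0..T}. s < t \<and> (\<omega>, s) \<in> Q}" for Q :: "('a \<times> real) set" and \<omega> t
  have V_sets: "V Q \<omega> t \<in> sets (dA \<omega>)" if "Q \<in> sets predictable_sigma" "\<omega> \<in> space M" for Q \<omega> t
  proof -
    have [measurable]: "(\<lambda>s. (\<omega>, s)) -` Q \<inter> {0..T} \<in> sets (dA \<omega>)"
      using measurable_sets[OF measurable_predictable_path[OF that(2)] that(1)]
      by (simp add: sets_dA space_restrict_space)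
    have "{..<t} \<inter> {0..T} \<in> sets (dA \<omega>)" by (intro sets_dA_I) auto
    moreover have "V Q \<omega> t = ((\<lambda>s. (\<omega>, s)) -` Q \<inter> {0..T}) \<inter> ({..<t} \<inter> {0..T})" unfolding V_def by auto
    ultimately show ?thesis by simp
  qed
  have "(\<lambda>z. emeasure (dA (fst z)) (V Q (fst z) (snd z))) \<in> borel_measurable predictable_sigma"
    using Int_stable_predictable_generator predictable_generator_subset assms[unfolded sets_predictable_sigma]
  proof (induction rule: sigma_sets_induct_disjoint)
    case (basic D)
    then consider B where "D = B \<times> {0}" "B \<in> sets (history 0)" 
      | s t B where "D = B \<times> {s<..t}" "0 \<le> s" "s < t" "t \<le> T" "B \<in> sets (history (ennreal s))"
      by (elim UnE CollectE exE conjE)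
    then show ?case
    proof cases
      case 1
      have "emeasure (dA \<omega>) (V D \<omega> t) = 0" if "\<omega> \<in> space M" for \<omega> t
      proof -
        have "emeasure (dA \<omega>) (V D \<omega> t) \<le> emeasure (dA \<omega>) {0}"
          using T_pos by (intro emeasure_mono sets_dA_I) (auto simp: V_def 1)
        then show ?thesis using dA_singleton[OF that] by simp
      qed
      then show ?thesis by (subst measurable_cong[where g="\<lambda>_. 0"]) auto
    next
      case (2 a b B)
      have BM: "B \<subseteq> space M" using sets.sets_into_space[OF 2(5)] by simp
      have R[measurable]: "B \<times> {a<..T} \<in> sets predictable_sigma" by (rule predictable_rectangle) (use 2 in auto)
      have A_stop: "(\<lambda>z. A (fst z) (min c (snd z))) \<in> borel_measurable predictable_sigma" if "0 \<le> c" "c \<le> T" for c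
        using measurable_compose[OF measurable_predictable_stop[OF that] A_measurable] by simp
      have [measurable]: "(\<lambda>z. A (fst z) (min a (snd z))) \<in> borel_measurable predictable_sigma"
        "(\<lambda>z. A (fst z) (min b (snd z))) \<in> borel_measurable predictable_sigma"
        using 2 by (auto intro!: A_stop)
      have "(\<lambda>z. indicator (B \<times> {a<..T}) z * ennreal (A (fst z) (min b (snd z)) - A (fst z) (min a (snd z)))) \<in> borel_measurable predictable_sigma"
        by (rule borel_measurable_times_ennreal[OF borel_measurable_indicator[OF R]]) measurable
      moreover have "emeasure (dA (fst z)) (V D (fst z) (snd z)) = indicator (B \<times> {a<..T}) z * ennreal (A (fst z) (min b (snd z)) - A (fst z) (min a (snd z)))"
        if z: "z \<in> space predictable_sigma" for z
      proof (cases "z \<in> B \<times> {a<..T}")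
        case True
        have *: "emeasure (dA (fst z)) (V D (fst z) (snd z)) = emeasure (dA (fst z)) {a<..<min b (snd z)}"
        proof (rule emeasure_eq_AE)
          show "AE s in dA (fst z). (s \<in> V D (fst z) (snd z)) = (s \<in> {a<..<min b (snd z)})"
            using AE_dA_neq[of "fst z" b] z True 2 by (auto elim!: eventually_mono simp: V_def)
          show "V D (fst z) (snd z) \<in> sets (dA (fst z))" 
            using V_sets[of D "fst z"] z predictable_rectangle[OF 2(2-5)] 2(1) by auto
        qed (use True 2 in \<open>auto intro!: sets_dA_I\<close>)
        show ?thesis unfolding * using True z 2 by (subst emeasure_dA_Ioo) auto
      next
        case False
        then have "V D (fst z) (snd z) = {}" using z 2 by (auto simp: V_def)
        then show ?thesis using False by simp
      qed
      ultimately show ?thesis by (subst measurable_cong) auto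
    qed
  next
    case empty
    then show ?case by (simp add: V_def)
  next
    case (compl D)
    have D: "D \<in> sets predictable_sigma" using compl(1) by (simp add: sets_predictable_sigma)
    have *: "emeasure (dA (fst z)) (V (space M \<times> {0..T} - D) (fst z) (snd z)) = 
      ennreal (A (fst z) (snd z)) - emeasure (dA (fst z)) (V D (fst z) (snd z))" if z: "z \<in> space predictable_sigma" for z
    proof -
      have \<omega>: "fst z \<in> space M" and t: "0 \<le> snd z" "snd z \<le> T" using z by auto
      interpret finite_measure "dA (fst z)" by (rule finite_measure_dA[OF \<omega>])
      have "emeasure (dA (fst z)) {0..<snd z} = emeasure (dA (fst z)) {0..snd z}"
        using AE_dA_neq[OF \<omega>, of "snd z"] t by (intro emeasure_eq_AE sets_dA_I) (auto elim!: eventually_mono)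
      then have "emeasure (dA (fst z)) {0..<snd z} = ennreal (A (fst z) (snd z))"
        using emeasure_dA_Icc[OF \<omega>, of 0 "snd z"] t A_0[OF \<omega>] by simp
      moreover have "V (space M \<times> {0..T} - D) (fst z) (snd z) = {0..<snd z} - V D (fst z) (snd z)"
        using t \<omega> by (auto simp: V_def)
      moreover have "{0..<snd z} \<in> sets (dA (fst z))" using t by (intro sets_dA_I) auto
      ultimately show ?thesis
        using V_sets[OF D \<omega>, of "snd z"] emeasure_Diff[of "dA (fst z)" "V D (fst z) (snd z)" "{0..<snd z}"]
        by (simp add: V_def subset_eq)
    qed
    note compl(2)[measurable]
    have "(\<lambda>z. ennreal (A (fst z) (snd z)) - emeasure (dA (fst z)) (V D (fst z) (snd z))) \<in> borel_measurable predictable_sigma"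
      by measurable
    then show ?case by (subst measurable_cong[OF *])
  next
    case (union D)
    have D: "D i \<in> sets predictable_sigma" for i using union(2) by (auto simp: sets_predictable_sigma)
    note union(3)[measurable]
    have "(\<lambda>z. \<Sum>i. emeasure (dA (fst z)) (V (D i) (fst z) (snd z))) \<in> borel_measurable predictable_sigma"
      by measurable
    moreover have "emeasure (dA (fst z)) (V (\<Union>i. D i) (fst z) (snd z)) = (\<Sum>i. emeasure (dA (fst z)) (V (D i) (fst z) (snd z)))"
      if z: "z \<in> space predictable_sigma" for z
    proof -
      have "V (\<Union>i. D i) (fst z) (snd z) = (\<Union>i. V (D i) (fst z) (snd z))" by (auto simp: V_def)
      moreover have "disjoint_family (\<lambda>i. V (D i) (fst z) (snd z))"
        using union(1) by (auto simp: disjoint_family_on_def V_def)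
      ultimately show ?thesis using V_sets[OF D] z by (subst suminf_emeasure) (auto simp: image_subset_iff)
    qed
    ultimately show ?case by (subst measurable_cong) auto
  qed
  then show ?thesis by (simp add: V_def)
qed

lemma measurable_path_dA:
  "\<omega> \<in> space M \<Longrightarrow> h \<in> predictable_sigma \<rightarrow>\<^sub>M K \<Longrightarrow> (\<lambda>s. h (\<omega>, s)) \<in> dA \<omega> \<rightarrow>\<^sub>M K"
  using measurable_compose[OF measurable_predictable_path, of \<omega> h K]
  by (simp add: measurable_cong_sets[OF sets_dA refl])

lemma measurable_time_dA [measurable]: "(\<lambda>s. s) \<in> dA \<omega> \<rightarrow>\<^sub>M borel"
  using measurable_restrict_space1[OF measurable_ident_sets[OF refl], of borel "{0..T}"]
  by (simp add: measurable_cong_sets[OF sets_dA refl])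

lemma predictable_integral_dA:
  assumes "h \<in> predictable_sigma \<rightarrow>\<^sub>M (borel :: ennreal measure)"
  shows "(\<lambda>z. \<integral>\<^sup>+s. (if s < snd z then h (fst z, s) else 0) \<partial>dA (fst z)) \<in> predictable_sigma \<rightarrow>\<^sub>M borel"
  using assms
proof (induction rule: borel_measurable_induct)
  case (cong f g)
  then show ?case
    by (subst measurable_cong[where g="\<lambda>z. \<integral>\<^sup>+s. (if s < snd z then g (fst z, s) else 0) \<partial>dA (fst z)"])
       (auto intro!: nn_integral_cong)
next
  case (set Q)
  have "(\<integral>\<^sup>+s. (if s < snd z then indicator Q (fst z, s) else 0) \<partial>dA (fst z)) =
     emeasure (dA (fst z)) {s \<in> {0..T}. s < snd z \<and> (fst z, s) \<in> Q}" if z: "z \<in> space predictable_sigma" for z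
  proof -
    have \<omega>: "fst z \<in> space M" using z by auto
    have [measurable]: "Measurable.pred (dA (fst z)) (\<lambda>s. (fst z, s) \<in> Q)"
      using measurable_path_dA[OF \<omega>, of "\<lambda>z. z \<in> Q" "count_space UNIV"] set by simp
    have "{s \<in> space (dA (fst z)). s < snd z \<and> (fst z, s) \<in> Q} \<in> sets (dA (fst z))" by measurable
    then have "emeasure (dA (fst z)) {s \<in> {0..T}. s < snd z \<and> (fst z, s) \<in> Q} 
      = (\<integral>\<^sup>+s. indicator {s \<in> {0..T}. s < snd z \<and> (fst z, s) \<in> Q} s \<partial>dA (fst z))" by simp
    also have "\<dots> = (\<integral>\<^sup>+s. (if s < snd z then indicator Q (fst z, s) else 0) \<partial>dA (fst z))"
      by (intro nn_integral_cong) (auto simp: indicator_def)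
    finally show ?thesis by simp
  qed
  then show ?case using predictable_emeasure_dA[OF set] by (subst measurable_cong) auto
next
  case (mult u c)
  have "(\<integral>\<^sup>+s. (if s < snd z then c * u (fst z, s) else 0) \<partial>dA (fst z)) = c * (\<integral>\<^sup>+s. (if s < snd z then u (fst z, s) else 0) \<partial>dA (fst z))"
    if z: "z \<in> space predictable_sigma" for z
  proof -
    have [measurable]: "(\<lambda>s. u (fst z, s)) \<in> borel_measurable (dA (fst z))" using z mult by (intro measurable_path_dA) auto
    show ?thesis by (subst nn_integral_cmult[symmetric]) (auto intro!: nn_integral_cong)
  qed
  note * = this
  have "(\<lambda>z. c * (\<integral>\<^sup>+s. (if s < snd z then u (fst z, s) else 0) \<partial>dA (fst z))) \<in> borel_measurable predictable_sigma"
    using mult by measurable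
  then show ?case by (subst measurable_cong[OF *]) simp_all
next
  case (add u v)
  have "(\<integral>\<^sup>+s. (if s < snd z then v (fst z, s) + u (fst z, s) else 0) \<partial>dA (fst z)) = 
      (\<integral>\<^sup>+s. (if s < snd z then v (fst z, s) else 0) \<partial>dA (fst z)) + (\<integral>\<^sup>+s. (if s < snd z then u (fst z, s) else 0) \<partial>dA (fst z))"
    if z: "z \<in> space predictable_sigma" for z
  proof -
    have [measurable]: "(\<lambda>s. u (fst z, s)) \<in> borel_measurable (dA (fst z))" "(\<lambda>s. v (fst z, s)) \<in> borel_measurable (dA (fst z))"
      using z add by (auto intro!: measurable_path_dA)
    show ?thesis by (subst nn_integral_add[symmetric]) (auto intro!: nn_integral_cong)
  qed
  note * = this
  have "(\<lambda>z. (\<integral>\<^sup>+s. (if s < snd z then v (fst z, s) else 0) \<partial>dA (fst z)) + (\<integral>\<^sup>+s. (if s < snd z then u (fst z, s) else 0) \<partial>dA (fst z)))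
    \<in> borel_measurable predictable_sigma"
    using add by measurable
  then show ?case by (subst measurable_cong[OF *]) simp_all
next
  case (seq U)
  have "(\<integral>\<^sup>+s. (if s < snd z then (SUP i. U i) (fst z, s) else 0) \<partial>dA (fst z)) = 
      (SUP i. \<integral>\<^sup>+s. (if s < snd z then U i (fst z, s) else 0) \<partial>dA (fst z))"
    if z: "z \<in> space predictable_sigma" for z
  proof -
    have [measurable]: "(\<lambda>s. U i (fst z, s)) \<in> borel_measurable (dA (fst z))" for i
      using z seq by (intro measurable_path_dA) auto
    have "incseq (\<lambda>i s. if s < snd z then U i (fst z, s) else 0)"
      using seq(3) by (auto simp: incseq_def le_fun_def)
    from nn_integral_monotone_convergence_SUP[OF this, of "dA (fst z)"]
    have "(\<integral>\<^sup>+s. (SUP i. if s < snd z then U i (fst z, s) else 0) \<partial>dA (fst z)) = 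
      (SUP i. \<integral>\<^sup>+s. (if s < snd z then U i (fst z, s) else 0) \<partial>dA (fst z))" by simp
    moreover have "(if s < snd z then (SUP i. U i) (fst z, s) else 0) = (SUP i. if s < snd z then U i (fst z, s) else 0)" for s
      by (cases "s < snd z") (simp_all add: SUP_apply image_image)
    ultimately show ?thesis by simp
  qed
  note * = this
  have "(\<lambda>z. SUP i. \<integral>\<^sup>+s. (if s < snd z then U i (fst z, s) else 0) \<partial>dA (fst z)) \<in> borel_measurable predictable_sigma"
    using seq by measurable
  then show ?case by (subst measurable_cong[OF *]) simp_all
qed

lemma \<phi>_measurable: "(\<lambda>z. \<phi> (fst z) (snd z)) \<in> predictable_sigma \<rightarrow>\<^sub>M prob_algebra borel"
  using \<phi>_kernel by (simp add: predictable_process_def split_beta')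

lemma prob_space_\<phi>: "\<omega> \<in> space M \<Longrightarrow> t \<in> {0..T} \<Longrightarrow> prob_space (\<phi> \<omega> t)"
  and sets_\<phi>: "\<omega> \<in> space M \<Longrightarrow> t \<in> {0..T} \<Longrightarrow> sets (\<phi> \<omega> t) = sets borel"
  using measurable_space[OF \<phi>_measurable, of "(\<omega>, t)"] by (auto simp: space_prob_algebra)

lemma \<nu>_kernel:
  assumes "\<omega> \<in> space M"
  shows "(\<lambda>t. distr (\<phi> \<omega> t) (restrict_space borel {0..T} \<Otimes>\<^sub>M borel) (Pair t)) \<in> dA \<omega> \<rightarrow>\<^sub>M subprob_algebra mark_space"
proof -
  have "(\<lambda>t. \<phi> \<omega> t) \<in> dA \<omega> \<rightarrow>\<^sub>M subprob_algebra borel"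
    using measurable_path_dA[OF assms \<phi>_measurable] by (simp add: measurable_prob_algebraD)
  moreover have "case_prod Pair \<in> dA \<omega> \<Otimes>\<^sub>M borel \<rightarrow>\<^sub>M restrict_space borel {0..T} \<Otimes>\<^sub>M (borel :: 'e measure)"
    by (simp add: measurable_cong_sets[OF sets_pair_measure_cong[OF sets_dA refl] refl])
  ultimately show ?thesis unfolding mark_space_def by (rule measurable_distr2[rotated])
qed

lemma sets_\<nu> [measurable_cong]: "\<omega> \<in> space M \<Longrightarrow> sets (\<nu> \<omega>) = sets mark_space"
  unfolding disintegrated_measure_def using sets_kernel[OF \<nu>_kernel] T_pos
  by (intro sets_bind[where N=mark_space]) auto

lemma space_\<nu>: "\<omega> \<in> space M \<Longrightarrow> space (\<nu> \<omega>) = {0..T} \<times> UNIV"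
  using sets_eq_imp_space_eq[OF sets_\<nu>] space_mark_space by auto

lemma measurable_mark_Pair: "t \<in> {0..T} \<Longrightarrow> Pair t \<in> borel \<rightarrow>\<^sub>M mark_space"
  unfolding mark_space_def by (rule measurable_Pair1') (simp add: space_restrict_space)

lemma nn_integral_\<nu>:
  assumes \<omega>: "\<omega> \<in> space M" and f: "f \<in> borel_measurable mark_space"
  shows "(\<integral>\<^sup>+z. f z \<partial>\<nu> \<omega>) = (\<integral>\<^sup>+t. \<integral>\<^sup>+x. f (t, x) \<partial>\<phi> \<omega> t \<partial>dA \<omega>)"
proof -
  have "(\<integral>\<^sup>+z. f z \<partial>\<nu> \<omega>) = (\<integral>\<^sup>+t. \<integral>\<^sup>+z. f z \<partial>distr (\<phi> \<omega> t) mark_space (Pair t) \<partial>dA \<omega>)"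
    unfolding disintegrated_measure_def mark_space_def[symmetric]
    by (rule nn_integral_bind[OF f \<nu>_kernel[OF \<omega>, folded mark_space_def]])
  also have "\<dots> = (\<integral>\<^sup>+t. \<integral>\<^sup>+x. f (t, x) \<partial>\<phi> \<omega> t \<partial>dA \<omega>)"
  proof (rule nn_integral_cong)
    fix t assume "t \<in> space (dA \<omega>)"
    then have t: "t \<in> {0..T}" by simp
    have "Pair t \<in> \<phi> \<omega> t \<rightarrow>\<^sub>M mark_space"
      using measurable_mark_Pair[OF t] by (simp add: measurable_cong_sets[OF sets_\<phi>[OF \<omega> t] refl])
    then show "(\<integral>\<^sup>+z. f z \<partial>distr (\<phi> \<omega> t) mark_space (Pair t)) = (\<integral>\<^sup>+x. f (t, x) \<partial>\<phi> \<omega> t)"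
      by (subst nn_integral_distr) (use f in auto)
  qed
  finally show ?thesis .
qed

lemma nn_integral_\<nu>_time:
  assumes \<omega>: "\<omega> \<in> space M" and f: "f \<in> borel_measurable (restrict_space borel {0..T})"
  shows "(\<integral>\<^sup>+z. f (fst z) \<partial>\<nu> \<omega>) = (\<integral>\<^sup>+t. f t \<partial>dA \<omega>)"
proof -
  have "(\<lambda>z. f (fst z)) \<in> borel_measurable mark_space"
    unfolding mark_space_def by (rule measurable_compose[OF measurable_fst f])
  from nn_integral_\<nu>[OF \<omega> this] have "(\<integral>\<^sup>+z. f (fst z) \<partial>\<nu> \<omega>) = (\<integral>\<^sup>+t. \<integral>\<^sup>+x. f t \<partial>\<phi> \<omega> t \<partial>dA \<omega>)" by simp
  also have "\<dots> = (\<integral>\<^sup>+t. f t \<partial>dA \<omega>)"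
    using prob_space.emeasure_space_1[OF prob_space_\<phi>[OF \<omega>]] by (intro nn_integral_cong) simp
  finally show ?thesis .
qed

lemma emeasure_\<nu>_times:
  assumes \<omega>: "\<omega> \<in> space M" and I: "I \<in> sets borel" "I \<subseteq> {0..T}"
  shows "emeasure (\<nu> \<omega>) (I \<times> UNIV) = emeasure (dA \<omega>) I"
proof -
  have I': "I \<in> sets (restrict_space borel {0..T})" using sets_dA_I[OF I] by (simp add: sets_dA)
  then have "I \<times> UNIV \<in> sets (\<nu> \<omega>)"
    unfolding sets_\<nu>[OF \<omega>] mark_space_def by (intro pair_measureI) auto
  then have "emeasure (\<nu> \<omega>) (I \<times> UNIV) = (\<integral>\<^sup>+z. indicator (I \<times> UNIV) z \<partial>\<nu> \<omega>)" by simp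
  also have "\<dots> = (\<integral>\<^sup>+z. indicator I (fst z) \<partial>\<nu> \<omega>)"
    by (intro nn_integral_cong) (auto simp: indicator_def)
  also have "\<dots> = (\<integral>\<^sup>+t. indicator I t \<partial>dA \<omega>)" using I' by (intro nn_integral_\<nu>_time[OF \<omega>]) simp
  also have "\<dots> = emeasure (dA \<omega>) I" using sets_dA_I[OF I] by simp
  finally show ?thesis .
qed

lemma finite_measure_\<nu>: "\<omega> \<in> space M \<Longrightarrow> finite_measure (\<nu> \<omega>)"
  using emeasure_\<nu>_times[of \<omega> "{0..T}"] finite_measure.emeasure_finite[OF finite_measure_dA, of \<omega> "{0..T}"]
  by (intro finite_measureI) (simp add: space_\<nu>)

lemma AE_\<nu>_time:
  assumes \<omega>: "\<omega> \<in> space M" and "AE t in dA \<omega>. P t"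
  shows "AE z in \<nu> \<omega>. P (fst z)"
proof -
  from assms(2) obtain V where V: "{t \<in> space (dA \<omega>). \<not> P t} \<subseteq> V" "V \<in> null_sets (dA \<omega>)" 
    unfolding eventually_ae_filter by auto
  then have V': "V \<in> sets borel" "V \<subseteq> {0..T}"
    by (auto simp: null_sets_def sets_dA sets_restrict_space_iff)
  show ?thesis
  proof (rule AE_I[of _ _ "V \<times> UNIV"])
    show "V \<times> UNIV \<in> sets (\<nu> \<omega>)"
      unfolding sets_\<nu>[OF \<omega>] mark_space_def using V' by (intro pair_measureI) (auto simp: sets_restrict_space_iff)
    show "emeasure (\<nu> \<omega>) (V \<times> UNIV) = 0"
      using emeasure_\<nu>_times[OF \<omega> V'] V(2) by (simp add: null_sets_def)
    show "{z \<in> space (\<nu> \<omega>). \<not> P (fst z)} \<subseteq> V \<times> UNIV" using V(1) by (auto simp: space_\<nu>[OF \<omega>])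
  qed
qed

lemma predictable_mark_integral:
  assumes H: "H \<in> predictable_sigma \<Otimes>\<^sub>M borel \<rightarrow>\<^sub>M (borel :: ennreal measure)"
  shows "(\<lambda>z. \<integral>\<^sup>+x. H (z, x) \<partial>\<phi> (fst z) (snd z)) \<in> borel_measurable predictable_sigma"
  using nn_integral_measurable_subprob_algebra2[OF _ measurable_prob_algebraD[OF \<phi>_measurable], of "\<lambda>z x. H (z, x)"] H
  by simp

lemma predictable_integral_\<nu>:
  assumes H: "H \<in> predictable_sigma \<Otimes>\<^sub>M borel \<rightarrow>\<^sub>M (borel :: ennreal measure)"
  shows "(\<lambda>z. \<integral>\<^sup>+y. (if fst y < snd z then H ((fst z, fst y), snd y) else 0) \<partial>\<nu> (fst z)) \<in> predictable_sigma \<rightarrow>\<^sub>M borel"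
proof -
  have "(\<integral>\<^sup>+y. (if fst y < snd z then H ((fst z, fst y), snd y) else 0) \<partial>\<nu> (fst z)) = 
     (\<integral>\<^sup>+s. (if s < snd z then \<integral>\<^sup>+x. H ((fst z, s), x) \<partial>\<phi> (fst z) s else 0) \<partial>dA (fst z))"
    if z: "z \<in> space predictable_sigma" for z
  proof -
    have \<omega>: "fst z \<in> space M" using z by auto
    note measurable_mark_section[OF \<omega> H, measurable]
    show ?thesis by (subst nn_integral_\<nu>[OF \<omega>]) (auto intro!: nn_integral_cong)
  qed
  then show ?thesis
    using predictable_integral_dA[OF predictable_mark_integral[OF H], unfolded fst_conv snd_conv]
    by (subst measurable_cong) auto
qed

end

section \<open>The exponential equation with jumps\<close>

text \<open>
  Using the value of \<open>B\<close> as the new time, \<open>\<Phi>\<close> becomes a function whose increments are quadratic in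
  the time step.  Its derivative vanishes, hence it is constant.
\<close>

lemma quadratic_increments_constant:
  fixes \<Phi> B :: "real \<Rightarrow> real"
  assumes ab: "a \<le> b" and cont: "continuous_on {a..b} B"
    and mono: "\<And>s t. a \<le> s \<Longrightarrow> s \<le> t \<Longrightarrow> t \<le> b \<Longrightarrow> B s \<le> B t"
    and quad: "\<And>s t. a \<le> s \<Longrightarrow> s \<le> t \<Longrightarrow> t \<le> b \<Longrightarrow> \<bar>\<Phi> t - \<Phi> s\<bar> \<le> c * (B t - B s)\<^sup>2"
  shows "\<Phi> b = \<Phi> a"
proof -
  define \<tau> where "\<tau> v = (SOME t. a \<le> t \<and> t \<le> b \<and> B t = v)" for v
  have \<tau>: "a \<le> \<tau> v \<and> \<tau> v \<le> b \<and> B (\<tau> v) = v" if "v \<in> {B a..B b}" for v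
  proof -
    have "\<exists>t. a \<le> t \<and> t \<le> b \<and> B t = v" using IVT'[of B a v b] that ab cont by auto
    then show ?thesis unfolding \<tau>_def by (rule someI_ex)
  qed
  have quad': "\<bar>\<Phi> t - \<Phi> s\<bar> \<le> c * (B t - B s)\<^sup>2" if "a \<le> s" "s \<le> b" "a \<le> t" "t \<le> b" for s t
    using quad[of s t] quad[of t s] that by (cases "s \<le> t") (auto simp: power2_commute abs_minus_commute)
  have "((\<lambda>v. \<Phi> (\<tau> v)) has_derivative (\<lambda>_. 0)) (at v within {B a..B b})" if v: "v \<in> {B a..B b}" for v
  proof (rule has_derivativeI_sandwich[of 1])
    fix w assume w: "w \<in> {B a..B b}" "w \<noteq> v" 
    have "\<bar>\<Phi> (\<tau> w) - \<Phi> (\<tau> v)\<bar> \<le> c * (w - v)\<^sup>2" 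
      using quad'[of "\<tau> v" "\<tau> w"] \<tau>[OF v] \<tau>[OF w(1)] by auto
    then show "norm (\<Phi> (\<tau> w) - \<Phi> (\<tau> v) - 0) / norm (w - v) \<le> c * \<bar>w - v\<bar>"
      using w(2) by (simp add: pos_divide_le_eq power2_eq_square ac_simps)
  next
    have "((\<lambda>w. c * \<bar>w - v\<bar>) \<longlongrightarrow> c * \<bar>v - v\<bar>) (at v within {B a..B b})" by (intro tendsto_intros)
    then show "((\<lambda>w. c * \<bar>w - v\<bar>) \<longlongrightarrow> 0) (at v within {B a..B b})" by simp
  qed auto
  then have "\<exists>d. \<forall>v\<in>{B a..B b}. \<Phi> (\<tau> v) = d"
    by (intro has_derivative_zero_constant) auto
  moreover have "B a \<in> {B a..B b}" "B b \<in> {B a..B b}" using mono[of a b] ab by auto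
  ultimately have "\<Phi> (\<tau> (B b)) = \<Phi> (\<tau> (B a))" by metis
  moreover have "\<Phi> (\<tau> (B b)) = \<Phi> b" "\<Phi> (\<tau> (B a)) = \<Phi> a"
    using quad'[of b "\<tau> (B b)"] quad'[of a "\<tau> (B a)"] \<tau>[of "B a"] \<tau>[of "B b"] ab mono[of a b] by auto
  ultimately show ?thesis by simp
qed

text \<open>
  Both bounds come from the tangent inequality \<open>exp x - exp y \<le> exp x * (x - y)\<close>.
\<close>

lemma exp_diff_le:
  fixes x y R :: real
  assumes "\<bar>x\<bar> \<le> R" "\<bar>y\<bar> \<le> R"
  shows "\<bar>exp x - exp y\<bar> \<le> exp R * \<bar>x - y\<bar>" 
    and "\<bar>exp x - exp y - exp y * (x - y)\<bar> \<le> exp R * (x - y)\<^sup>2"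
proof -
  have tangent: "exp x - exp y \<le> exp x * (x - y)" for x y :: real
    using mult_left_mono[OF exp_ge_add_one_self[of "y - x"], of "exp x"]
    by (simp add: exp_diff field_simps)
  have "exp x - exp y \<le> exp R * \<bar>x - y\<bar>" if "\<bar>x\<bar> \<le> R" for x y :: real
    using tangent[of x y] mult_mono[of "exp x" "exp R" "x - y" "\<bar>x - y\<bar>"] that
      mult_right_mono[of "exp x" "exp R" "\<bar>x - y\<bar>"] mult_left_mono[of "x - y" "\<bar>x - y\<bar>" "exp x"]
    by (smt (verit) exp_gt_zero exp_le_cancel_iff)
  from this[of x y] this[of y x] assms show 1: "\<bar>exp x - exp y\<bar> \<le> exp R * \<bar>x - y\<bar>"
    by (auto simp: abs_minus_commute abs_le_iff)
  have "exp x - exp y - exp y * (x - y) \<le> (exp x - exp y) * (x - y)"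
    using tangent[of x y] by (simp add: algebra_simps)
  also have "\<dots> \<le> \<bar>exp x - exp y\<bar> * \<bar>x - y\<bar>" by (metis abs_ge_self abs_mult)
  also have "\<dots> \<le> exp R * \<bar>x - y\<bar> * \<bar>x - y\<bar>" by (intro mult_right_mono 1) simp
  finally have "exp x - exp y - exp y * (x - y) \<le> exp R * (x - y)\<^sup>2"
    by (simp add: power2_eq_square mult.assoc)
  moreover have "0 \<le> exp x - exp y - exp y * (x - y)"
    using tangent[of y x] by (simp add: algebra_simps)
  ultimately show "\<bar>exp x - exp y - exp y * (x - y)\<bar> \<le> exp R * (x - y)\<^sup>2" by simp
qed

lemma prod_telescope:
  fixes R :: "nat \<Rightarrow> real"
  assumes "finite F"
  shows "(\<Prod>n\<in>F. R n) = 1 + (\<Sum>n\<in>F. (\<Prod>m\<in>{m\<in>F. m < n}. R m) * (R n - 1))"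
  using assms
proof (induction F rule: finite_linorder_max_induct)
  case (insert b F)
  have "{m \<in> insert b F. m < n} = {m \<in> F. m < n}" if "n \<in> F" for n
    using insert.hyps(2) that by fastforce
  moreover have "{m \<in> insert b F. m < b} = F" using insert.hyps(2) by fastforce
  moreover have "b \<notin> F" using insert.hyps(2) by auto
  ultimately show ?case using insert.IH insert.hyps(1)
    by (simp add: algebra_simps)
qed simp

context continuous_compensator
begin

lemma sets_slab: "0 \<le> a \<Longrightarrow> b \<le> T \<Longrightarrow> \<omega> \<in> space M \<Longrightarrow> {a<..b} \<times> UNIV \<in> sets (\<nu> \<omega>)"
  unfolding sets_\<nu> mark_space_def by (intro pair_measureI) (auto simp: sets_restrict_space_iff)

lemma measure_slab:
  assumes "\<omega> \<in> space M" "0 \<le> a" "a \<le> b" "b \<le> T"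
  shows "measure (\<nu> \<omega>) ({a<..b} \<times> UNIV) = A \<omega> b - A \<omega> a"
proof -
  have "emeasure (\<nu> \<omega>) ({a<..b} \<times> UNIV) = emeasure (dA \<omega>) {a<..b}"
    using assms by (intro emeasure_\<nu>_times) auto
  also have "\<dots> = emeasure (dA \<omega>) {a<..<b}"
    using AE_dA_neq[OF assms(1), of b] assms
    by (intro emeasure_eq_AE sets_dA_I) (auto elim: eventually_mono)
  also have "\<dots> = ennreal (A \<omega> b - A \<omega> a)" by (rule emeasure_dA_Ioo[OF assms])
  finally show ?thesis using A_le[OF assms] by (simp add: measure_def)
qed

lemma integrable_\<nu>_bounded:
  fixes f :: "_ \<Rightarrow> real"
  assumes \<omega>: "\<omega> \<in> space M" and f: "f \<in> borel_measurable mark_space"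
    and bound: "\<And>z. z \<in> {0..T} \<times> UNIV \<Longrightarrow> \<bar>f z\<bar> \<le> c"
  shows "integrable (\<nu> \<omega>) f"
proof -
  interpret finite_measure "\<nu> \<omega>" by (rule finite_measure_\<nu>[OF \<omega>])
  show ?thesis using f bound
    by (intro integrable_const_bound[of _ c] AE_I2) (auto simp: space_\<nu>[OF \<omega>] measurable_cong_sets[OF sets_\<nu>[OF \<omega>] refl])
qed

lemma set_integrable_\<nu>_bounded:
  fixes f :: "_ \<Rightarrow> real"
  assumes "\<omega> \<in> space M" "f \<in> borel_measurable mark_space"
    and "\<And>z. z \<in> {0..T} \<times> UNIV \<Longrightarrow> \<bar>f z\<bar> \<le> c" "0 \<le> a" "b \<le> T"
  shows "set_integrable (\<nu> \<omega>) ({a<..b} \<times> UNIV) f"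
  unfolding set_integrable_def using integrable_\<nu>_bounded[OF assms(1-3)] sets_slab[OF assms(4,5,1)]
  by (intro integrable_mult_indicator)

lemma set_integral_\<nu>_bound:
  fixes f :: "_ \<Rightarrow> real"
  assumes \<omega>: "\<omega> \<in> space M" and f: "f \<in> borel_measurable mark_space"
    and b: "\<And>z. z \<in> {0..T} \<times> UNIV \<Longrightarrow> \<bar>f z\<bar> \<le> c'"
    and c: "\<And>z. z \<in> {a<..b} \<times> UNIV \<Longrightarrow> \<bar>f z\<bar> \<le> c" and ab: "0 \<le> a" "a \<le> b" "b \<le> T"
  shows "\<bar>set_lebesgue_integral (\<nu> \<omega>) ({a<..b} \<times> UNIV) f\<bar> \<le> c * (A \<omega> b - A \<omega> a)"
proof -
  interpret finite_measure "\<nu> \<omega>" by (rule finite_measure_\<nu>[OF \<omega>])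
  note S = sets_slab[OF ab(1,3) \<omega>]
  have "\<bar>set_lebesgue_integral (\<nu> \<omega>) ({a<..b} \<times> UNIV) f\<bar> \<le> (\<integral>z. \<bar>indicator ({a<..b} \<times> UNIV) z *\<^sub>R f z\<bar> \<partial>\<nu> \<omega>)"
    unfolding set_lebesgue_integral_def using integral_norm_bound[of "\<nu> \<omega>"] by auto
  also have "\<dots> \<le> (\<integral>z. indicator ({a<..b} \<times> UNIV) z * c \<partial>\<nu> \<omega>)"
  proof (rule integral_mono)
    show "integrable (\<nu> \<omega>) (\<lambda>z. \<bar>indicator ({a<..b} \<times> UNIV) z *\<^sub>R f z\<bar>)"
      using set_integrable_\<nu>_bounded[OF \<omega> f b ab(1,3)] unfolding set_integrable_def by simp
    have "integrable (\<nu> \<omega>) (indicator ({a<..b} \<times> UNIV) :: _ \<Rightarrow> real)"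
      using S by (intro integrable_real_indicator) (auto simp: emeasure_eq_measure)
    then show "integrable (\<nu> \<omega>) (\<lambda>z. indicator ({a<..b} \<times> UNIV) z * c)" by simp
    show "\<bar>indicator ({a<..b} \<times> UNIV) z *\<^sub>R f z\<bar> \<le> indicator ({a<..b} \<times> UNIV) z * c" for z
      using c[of z] by (auto simp: indicator_def)
  qed
  also have "\<dots> = c * (A \<omega> b - A \<omega> a)"
    using S measure_slab[OF \<omega> ab] by (simp add: sets.Int_space_eq2)
  finally show ?thesis .
qed

definition cumul :: "'a \<Rightarrow> (real \<times> 'e \<Rightarrow> real) \<Rightarrow> real \<Rightarrow> real" where
  "cumul \<omega> k t = set_lebesgue_integral (\<nu> \<omega>) ({0<..t} \<times> UNIV) k"

lemma cumul_diff:
  assumes \<omega>: "\<omega> \<in> space M" and k: "k \<in> borel_measurable mark_space"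
    and K: "\<And>z. z \<in> {0..T} \<times> UNIV \<Longrightarrow> \<bar>k z\<bar> \<le> K" and ab: "0 \<le> a" "a \<le> b" "b \<le> T"
  shows "cumul \<omega> k b - cumul \<omega> k a = set_lebesgue_integral (\<nu> \<omega>) ({a<..b} \<times> UNIV) k"
proof -
  have "{0<..b} \<times> UNIV = {0<..a} \<times> UNIV \<union> {a<..b} \<times> (UNIV :: 'e set)" using ab by auto
  then have "cumul \<omega> k b = set_lebesgue_integral (\<nu> \<omega>) ({0<..a} \<times> UNIV \<union> {a<..b} \<times> UNIV) k" by (simp add: cumul_def)
  also have "\<dots> = cumul \<omega> k a + set_lebesgue_integral (\<nu> \<omega>) ({a<..b} \<times> UNIV) k"
    unfolding cumul_def using ab
    by (intro set_integral_Un set_integrable_\<nu>_bounded[OF \<omega> k K]) auto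
  finally show ?thesis by simp
qed

lemma cumul_lipschitz:
  assumes \<omega>: "\<omega> \<in> space M" and k: "k \<in> borel_measurable mark_space"
    and K: "\<And>z. z \<in> {0..T} \<times> UNIV \<Longrightarrow> \<bar>k z\<bar> \<le> K" and ab: "0 \<le> a" "a \<le> b" "b \<le> T"
  shows "\<bar>cumul \<omega> k b - cumul \<omega> k a\<bar> \<le> K * (A \<omega> b - A \<omega> a)"
proof -
  have eq: "cumul \<omega> k b - cumul \<omega> k a = set_lebesgue_integral (\<nu> \<omega>) ({a<..b} \<times> UNIV) k"
    by (rule cumul_diff[OF \<omega> k K ab])
  show ?thesis unfolding eq using ab by (intro set_integral_\<nu>_bound[OF \<omega> k K]) (auto intro!: K)
qed

lemma cumul_0 [simp]: "cumul \<omega> k 0 = 0"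
  by (simp add: cumul_def set_lebesgue_integral_def)

lemma cumul_continuous:
  assumes \<omega>: "\<omega> \<in> space M" and k: "k \<in> borel_measurable mark_space"
    and K: "\<And>z. z \<in> {0..T} \<times> UNIV \<Longrightarrow> \<bar>k z\<bar> \<le> K"
  shows "continuous_on {0..T} (cumul \<omega> k)"
  unfolding continuous_on_def
proof
  fix t assume t: "t \<in> {0..T}"
  have le: "\<bar>cumul \<omega> k s - cumul \<omega> k t\<bar> \<le> K * \<bar>A \<omega> s - A \<omega> t\<bar>" if "s \<in> {0..T}" for s
    using cumul_lipschitz[OF \<omega> k K, of s t] cumul_lipschitz[OF \<omega> k K, of t s] that t
      A_le[OF \<omega>, of s t] A_le[OF \<omega>, of t s] by (cases "s \<le> t") (auto simp: abs_minus_commute)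
  have "(A \<omega> \<longlongrightarrow> A \<omega> t) (at t within {0..T})" using A_continuous[OF \<omega>] t by (auto simp: continuous_on_def)
  then have "((\<lambda>s. K * \<bar>A \<omega> s - A \<omega> t\<bar>) \<longlongrightarrow> K * \<bar>A \<omega> t - A \<omega> t\<bar>) (at t within {0..T})"
    by (intro tendsto_intros)
  then have "((\<lambda>s. K * \<bar>A \<omega> s - A \<omega> t\<bar>) \<longlongrightarrow> 0) (at t within {0..T})" by simp
  moreover have "\<forall>\<^sub>F s in at t within {0..T}. norm (cumul \<omega> k s - cumul \<omega> k t) \<le> K * \<bar>A \<omega> s - A \<omega> t\<bar>"
    unfolding eventually_at_filter by (rule always_eventually) (use le in simp)
  ultimately have "((\<lambda>s. cumul \<omega> k s - cumul \<omega> k t) \<longlongrightarrow> 0) (at t within {0..T})"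
    by (rule Lim_null_comparison[rotated])
  then show "(cumul \<omega> k \<longlongrightarrow> cumul \<omega> k t) (at t within {0..T})" by (simp add: LIM_zero_iff)
qed

lemma cumul_measurable:
  assumes "\<omega> \<in> space M" "k \<in> borel_measurable mark_space"
    and "\<And>z. z \<in> {0..T} \<times> UNIV \<Longrightarrow> \<bar>k z\<bar> \<le> K"
  shows "(\<lambda>z. cumul \<omega> k (fst z)) \<in> borel_measurable mark_space"
  unfolding mark_space_def
  by (rule measurable_compose[OF measurable_fst borel_measurable_continuous_on_restrict[OF cumul_continuous[OF assms]]])

text \<open>
  The chain rule for the exponential.  Over a short interval both sides change by
  \<open>exp (g s) * (g t - g s)\<close> up to an error of order \<open>(A t - A s)\<^sup>2\<close>, so the difference of the two sides is
  constant by \<open>quadratic_increments_constant\<close>.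
\<close>

lemma exp_cumul:
  assumes \<omega>: "\<omega> \<in> space M" and k: "k \<in> borel_measurable mark_space"
    and K: "\<And>z. z \<in> {0..T} \<times> UNIV \<Longrightarrow> \<bar>k z\<bar> \<le> K" and ab: "0 \<le> a" "a \<le> b" "b \<le> T"
  shows "exp (cumul \<omega> k b) = exp (cumul \<omega> k a) +
    set_lebesgue_integral (\<nu> \<omega>) ({a<..b} \<times> UNIV) (\<lambda>z. exp (cumul \<omega> k (fst z)) * k z)"
proof -
  let ?g = "cumul \<omega> k"
  define R where "R = K * A \<omega> T"
  define I where "I s t = set_lebesgue_integral (\<nu> \<omega>) ({s<..t} \<times> UNIV) (\<lambda>z. exp (?g (fst z)) * k z)" for s t
  define \<Phi> where "\<Phi> t = exp (?g t) - I 0 t" for t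
  have K0: "0 \<le> K" using K[of "(0, undefined)"] T_pos by auto
  have R: "\<bar>?g t\<bar> \<le> R" if "t \<in> {0..T}" for t
  proof -
    have "\<bar>?g t\<bar> \<le> K * A \<omega> t" using cumul_lipschitz[OF \<omega> k K, of 0 t] that A_0[OF \<omega>] by auto
    also have "\<dots> \<le> R" unfolding R_def using that K0 by (intro mult_left_mono A_le \<omega>) auto
    finally show ?thesis .
  qed
  note [measurable] = k cumul_measurable[OF \<omega> k K]
  have bound: "\<bar>exp (?g (fst z)) * k z\<bar> \<le> exp R * K" if "z \<in> {0..T} \<times> UNIV" for z
    unfolding abs_mult using R[of "fst z"] that by (intro mult_mono K) auto
  have I_add: "I 0 t - I 0 s = I s t" if "0 \<le> s" "s \<le> t" "t \<le> T" for s t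
    unfolding I_def cumul_def[symmetric, where k="\<lambda>z. exp (cumul \<omega> k (fst z)) * k z"]
    by (rule cumul_diff[OF \<omega> _ bound that]) measurable
  have "\<Phi> b = \<Phi> a"
  proof (rule quadratic_increments_constant[OF ab(2)])
    show "continuous_on {a..b} (A \<omega>)" using A_continuous[OF \<omega>] ab by (auto intro: continuous_on_subset)
    show "A \<omega> s \<le> A \<omega> t" if "a \<le> s" "s \<le> t" "t \<le> b" for s t using that ab by (intro A_le \<omega>) auto
    fix s t assume "a \<le> s" "s \<le> t" "t \<le> b"
    then have st: "0 \<le> s" "s \<le> t" "t \<le> T" using ab by auto
    have incr: "0 \<le> A \<omega> t - A \<omega> s" using A_le[OF \<omega> st] by simp
    have cumul_diff_st: "?g t - ?g s = set_lebesgue_integral (\<nu> \<omega>) ({s<..t} \<times> UNIV) k"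
      by (rule cumul_diff[OF \<omega> k K st])
    have lin: "set_lebesgue_integral (\<nu> \<omega>) ({s<..t} \<times> UNIV) (\<lambda>z. exp (?g (fst z)) * k z - exp (?g s) * k z)
        = I s t - exp (?g s) * (?g t - ?g s)"
      unfolding I_def cumul_diff_st
      by (subst set_integral_diff)
         (auto intro!: set_integrable_\<nu>_bounded[OF \<omega> _ bound] set_integrable_mult_right set_integrable_\<nu>_bounded[OF \<omega> k K] simp: st)
    have "\<bar>set_lebesgue_integral (\<nu> \<omega>) ({s<..t} \<times> UNIV) (\<lambda>z. exp (?g (fst z)) * k z - exp (?g s) * k z)\<bar>
      \<le> (exp R * (K * (A \<omega> t - A \<omega> s)) * K) * (A \<omega> t - A \<omega> s)"
    proof (rule set_integral_\<nu>_bound[OF \<omega> _ _ _ st])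
      show "\<bar>exp (?g (fst z)) * k z - exp (?g s) * k z\<bar> \<le> exp R * K + exp R * K" if "z \<in> {0..T} \<times> UNIV" for z
      proof -
        have "\<bar>exp (?g s) * k z\<bar> \<le> exp R * K"
          unfolding abs_mult using R[of s] that st by (intro mult_mono K) auto
        then show ?thesis using bound[OF that] by linarith
      qed
      fix z :: "real \<times> 'e" assume z: "z \<in> {s<..t} \<times> UNIV"
      have z': "s \<le> fst z" "fst z \<le> t" "fst z \<in> {0..T}" using z st by auto
      have "\<bar>exp (?g (fst z)) - exp (?g s)\<bar> \<le> exp R * \<bar>?g (fst z) - ?g s\<bar>"
        using st z' by (intro exp_diff_le R) auto
      also have "\<dots> \<le> exp R * (K * (A \<omega> t - A \<omega> s))"
      proof (rule mult_left_mono)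
        have "\<bar>?g (fst z) - ?g s\<bar> \<le> K * (A \<omega> (fst z) - A \<omega> s)" using z' st by (intro cumul_lipschitz[OF \<omega> k K]) auto
        also have "\<dots> \<le> K * (A \<omega> t - A \<omega> s)" using K0 A_le[OF \<omega>, of "fst z" t] z' st by (intro mult_left_mono) auto
        finally show "\<bar>?g (fst z) - ?g s\<bar> \<le> K * (A \<omega> t - A \<omega> s)" .
      qed simp
      finally have "\<bar>exp (?g (fst z)) - exp (?g s)\<bar> * \<bar>k z\<bar> \<le> exp R * (K * (A \<omega> t - A \<omega> s)) * K"
        using K[of z] z' incr K0 by (intro mult_mono) (auto simp: mem_Times_iff)
      then show "\<bar>exp (?g (fst z)) * k z - exp (?g s) * k z\<bar> \<le> exp R * (K * (A \<omega> t - A \<omega> s)) * K"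
        by (simp add: abs_mult[symmetric] left_diff_distrib)
    qed simp
    moreover have "\<bar>exp (?g t) - exp (?g s) - exp (?g s) * (?g t - ?g s)\<bar> \<le> exp R * (K * (A \<omega> t - A \<omega> s))\<^sup>2"
    proof -
      have "\<bar>exp (?g t) - exp (?g s) - exp (?g s) * (?g t - ?g s)\<bar> \<le> exp R * (?g t - ?g s)\<^sup>2"
        using st by (intro exp_diff_le R) auto
      also have "(?g t - ?g s)\<^sup>2 \<le> (K * (A \<omega> t - A \<omega> s))\<^sup>2"
        using cumul_lipschitz[OF \<omega> k K st] by (intro power2_le_iff_abs_le[THEN iffD2]) (auto simp: incr K0)
      finally show ?thesis by simp
    qed
    moreover have "\<Phi> t - \<Phi> s = exp (?g t) - exp (?g s) - I s t"
      using I_add[OF st] by (simp add: \<Phi>_def)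
    ultimately have "\<bar>\<Phi> t - \<Phi> s\<bar> \<le> exp R * (K * (A \<omega> t - A \<omega> s))\<^sup>2 + (exp R * (K * (A \<omega> t - A \<omega> s)) * K) * (A \<omega> t - A \<omega> s)"
      unfolding lin by linarith
    also have "\<dots> = (2 * exp R * K\<^sup>2) * (A \<omega> t - A \<omega> s)\<^sup>2" by (simp add: power2_eq_square algebra_simps)
    finally show "\<bar>\<Phi> t - \<Phi> s\<bar> \<le> (2 * exp R * K\<^sup>2) * (A \<omega> t - A \<omega> s)\<^sup>2" .
  qed
  then show ?thesis using I_add[OF ab] unfolding \<Phi>_def I_def[symmetric] by simp
qed

definition jump_prod :: "'a \<Rightarrow> (real \<times> 'e \<Rightarrow> real) \<Rightarrow> real \<Rightarrow> real" where
  "jump_prod \<omega> R t = (\<Prod>n\<in>{n \<in> jumps \<omega>. time n \<omega> < t}. R (time n \<omega>, X n \<omega>))"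

lemma jump_prod_bound:
  assumes \<omega>: "\<omega> \<in> space M" and R: "\<And>z. z \<in> {0..T} \<times> UNIV \<Longrightarrow> \<bar>R z\<bar> \<le> K"
  shows "\<bar>jump_prod \<omega> R t\<bar> \<le> max 1 K ^ card (jumps \<omega>)"
proof -
  let ?F = "{n \<in> jumps \<omega>. time n \<omega> < t}"
  have "\<bar>jump_prod \<omega> R t\<bar> = (\<Prod>n\<in>?F. \<bar>R (time n \<omega>, X n \<omega>)\<bar>)" unfolding jump_prod_def by (rule abs_prod)
  also have "\<dots> \<le> (\<Prod>n\<in>?F. max 1 K)"
    using R[of "(time _ \<omega>, X _ \<omega>)"] time_jumps[OF \<omega>]
    by (intro prod_mono conjI) (auto intro!: max.coboundedI2 simp: less_imp_le)
  also have "\<dots> \<le> max 1 K ^ card (jumps \<omega>)"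
    unfolding prod_constant using card_mono[OF finite_jumps[OF \<omega>], of ?F]
    by (intro power_increasing) auto
  finally show ?thesis .
qed

text \<open>
  The integrated form of \<open>dL = L\<^sub>- (R - 1) (d\<mu> - d\<nu>)\<close>.  The product over the jumps is expanded by
  telescoping into \<open>1\<close> plus one term for each jump; each term is then multiplied by the exponential at
  time \<open>v\<close>, which the chain rule expresses through its value at the time of that jump.  Collecting the
  terms under the integral sign rebuilds the product over the jumps before the integration variable.
\<close>

lemma doleans_equation:
  assumes \<omega>: "\<omega> \<in> space M" and R: "R \<in> borel_measurable mark_space"
    and K: "\<And>z. z \<in> {0..T} \<times> UNIV \<Longrightarrow> \<bar>R z\<bar> \<le> K" and v: "0 \<le> v" "v \<le> T"
  defines "g \<equiv> cumul \<omega> (\<lambda>z. 1 - R z)"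
  shows "exp (g v) * (\<Prod>n\<in>{n \<in> jumps \<omega>. time n \<omega> \<le> v}. R (time n \<omega>, X n \<omega>)) = 1 +
    (\<Sum>n\<in>{n \<in> jumps \<omega>. time n \<omega> \<le> v}. exp (g (time n \<omega>)) * jump_prod \<omega> R (time n \<omega>) * (R (time n \<omega>, X n \<omega>) - 1)) +
    set_lebesgue_integral (\<nu> \<omega>) ({0<..v} \<times> UNIV) (\<lambda>z. exp (g (fst z)) * jump_prod \<omega> R (fst z) * (1 - R z))"
proof -
  define r where "r n = R (time n \<omega>, X n \<omega>)" for n
  define q where "q n = jump_prod \<omega> R (time n \<omega>) * (r n - 1)" for n
  let ?J = "{n \<in> jumps \<omega>. time n \<omega> \<le> v}"
  note fin = finite_jumps[OF \<omega>]
  note [measurable] = R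
  have k: "(\<lambda>z. 1 - R z) \<in> borel_measurable mark_space" by measurable
  have kK: "\<bar>1 - R z\<bar> \<le> 1 + K" if "z \<in> {0..T} \<times> UNIV" for z using K[OF that] by linarith
  \<comment> \<open>The set has to be closed under passing to earlier jumps, so that the partial products within it are jump products.\<close>
  have telescope: "(\<Prod>n\<in>F. r n) = 1 + (\<Sum>n\<in>F. q n)"
    if F: "F \<subseteq> jumps \<omega>" "\<And>m n. n \<in> F \<Longrightarrow> m \<in> jumps \<omega> \<Longrightarrow> time m \<omega> \<le> time n \<omega> \<Longrightarrow> m \<in> F" for F
  proof -
    have "{m \<in> F. m < n} = {m \<in> jumps \<omega>. time m \<omega> < time n \<omega>}" if "n \<in> F" for n
    proof -
      have lt: "time m \<omega> < time n \<omega> \<longleftrightarrow> m < n" if "m \<in> jumps \<omega>" for m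
        using time_strict[OF \<omega> _ that] F(1) \<open>n \<in> F\<close> by blast
      have "m \<in> F" if "m \<in> jumps \<omega>" "time m \<omega> < time n \<omega>" for m
        using F(2)[OF \<open>n \<in> F\<close> that(1)] that(2) by simp
      then show ?thesis using lt F(1) by blast
    qed
    then have "(\<Prod>m\<in>{m\<in>F. m < n}. r m) = jump_prod \<omega> R (time n \<omega>)" if "n \<in> F" for n
      using that by (simp add: jump_prod_def r_def)
    then show ?thesis using prod_telescope[OF finite_subset[OF F(1) fin], of r] by (simp add: q_def)
  qed
  note E = exp_cumul[OF \<omega> k kK, folded g_def]
  have gm [measurable]: "(\<lambda>z. g (fst z)) \<in> borel_measurable mark_space" unfolding g_def by (rule cumul_measurable[OF \<omega> k kK])
  have "continuous_on {0..T} g" unfolding g_def by (rule cumul_continuous[OF \<omega> k kK])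
  then have "bounded (g ` {0..T})" by (intro compact_imp_bounded compact_continuous_image) auto
  then obtain G where "\<forall>x\<in>g ` {0..T}. norm x \<le> G" unfolding bounded_iff by blast
  then have G: "\<And>t. t \<in> {0..T} \<Longrightarrow> \<bar>g t\<bar> \<le> G" by simp
  have b1: "\<bar>exp (g (fst z)) * (1 - R z)\<bar> \<le> exp G * (1 + K)" if "z \<in> {0..T} \<times> UNIV" for z
    unfolding abs_mult using kK[OF that] G[of "fst z"] that by (intro mult_mono) auto
  have E0: "exp (g v) = 1 + set_lebesgue_integral (\<nu> \<omega>) ({0<..v} \<times> UNIV) (\<lambda>z. exp (g (fst z)) * (1 - R z))"
    using E[of 0 v] v by (simp add: g_def)
  have En: "q n * exp (g v) = q n * exp (g (time n \<omega>)) + 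
      set_lebesgue_integral (\<nu> \<omega>) ({0<..v} \<times> UNIV) (\<lambda>z. (if time n \<omega> < fst z then q n else 0) * (exp (g (fst z)) * (1 - R z)))"
    if "n \<in> ?J" for n
  proof -
    have t: "0 < time n \<omega>" "time n \<omega> \<le> v" using that time_jumps[OF \<omega>] by auto
    have "set_lebesgue_integral (\<nu> \<omega>) ({0<..v} \<times> UNIV) (\<lambda>z. (if time n \<omega> < fst z then q n else 0) * (exp (g (fst z)) * (1 - R z)))
      = set_lebesgue_integral (\<nu> \<omega>) ({time n \<omega><..v} \<times> UNIV) (\<lambda>z. q n * (exp (g (fst z)) * (1 - R z)))"
      unfolding set_lebesgue_integral_def using t by (intro Bochner_Integration.integral_cong) (auto simp: indicator_def)
    also have "\<dots> = q n * set_lebesgue_integral (\<nu> \<omega>) ({time n \<omega><..v} \<times> UNIV) (\<lambda>z. exp (g (fst z)) * (1 - R z))"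
      by (rule set_integral_mult_right)
    finally show ?thesis using E[of "time n \<omega>" v] t v by (simp add: algebra_simps)
  qed
  have int1: "set_integrable (\<nu> \<omega>) ({0<..v} \<times> UNIV) (\<lambda>z. exp (g (fst z)) * (1 - R z))"
    using v by (intro set_integrable_\<nu>_bounded[OF \<omega> _ b1]) auto
  have intn: "set_integrable (\<nu> \<omega>) ({0<..v} \<times> UNIV) (\<lambda>z. (if time n \<omega> < fst z then q n else 0) * (exp (g (fst z)) * (1 - R z)))" for n
  proof (rule set_integrable_\<nu>_bounded[OF \<omega>])
    show "\<bar>(if time n \<omega> < fst z then q n else 0) * (exp (g (fst z)) * (1 - R z))\<bar> \<le> \<bar>q n\<bar> * (exp G * (1 + K))"
      if "z \<in> {0..T} \<times> UNIV" for z
      unfolding abs_mult[of "if _ then _ else _"] using b1[OF that] by (intro mult_mono) auto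
  qed (use v in auto)
  have prod: "(\<Prod>n\<in>?J. r n) = 1 + (\<Sum>n\<in>?J. q n)" by (rule telescope) auto
  have jp: "jump_prod \<omega> R t = 1 + (\<Sum>n\<in>?J. if time n \<omega> < t then q n else 0)" if "t \<le> v" for t
  proof -
    have "jump_prod \<omega> R t = 1 + (\<Sum>n\<in>{n \<in> jumps \<omega>. time n \<omega> < t}. q n)"
      unfolding jump_prod_def r_def[symmetric] by (rule telescope) auto
    also have "(\<Sum>n\<in>{n \<in> jumps \<omega>. time n \<omega> < t}. q n) = (\<Sum>n\<in>?J. if time n \<omega> < t then q n else 0)"
      using fin that by (intro sum.mono_neutral_cong_left) auto
    finally show ?thesis .
  qed
  have "exp (g v) * (\<Prod>n\<in>?J. r n) = exp (g v) + (\<Sum>n\<in>?J. q n * exp (g v))"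
    unfolding prod by (simp add: algebra_simps sum_distrib_right sum_distrib_left)
  also have "(\<Sum>n\<in>?J. q n * exp (g v)) = (\<Sum>n\<in>?J. q n * exp (g (time n \<omega>))) + 
      (\<Sum>n\<in>?J. set_lebesgue_integral (\<nu> \<omega>) ({0<..v} \<times> UNIV) (\<lambda>z. (if time n \<omega> < fst z then q n else 0) * (exp (g (fst z)) * (1 - R z))))"
    using En by (simp add: sum.distrib)
  also have "(\<Sum>n\<in>?J. set_lebesgue_integral (\<nu> \<omega>) ({0<..v} \<times> UNIV) (\<lambda>z. (if time n \<omega> < fst z then q n else 0) * (exp (g (fst z)) * (1 - R z))))
     = set_lebesgue_integral (\<nu> \<omega>) ({0<..v} \<times> UNIV) (\<lambda>z. \<Sum>n\<in>?J. (if time n \<omega> < fst z then q n else 0) * (exp (g (fst z)) * (1 - R z)))"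
    unfolding set_lebesgue_integral_def scaleR_sum_right
    by (intro Bochner_Integration.integral_sum[symmetric] intn[unfolded set_integrable_def])
  finally have "exp (g v) * (\<Prod>n\<in>?J. r n) = 1 + (\<Sum>n\<in>?J. q n * exp (g (time n \<omega>))) + 
      (set_lebesgue_integral (\<nu> \<omega>) ({0<..v} \<times> UNIV) (\<lambda>z. exp (g (fst z)) * (1 - R z)) + 
       set_lebesgue_integral (\<nu> \<omega>) ({0<..v} \<times> UNIV) (\<lambda>z. \<Sum>n\<in>?J. (if time n \<omega> < fst z then q n else 0) * (exp (g (fst z)) * (1 - R z))))"
    using E0 by linarith
  also have "(set_lebesgue_integral (\<nu> \<omega>) ({0<..v} \<times> UNIV) (\<lambda>z. exp (g (fst z)) * (1 - R z)) + 
       set_lebesgue_integral (\<nu> \<omega>) ({0<..v} \<times> UNIV) (\<lambda>z. \<Sum>n\<in>?J. (if time n \<omega> < fst z then q n else 0) * (exp (g (fst z)) * (1 - R z))))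
     = set_lebesgue_integral (\<nu> \<omega>) ({0<..v} \<times> UNIV) (\<lambda>z. exp (g (fst z)) * (1 - R z) + (\<Sum>n\<in>?J. (if time n \<omega> < fst z then q n else 0) * (exp (g (fst z)) * (1 - R z))))"
  proof (rule set_integral_add(2)[symmetric, OF int1])
    show "set_integrable (\<nu> \<omega>) ({0<..v} \<times> UNIV) (\<lambda>z. \<Sum>n\<in>?J. (if time n \<omega> < fst z then q n else 0) * (exp (g (fst z)) * (1 - R z)))"
      unfolding set_integrable_def scaleR_sum_right
      by (intro Bochner_Integration.integrable_sum intn[unfolded set_integrable_def])
  qed
  also have "\<dots> = set_lebesgue_integral (\<nu> \<omega>) ({0<..v} \<times> UNIV) (\<lambda>z. exp (g (fst z)) * jump_prod \<omega> R (fst z) * (1 - R z))"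
    unfolding set_lebesgue_integral_def sum_distrib_right[symmetric]
  proof (intro Bochner_Integration.integral_cong refl)
    fix z :: "real \<times> 'e"
    let ?c = "exp (g (fst z)) * (1 - R z)" and ?\<Sigma> = "\<Sum>n\<in>?J. if time n \<omega> < fst z then q n else 0"
    have "?c + ?\<Sigma> * ?c = exp (g (fst z)) * jump_prod \<omega> R (fst z) * (1 - R z)" if "fst z \<le> v"
      unfolding jp[OF that] by (simp only: algebra_simps)
    then show "indicator ({0<..v} \<times> UNIV) z *\<^sub>R (?c + ?\<Sigma> * ?c) = 
        indicator ({0<..v} \<times> UNIV) z *\<^sub>R (exp (g (fst z)) * jump_prod \<omega> R (fst z) * (1 - R z))"
      by (cases z) (auto simp: indicator_def)
  qed
  finally show ?thesis by (simp add: r_def q_def ac_simps)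
qed

end

section \<open>Integrability of the exponential weight\<close>

context marked_point_process
begin

definition count_before :: "'a \<Rightarrow> real \<Rightarrow> nat" where
  "count_before \<omega> t = card {n \<in> jumps \<omega>. time n \<omega> < t}"

lemma jumps_before_jump:
  assumes \<omega>: "\<omega> \<in> space M" and n: "n \<in> jumps \<omega>"
  shows "{m \<in> jumps \<omega>. time m \<omega> < time n \<omega>} = {1..<n}"
  using time_strict[OF \<omega> n] jumps_downward[OF \<omega> n] by (auto simp: jumps_def[of \<omega>])

lemma count_before_jump: "\<omega> \<in> space M \<Longrightarrow> n \<in> jumps \<omega> \<Longrightarrow> count_before \<omega> (time n \<omega>) = n - 1"
  by (simp add: count_before_def jumps_before_jump)

lemma jumps_eq_atLeastAtMost:
  assumes \<omega>: "\<omega> \<in> space M" and n: "S n \<omega> \<le> ennreal T" "ennreal T < S (Suc n) \<omega>"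
  shows "jumps \<omega> = {1..n}"
proof -
  have "S m \<omega> \<le> ennreal T \<longleftrightarrow> m \<le> n" for m
  proof
    show "S m \<omega> \<le> ennreal T" if "m \<le> n" using order.trans[OF S_incseq[OF \<omega> that] n(1)] .
    show "m \<le> n" if "S m \<omega> \<le> ennreal T"
    proof (rule ccontr)
      assume "\<not> m \<le> n"
      then have "S (Suc n) \<omega> \<le> S m \<omega>" by (intro S_incseq[OF \<omega>]) simp
      then show False using n(2) that by simp
    qed
  qed
  then show ?thesis unfolding jumps_def by (intro set_eqI) (simp only: mem_Collect_eq atLeastAtMost_iff)
qed

end

context continuous_compensator
begin

text \<open>
  The number of factors is random, but at every point the product over the first \<open>m\<close> indices, with
  the factor \<open>1\<close> for points that have not occurred yet, is eventually constant in \<open>m\<close>.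
\<close>

lemma predictable_jump_prod:
  assumes H: "H \<in> predictable_sigma \<Otimes>\<^sub>M borel \<rightarrow>\<^sub>M borel"
  shows "(\<lambda>z. jump_prod (fst z) (\<lambda>y. H ((fst z, fst y), snd y)) (snd z)) \<in> borel_measurable predictable_sigma"
proof -
  define h where "h n z = (if S n (fst z) < ennreal (snd z) then H ((fst z, time n (fst z)), X n (fst z)) else 1)" for n z
  have [measurable]: "h n \<in> predictable_sigma \<rightarrow>\<^sub>M borel" if "1 \<le> n" for n
    unfolding h_def by (rule measurable_predictable_compose_jump[OF that H])
  show ?thesis
  proof (rule borel_measurable_LIMSEQ_real)
    fix z assume z: "z \<in> space predictable_sigma"
    then have \<omega>: "fst z \<in> space M" and t: "snd z \<le> T" by auto
    let ?J = "{n \<in> jumps (fst z). time n (fst z) < snd z}"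
    have fin: "finite ?J" using finite_jumps[OF \<omega>] by simp
    have "(\<Prod>n\<in>{1..m}. h n z) = jump_prod (fst z) (\<lambda>y. H ((fst z, fst y), snd y)) (snd z)" if m: "Max (insert 0 ?J) \<le> m" for m
    proof -
      have "?J \<subseteq> {1..m}" using m fin by (auto simp: jumps_def)
      moreover have "h n z = 1" if "n \<in> {1..m} - ?J" for n
        using that jumpsI[of n "fst z" "snd z"] t S_less_iff[of n "fst z" "snd z"] by (auto simp: h_def)
      ultimately have "(\<Prod>n\<in>{1..m}. h n z) = (\<Prod>n\<in>?J. h n z)"
        by (intro prod.mono_neutral_right) auto
      also have "\<dots> = jump_prod (fst z) (\<lambda>y. H ((fst z, fst y), snd y)) (snd z)"
        unfolding jump_prod_def by (intro prod.cong) (auto simp: h_def S_less_iff)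
      finally show ?thesis .
    qed
    then show "(\<lambda>m. \<Prod>n\<in>{1..m}. h n z) \<longlonglongrightarrow> jump_prod (fst z) (\<lambda>y. H ((fst z, fst y), snd y)) (snd z)"
      by (intro tendsto_eventually eventually_sequentiallyI)
  qed (auto intro!: borel_measurable_prod)
qed

lemma jump_prod_const: "jump_prod \<omega> (\<lambda>_. c) t = c ^ count_before \<omega> t"
  by (simp add: jump_prod_def count_before_def)

lemma predictable_power_count [measurable]:
  "(\<lambda>z. c ^ count_before (fst z) (snd z) :: real) \<in> borel_measurable predictable_sigma"
  using predictable_jump_prod[of "\<lambda>_. c"] by (simp add: jump_prod_const)

lemma cumul_1:
  assumes "\<omega> \<in> space M" "0 \<le> t" "t \<le> T"
  shows "cumul \<omega> (\<lambda>_. 1) t = A \<omega> t"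
  using measure_slab[OF assms(1), of 0 t] sets_slab[of 0 t \<omega>] assms A_0
  by (simp add: cumul_def set_lebesgue_integral_def sets.Int_space_eq2)

lemma nn_integral_exp_A:
  assumes \<omega>: "\<omega> \<in> space M" and ab: "0 \<le> a" "a \<le> b" "b \<le> T"
  shows "ennreal (exp (A \<omega> b)) = ennreal (exp (A \<omega> a)) + 
    (\<integral>\<^sup>+z. (if a < fst z \<and> fst z \<le> b then ennreal (exp (A \<omega> (fst z))) else 0) \<partial>\<nu> \<omega>)"
proof -
  let ?f = "\<lambda>z::real \<times> 'e. exp (cumul \<omega> (\<lambda>_. 1) (fst z)) * 1"
  let ?I = "set_lebesgue_integral (\<nu> \<omega>) ({a<..b} \<times> UNIV) ?f"
  have m: "?f \<in> borel_measurable mark_space"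
    using cumul_measurable[OF \<omega>, of "\<lambda>_. 1" 1] by simp
  have b: "\<bar>?f z\<bar> \<le> exp (A \<omega> T)" if "z \<in> {0..T} \<times> UNIV" for z
    using that A_le[OF \<omega>, of "fst z" T] by (auto simp: cumul_1[OF \<omega>])
  have "(\<integral>\<^sup>+z. (if a < fst z \<and> fst z \<le> b then ennreal (exp (A \<omega> (fst z))) else 0) \<partial>\<nu> \<omega>) = 
     (\<integral>\<^sup>+z. ennreal (indicator ({a<..b} \<times> UNIV) z *\<^sub>R ?f z) \<partial>\<nu> \<omega>)"
    using ab by (intro nn_integral_cong) (auto simp: indicator_def cumul_1[OF \<omega>] space_\<nu>[OF \<omega>])
  also have "\<dots> = ennreal ?I"
    unfolding set_lebesgue_integral_def
    using set_integrable_\<nu>_bounded[OF \<omega> m b ab(1,3)]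
    by (intro nn_integral_eq_integral) (auto simp: set_integrable_def)
  finally have 1: "(\<integral>\<^sup>+z. (if a < fst z \<and> fst z \<le> b then ennreal (exp (A \<omega> (fst z))) else 0) \<partial>\<nu> \<omega>) = ennreal ?I" .
  have "exp (A \<omega> b) = exp (A \<omega> a) + ?I"
    using exp_cumul[OF \<omega>, of "\<lambda>_. 1" 1 a b] ab by (simp add: cumul_1[OF \<omega>])
  moreover have "0 \<le> ?I" unfolding set_lebesgue_integral_def by (intro integral_nonneg_AE) auto
  ultimately show ?thesis unfolding 1 by (simp add: ennreal_plus[symmetric] del: ennreal_plus)
qed

lemma compensator_pair:
  assumes "H \<in> predictable_sigma \<Otimes>\<^sub>M borel \<rightarrow>\<^sub>M (borel :: ennreal measure)"
  shows "(\<integral>\<^sup>+\<omega>. (\<integral>\<^sup>+z. H ((\<omega>, fst z), snd z) \<partial>\<mu> \<omega>) \<partial>M) = (\<integral>\<^sup>+\<omega>. (\<integral>\<^sup>+z. H ((\<omega>, fst z), snd z) \<partial>\<nu> \<omega>) \<partial>M)"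
  using compensator[OF assms] by (simp add: split_beta')

definition capped :: "nat \<Rightarrow> 'a \<Rightarrow> real" where
  "capped n \<omega> = (if S n \<omega> \<le> ennreal T then time n \<omega> else T)"

lemma capped_range: "0 \<le> capped n \<omega>" "capped n \<omega> \<le> T"
  using T_pos time_nonneg time_le[of T n \<omega>] by (auto simp: capped_def)

lemma capped_eq: "capped n \<omega> = enn2real (min (S n \<omega>) (ennreal T))"
  using T_pos by (auto simp: capped_def time_def min_def)

lemma capped_mono: "\<omega> \<in> space M \<Longrightarrow> capped n \<omega> \<le> capped (Suc n) \<omega>"
  unfolding capped_eq using S_incseq[of \<omega> n "Suc n"]
  by (intro enn2real_mono min.mono) (auto simp: min_less_iff_disj)

lemma A_section_measurable:
  assumes "t \<in> {0..T}"
  shows "(\<lambda>\<omega>. A \<omega> t) \<in> borel_measurable (history (ennreal t))"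
  using measurable_compose[OF measurable_predictable_section[OF assms] A_measurable] by simp

end

locale survival_compensator = continuous_compensator M T \<Delta> S X A \<phi>
  for M :: "'a measure" and T and \<Delta> :: "'e :: topological_space" and S X A \<phi> +
  assumes survival: "\<And>n. AE \<omega> in M. 0 < real_cond_exp M (pre_sigma (S n))
            (indicator {\<omega>' \<in> space M. ennreal T < S (Suc n) \<omega>'}) \<omega>"
begin

text \<open>
  The conditional probability of \<open>T < S (Suc n)\<close> has integral \<open>0\<close> over \<open>B\<close> although it is
  almost surely positive.
\<close>

lemma survival_null:
  assumes B: "B \<in> sets (pre_sigma (S n))" and disj: "\<And>\<omega>. \<omega> \<in> B \<Longrightarrow> \<not> ennreal T < S (Suc n) \<omega>"
  shows "AE \<omega> in M. \<omega> \<notin> B"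
proof -
  let ?F = "pre_sigma (S n)" and ?V = "{\<omega>' \<in> space M. ennreal T < S (Suc n) \<omega>'}"
  have "subalgebra M ?F"
    unfolding subalgebra_def using sets_pre_sigma_subset by (simp add: space_pre_sigma)
  then interpret F: finite_measure_subalgebra M ?F by unfold_locales
  have BM [measurable]: "B \<in> sets M" using B sets_pre_sigma_subset by auto
  have V [measurable]: "?V \<in> sets M" by measurable
  have int: "integrable M (indicator ?V :: 'a \<Rightarrow> real)" by (intro integrable_real_indicator) (auto simp: emeasure_eq_measure)
  let ?c = "real_cond_exp M ?F (indicator ?V)"
  have [measurable]: "?c \<in> borel_measurable M" by (rule borel_measurable_cond_exp2)
  have "(\<integral>\<omega>. indicator B \<omega> * ?c \<omega> \<partial>M) = (\<integral>\<omega>. indicator B \<omega> * indicator ?V \<omega> \<partial>M)"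
    using F.real_cond_exp_intA[OF int B] by (simp add: set_lebesgue_integral_def)
  also have "\<dots> = (\<integral>\<omega>. 0 \<partial>M)" using disj by (intro Bochner_Integration.integral_cong) (auto simp: indicator_def)
  finally have 0: "(\<integral>\<omega>. indicator B \<omega> * ?c \<omega> \<partial>M) = 0" by simp
  have "integrable M (\<lambda>\<omega>. indicator B \<omega> * ?c \<omega>)"
    using F.real_cond_exp_int(1)[OF int] integrable_mult_indicator[OF BM, of ?c] by simp
  moreover have "AE \<omega> in M. 0 \<le> indicator B \<omega> * ?c \<omega>" using survival[of n] by (auto elim!: eventually_mono)
  ultimately have "AE \<omega> in M. indicator B \<omega> * ?c \<omega> = 0"
    using integral_nonneg_eq_0_iff_AE 0 by blast
  with survival[of n] show ?thesis by eventually_elim (auto simp: indicator_def)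
qed

text \<open>
  Up to the next point, \<open>A\<close> is bounded by a quantity that is already known at \<open>S n\<close>.  By
  \<open>history_between_jumps\<close> the events \<open>A\<^sub>t > k\<close>, with \<open>t\<close> rational or \<open>t = T\<close>, agree before the next point with
  events \<open>B k t\<close> known at \<open>S n\<close>, and by continuity \<open>A\<close> exceeds \<open>k\<close> before the next point only on their
  union \<open>Bad k\<close>.  If all \<open>Bad k\<close> occurred and the next point came after \<open>T\<close>, then \<open>A\<^sub>T\<close> would be infinite.
  So the intersection of the \<open>Bad k\<close> is disjoint from the event of survival, and it is a null set by
  \<open>survival_null\<close>.
\<close>

lemma bounded_hazard_sets:
  obtains G where "\<And>k. G k \<in> sets (pre_sigma (S n))" "incseq G" "AE \<omega> in M. \<exists>k. \<omega> \<in> G k"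
    "\<And>k \<omega>. \<omega> \<in> G k \<Longrightarrow> S n \<omega> \<le> ennreal T \<Longrightarrow> A \<omega> (capped (Suc n) \<omega>) \<le> real k"
proof -
  define D where "D = insert T (\<rat> \<inter> {0..T})"
  have D: "countable D" "D \<subseteq> {0..T}" "T \<in> D"
    unfolding D_def using countable_rat T_pos by (auto intro: countable_subset)
  define E where "E k t = {\<omega> \<in> space M. real k < A \<omega> t}" for k :: nat and t
  have "E k t \<in> sets (history (ennreal t))" if "t \<in> D" for k t
    using borel_measurable_less[OF borel_measurable_const A_section_measurable[of t], of "real k"] that D
    by (auto simp: E_def)
  then have ex: "\<exists>B\<in>sets (pre_sigma (S n)). \<forall>\<omega>\<in>space M. S n \<omega> \<le> ennreal t \<and> ennreal t < S (Suc n) \<omega> \<longrightarrow> (\<omega> \<in> E k t \<longleftrightarrow> \<omega> \<in> B)"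
    if "t \<in> D" for k t using that history_between_jumps by blast
  define B where "B k t = (SOME B. B \<in> sets (pre_sigma (S n)) \<and> (\<forall>\<omega>\<in>space M. S n \<omega> \<le> ennreal t \<and> ennreal t < S (Suc n) \<omega> \<longrightarrow> (\<omega> \<in> E k t \<longleftrightarrow> \<omega> \<in> B)))" for k t
  have "B k t \<in> sets (pre_sigma (S n)) \<and> (\<forall>\<omega>\<in>space M. S n \<omega> \<le> ennreal t \<and> ennreal t < S (Suc n) \<omega> \<longrightarrow> (\<omega> \<in> E k t \<longleftrightarrow> \<omega> \<in> B k t))"
    if "t \<in> D" for k t
    unfolding B_def by (rule someI_ex) (use ex[OF that] in blast)
  then have B: "\<And>k t. t \<in> D \<Longrightarrow> B k t \<in> sets (pre_sigma (S n))"
    "\<And>k t \<omega>. t \<in> D \<Longrightarrow> \<omega> \<in> space M \<Longrightarrow> S n \<omega> \<le> ennreal t \<Longrightarrow> ennreal t < S (Suc n) \<omega> \<Longrightarrow> \<omega> \<in> E k t \<longleftrightarrow> \<omega> \<in> B k t"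
    by blast+
  define Bad where "Bad k = (\<Union>t\<in>D. B k t \<inter> {\<omega> \<in> space M. S n \<omega> \<le> ennreal t})" for k
  have "{\<omega> \<in> space M. S n \<omega> \<le> ennreal t} \<in> sets (pre_sigma (S n))" for t
  proof -
    have "{\<omega> \<in> space (pre_sigma (S n)). S n \<omega> \<le> ennreal t} \<in> sets (pre_sigma (S n))"
      using measurable_stopping_time_pre_sigma[OF stopping_time_S, of n] by measurable
    then show ?thesis by (simp add: space_pre_sigma)
  qed
  then have Bad: "Bad k \<in> sets (pre_sigma (S n))" for k
    unfolding Bad_def using D(1) B(1) by (intro sets.countable_UN') auto
  have exceeds: "\<omega> \<in> Bad k" if \<omega>: "\<omega> \<in> space M" and n: "S n \<omega> \<le> ennreal T" and gt: "real k < A \<omega> (capped (Suc n) \<omega>)" for \<omega> k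
  proof (cases "ennreal T < S (Suc n) \<omega>")
    case True
    then have "capped (Suc n) \<omega> = T" by (auto simp: capped_def)
    then have "\<omega> \<in> E k T" using gt \<omega> by (simp add: E_def)
    then have "\<omega> \<in> B k T" using B(2)[OF D(3) \<omega> n True] by simp
    then show ?thesis unfolding Bad_def using n \<omega> D(3) by auto
  next
    case False
    let ?s = "time (Suc n) \<omega>"
    have j: "Suc n \<in> jumps \<omega>" using False by (simp add: jumps_def not_less)
    have s: "?s \<in> {0..T}" using time_jumps[OF \<omega> j] by auto
    have c: "capped (Suc n) \<omega> = ?s" using False by (simp add: capped_def not_less)
    have lt: "time n \<omega> < ?s"
      using S_less_S_Suc[OF \<omega> n] S_eq_time[OF n] less_S_iff[OF time_nonneg[of n \<omega>] j] by simp
    \<comment> \<open>The next point comes before \<open>T\<close>: left continuity of \<open>A\<close> gives a rational time strictly between the two points.\<close>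
    have "(A \<omega> \<longlongrightarrow> A \<omega> ?s) (at ?s within {0..T})" using A_continuous[OF \<omega>] s by (auto simp: continuous_on_def)
    then have "\<forall>\<^sub>F t in at ?s within {0..T}. real k < A \<omega> t" using gt c by (intro order_tendstoD) auto
    then obtain d where d: "0 < d" "\<And>t. t \<in> {0..T} \<Longrightarrow> t \<noteq> ?s \<Longrightarrow> dist t ?s < d \<Longrightarrow> real k < A \<omega> t"
      unfolding eventually_at by blast
    obtain q where q: "q \<in> \<rat>" "max (time n \<omega>) (?s - d) < q" "q < ?s"
      using Rats_dense_in_real[of "max (time n \<omega>) (?s - d)" ?s] lt d(1) by auto
    have q0: "0 \<le> q" "q \<le> T" using q time_nonneg[of n \<omega>] s by auto
    have "q \<in> D" using q q0 by (simp add: D_def)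
    moreover have "\<omega> \<in> E k q" unfolding E_def using \<omega> d(2)[of q] q q0 by (auto simp: dist_real_def)
    moreover have nq: "S n \<omega> \<le> ennreal q" using S_eq_time[OF n] q by (simp add: ennreal_leI)
    moreover have "ennreal q < S (Suc n) \<omega>" using less_S_iff[OF q0(1) j] q by simp
    ultimately have "\<omega> \<in> B k q" using B(2) \<omega> by blast
    then show ?thesis unfolding Bad_def using nq \<omega> \<open>q \<in> D\<close> by blast
  qed
  have "AE \<omega> in M. \<omega> \<notin> (\<Inter>k. Bad k)"
  proof (rule survival_null[of _ n])
    show "(\<Inter>k. Bad k) \<in> sets (pre_sigma (S n))" using Bad by auto
    fix \<omega> assume bad: "\<omega> \<in> (\<Inter>k. Bad k)"
    show "\<not> ennreal T < S (Suc n) \<omega>"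
    proof
      assume late: "ennreal T < S (Suc n) \<omega>"
      obtain j where j: "A \<omega> T \<le> real j" using real_arch_simple by blast
      obtain t where t: "t \<in> D" "\<omega> \<in> B j t" "\<omega> \<in> space M" "S n \<omega> \<le> ennreal t" using bad unfolding Bad_def by blast
      have "t \<in> {0..T}" using t D by auto
      then have "ennreal t < S (Suc n) \<omega>" using late by (auto intro: le_less_trans ennreal_leI)
      then have "\<omega> \<in> E j t" using B(2)[OF t(1,3,4)] t(2) by blast
      then have "real j < A \<omega> t" by (simp add: E_def)
      then show False using A_le[OF t(3), of t T] \<open>t \<in> {0..T}\<close> j by auto
    qed
  qed
  then have *: "AE \<omega> in M. \<exists>k. \<omega> \<in> space M - (\<Inter>j\<le>k. Bad j)" by (auto elim!: AE_mp)
  show ?thesis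
  proof (rule that[of "\<lambda>k. space M - (\<Inter>j\<le>k. Bad j)"])
    show "space M - (\<Inter>j\<le>k. Bad j) \<in> sets (pre_sigma (S n))" for k
      using sets.compl_sets[of "\<Inter>j\<le>k. Bad j" "pre_sigma (S n)"] Bad
      by (simp add: space_pre_sigma sets.finite_INT)
    show "incseq (\<lambda>k. space M - (\<Inter>j\<le>k. Bad j))" by (force simp: incseq_def)
    show "A \<omega> (capped (Suc n) \<omega>) \<le> real k" if "\<omega> \<in> space M - (\<Inter>j\<le>k. Bad j)" "S n \<omega> \<le> ennreal T" for k \<omega>
    proof -
      obtain j where "j \<le> k" "\<omega> \<notin> Bad j" using \<open>\<omega> \<in> space M - _\<close> by auto
      then have "A \<omega> (capped (Suc n) \<omega>) \<le> real j" using exceeds[of \<omega> j] that by force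
      then show ?thesis using \<open>j \<le> k\<close> by simp
    qed
  qed (rule *)
qed

end

context marked_point_process
begin

lemma mark_time_measurable_at_jump:
  assumes "1 \<le> n" and H: "H \<in> predictable_sigma \<Otimes>\<^sub>M borel \<rightarrow>\<^sub>M borel"
  shows "(\<lambda>\<omega>. if S n \<omega> \<le> ennreal T then H ((\<omega>, time n \<omega>), X n \<omega>) else c) \<in> M \<rightarrow>\<^sub>M borel"
proof (subst measurable_If_restrict_space_iff, goal_cases)
  case 1
  show ?case by measurable
next
  case 2
  let ?R = "restrict_space M {\<omega>. S n \<omega> \<le> ennreal T}"
  have sp: "space ?R = {\<omega> \<in> space M. S n \<omega> \<le> ennreal T}" by (auto simp: space_restrict_space)
  have V: "{\<omega>. S n \<omega> \<le> ennreal T} \<inter> space M \<in> sets M"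
  proof -
    have "{\<omega> \<in> space M. S n \<omega> \<le> ennreal T} \<in> sets M" by measurable
    then show ?thesis by (simp add: Int_def conj_commute)
  qed
  have j: "n \<in> jumps \<omega>" if "\<omega> \<in> space ?R" for \<omega> using that assms(1) by (simp add: sp jumps_def)
  have "(\<lambda>\<omega>. ((\<omega>, time n \<omega>), X n \<omega>)) \<in> ?R \<rightarrow>\<^sub>M predictable_sigma \<Otimes>\<^sub>M borel"
  proof (rule measurable_Pair)
    show "X n \<in> ?R \<rightarrow>\<^sub>M borel" using X_measurable[OF assms(1)] by (rule measurable_restrict_space1)
    show "(\<lambda>\<omega>. (\<omega>, time n \<omega>)) \<in> ?R \<rightarrow>\<^sub>M predictable_sigma"
    proof (rule measurable_predictableI)
      show "(\<lambda>\<omega>. (\<omega>, time n \<omega>)) \<in> space ?R \<rightarrow> space M \<times> {0..T}"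
        using j time_jumps by (auto simp: sp less_imp_le)
    next
      fix B
      have "(\<lambda>\<omega>. (\<omega>, time n \<omega>)) -` (B \<times> {0}) \<inter> space ?R = {}"
        using j time_jumps(1) by (force simp: sp)
      then show "(\<lambda>\<omega>. (\<omega>, time n \<omega>)) -` (B \<times> {0}) \<inter> space ?R \<in> sets ?R" by (metis sets.empty_sets)
    next
      fix s t B assume st: "0 \<le> s" "s < t" "t \<le> T" and B: "B \<in> sets (history (ennreal s))"
      have [measurable]: "B \<in> sets M" using B sets_history_subset by auto
      have "{\<omega> \<in> space M. \<omega> \<in> B \<and> ennreal s < S n \<omega> \<and> S n \<omega> \<le> ennreal t} \<in> sets M" by measurable
      moreover have "(\<lambda>\<omega>. (\<omega>, time n \<omega>)) -` (B \<times> {s<..t}) \<inter> space ?R = {\<omega> \<in> space M. \<omega> \<in> B \<and> ennreal s < S n \<omega> \<and> S n \<omega> \<le> ennreal t}"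
      proof -
        have "ennreal s < S n \<omega> \<and> S n \<omega> \<le> ennreal t \<longleftrightarrow> S n \<omega> \<le> ennreal T \<and> s < time n \<omega> \<and> time n \<omega> \<le> t" for \<omega>
        proof (cases "S n \<omega> \<le> ennreal T")
          case True
          then have "n \<in> jumps \<omega>" using assms(1) by (simp add: jumps_def)
          then show ?thesis using S_le_iff[of t n \<omega>] less_S_iff[of s n \<omega>] st True by simp
        next
          case False
          then have "\<not> S n \<omega> \<le> ennreal t" using order.trans[OF _ ennreal_leI[OF st(3)]] by blast
          then show ?thesis using False by simp
        qed
        note * = this
        show ?thesis unfolding sp
        proof (rule set_eqI)
          fix \<omega>
          show "\<omega> \<in> (\<lambda>\<omega>. (\<omega>, time n \<omega>)) -` (B \<times> {s<..t}) \<inter> {\<omega> \<in> space M. S n \<omega> \<le> ennreal T} \<longleftrightarrow>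
              \<omega> \<in> {\<omega> \<in> space M. \<omega> \<in> B \<and> ennreal s < S n \<omega> \<and> S n \<omega> \<le> ennreal t}"
            unfolding Int_iff vimage_eq mem_Sigma_iff greaterThanAtMost_iff mem_Collect_eq using *[of \<omega>] by argo
        qed
      qed
      ultimately show "(\<lambda>\<omega>. (\<omega>, time n \<omega>)) -` (B \<times> {s<..t}) \<inter> space ?R \<in> sets ?R"
        using sp by (subst sets_restrict_space_iff[OF V]) (simp only:, blast)
    qed
  qed
  from measurable_compose[OF this H] show ?case by simp
qed

lemma measurable_nn_integral_\<mu>:
  assumes H: "H \<in> predictable_sigma \<Otimes>\<^sub>M borel \<rightarrow>\<^sub>M (borel :: ennreal measure)"
  shows "(\<lambda>\<omega>. \<integral>\<^sup>+z. H ((\<omega>, fst z), snd z) \<partial>\<mu> \<omega>) \<in> borel_measurable M"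
proof -
  define h where "h n \<omega> = (if S n \<omega> \<le> ennreal T then H ((\<omega>, time n \<omega>), X n \<omega>) else 0)" for n \<omega>
  have [measurable]: "h n \<in> M \<rightarrow>\<^sub>M borel" if "1 \<le> n" for n
    unfolding h_def by (rule mark_time_measurable_at_jump[OF that H])
  have "(\<lambda>\<omega>. \<Sum>n. h (Suc n) \<omega>) \<in> M \<rightarrow>\<^sub>M borel" by measurable
  moreover have "(\<integral>\<^sup>+z. H ((\<omega>, fst z), snd z) \<partial>\<mu> \<omega>) = (\<Sum>n. h (Suc n) \<omega>)" if \<omega>: "\<omega> \<in> space M" for \<omega>
  proof -
    have "(\<integral>\<^sup>+z. H ((\<omega>, fst z), snd z) \<partial>\<mu> \<omega>) = (\<Sum>n\<in>jumps \<omega>. H ((\<omega>, time n \<omega>), X n \<omega>))"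
      using measurable_mark_section[OF \<omega> H] by (subst nn_integral_\<mu>[OF \<omega>]) auto
    also have "\<dots> = (\<Sum>n\<in>jumps \<omega>. h n \<omega>)"
      by (intro sum.cong refl) (auto simp: h_def jumps_def)
    also have "\<dots> = (\<Sum>n\<in>(\<lambda>n. n - 1) ` jumps \<omega>. h (Suc n) \<omega>)"
      by (subst sum.reindex) (auto simp: jumps_def inj_on_def)
    also have "\<dots> = (\<Sum>n. h (Suc n) \<omega>)"
    proof (rule suminf_finite[symmetric])
      fix n assume n: "n \<notin> (\<lambda>n. n - 1) ` jumps \<omega>"
      have "Suc n \<notin> jumps \<omega>" using n by (metis diff_Suc_1 image_eqI)
      then show "h (Suc n) \<omega> = 0" by (simp add: h_def jumps_def)
    qed (use finite_jumps[OF \<omega>] in simp)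
    finally show ?thesis .
  qed
  ultimately show ?thesis by (subst measurable_cong) auto
qed

lemma time_Suc_unique:
  assumes \<omega>: "\<omega> \<in> space M" and m: "m \<in> jumps \<omega>"
  shows "S n \<omega> < ennreal (time m \<omega>) \<and> \<not> S (Suc n) \<omega> < ennreal (time m \<omega>) \<longleftrightarrow> m = Suc n"
proof -
  have Sm: "S m \<omega> \<le> ennreal T" "ennreal (time m \<omega>) = S m \<omega>" using m S_eq_time[of m \<omega> T] by (auto simp: jumps_def)
  have less: "S k \<omega> < S m \<omega> \<longleftrightarrow> k < m" for k
  proof
    assume lt: "S k \<omega> < S m \<omega>"
    show "k < m"
    proof (rule ccontr)
      assume "\<not> k < m"
      then show False using S_incseq[OF \<omega>, of m k] lt by simp
    qed
  next
    assume km: "k < m"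
    have "S k \<omega> \<le> ennreal T" using S_incseq[OF \<omega>, of k m] km Sm(1) by (meson less_imp_le order.trans)
    then show "S k \<omega> < S m \<omega>" using S_less_S[OF \<omega> km] by simp
  qed
  show ?thesis unfolding Sm(2) less by linarith
qed

end

context survival_compensator
begin

lemma measurable_nn_integral_\<nu>:
  assumes H: "H \<in> predictable_sigma \<Otimes>\<^sub>M borel \<rightarrow>\<^sub>M (borel :: ennreal measure)"
  shows "(\<lambda>\<omega>. \<integral>\<^sup>+z. H ((\<omega>, fst z), snd z) \<partial>\<nu> \<omega>) \<in> borel_measurable M"
proof -
  have "(\<lambda>\<omega>. \<integral>\<^sup>+z. (if fst z < T then H ((\<omega>, fst z), snd z) else 0) \<partial>\<nu> \<omega>) \<in> borel_measurable M"
    using measurable_compose[OF measurable_predictable_section_M[of T] predictable_integral_\<nu>[OF H]] T_pos by (simp cong: if_cong)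
  moreover have "(\<integral>\<^sup>+z. H ((\<omega>, fst z), snd z) \<partial>\<nu> \<omega>) = (\<integral>\<^sup>+z. (if fst z < T then H ((\<omega>, fst z), snd z) else 0) \<partial>\<nu> \<omega>)"
    if \<omega>: "\<omega> \<in> space M" for \<omega>
    using AE_\<nu>_time[OF \<omega> AE_dA_neq[OF \<omega>, of T]] AE_space[of "\<nu> \<omega>"]
    by (intro nn_integral_cong_AE, eventually_elim) (auto simp: space_\<nu>[OF \<omega>])
  ultimately show ?thesis by (subst measurable_cong) auto
qed

lemma A_capped_measurable [measurable]: "(\<lambda>\<omega>. A \<omega> (capped n \<omega>)) \<in> borel_measurable M"
proof (cases "n = 0")
  case True
  then have "A \<omega> (capped n \<omega>) = 0" if "\<omega> \<in> space M" for \<omega> using S_0[OF that] A_0[OF that] by (simp add: capped_def time_def)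
  then show ?thesis by (subst measurable_cong[where g="\<lambda>_. 0"]) auto
next
  case False
  have [measurable]: "(\<lambda>\<omega>. A \<omega> T) \<in> borel_measurable M"
    using measurable_history[OF A_section_measurable[of T]] T_pos by simp
  have "(\<lambda>\<omega>. if S n \<omega> \<le> ennreal T then A \<omega> (time n \<omega>) else 0) \<in> borel_measurable M"
    using mark_time_measurable_at_jump[of n "\<lambda>z. A (fst (fst z)) (snd (fst z))" 0]
      measurable_compose[OF measurable_fst A_measurable] False by (simp cong: if_cong)
  then have "(\<lambda>\<omega>. if S n \<omega> \<le> ennreal T then (if S n \<omega> \<le> ennreal T then A \<omega> (time n \<omega>) else 0) else A \<omega> T) \<in> borel_measurable M"
    by measurable
  moreover have "A \<omega> (capped n \<omega>) = (if S n \<omega> \<le> ennreal T then (if S n \<omega> \<le> ennreal T then A \<omega> (time n \<omega>) else 0) else A \<omega> T)" for \<omega>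
    by (simp add: capped_def)
  ultimately show ?thesis by simp
qed

text \<open>
  The increment of \<open>exp A\<close> over \<open>(S n, S (Suc n)]\<close> is the integral of \<open>exp A\<close> against \<open>dA\<close>.  By the
  compensator formula its mean is that of the single value of \<open>exp A\<close> at the next point, if this point
  comes before \<open>T\<close>.  Subtracting it leaves the event of survival.  The bound on \<open>G\<close> makes the
  subtracted term finite.
\<close>

lemma survival_identity_bounded:
  assumes G: "G \<in> sets (pre_sigma (S n))"
    and k: "\<And>\<omega>. \<omega> \<in> G \<Longrightarrow> S n \<omega> \<le> ennreal T \<Longrightarrow> A \<omega> (capped (Suc n) \<omega>) \<le> k"
  shows "(\<integral>\<^sup>+\<omega>. indicator {\<omega> \<in> space M. S n \<omega> \<le> ennreal T} \<omega> * ennreal (exp (A \<omega> (capped n \<omega>))) * indicator G \<omega> \<partial>M)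
    = (\<integral>\<^sup>+\<omega>. indicator {\<omega> \<in> space M. S n \<omega> \<le> ennreal T \<and> ennreal T < S (Suc n) \<omega>} \<omega> * ennreal (exp (A \<omega> T)) * indicator G \<omega> \<partial>M)"
    (is "?l = ?r")
proof -
  have GM [measurable]: "G \<in> sets M" using G sets_pre_sigma_subset by auto
  have Gsp: "G \<subseteq> space M" using sets.sets_into_space[OF GM] .
  have [measurable]: "(\<lambda>\<omega>. A \<omega> T) \<in> borel_measurable M"
    using measurable_history[OF A_section_measurable[of T]] T_pos by simp
  define H :: "('a \<times> real) \<times> 'e \<Rightarrow> ennreal" where
    "H y = (if fst (fst y) \<in> G \<and> S n (fst (fst y)) < ennreal (snd (fst y)) then
        if S (Suc n) (fst (fst y)) < ennreal (snd (fst y)) then 0 else ennreal (exp (A (fst (fst y)) (snd (fst y)))) else 0)" for y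
  have [measurable]: "Measurable.pred predictable_sigma (\<lambda>z. fst z \<in> G \<and> S n (fst z) < ennreal (snd z))"
    unfolding pred_def by (rule predictable_pre_sigma[OF G])
  have "(\<lambda>z. if fst z \<in> G \<and> S n (fst z) < ennreal (snd z) then
        if S (Suc n) (fst z) < ennreal (snd z) then 0 else ennreal (exp (A (fst z) (snd z))) else 0) \<in> borel_measurable predictable_sigma"
    by measurable
  from measurable_compose[OF measurable_fst this] have H [measurable]: "H \<in> borel_measurable (predictable_sigma \<Otimes>\<^sub>M borel)"
    unfolding H_def[abs_def] .
  let ?I\<mu> = "\<lambda>\<omega>. \<integral>\<^sup>+z. H ((\<omega>, fst z), snd z) \<partial>\<mu> \<omega>" and ?I\<nu> = "\<lambda>\<omega>. \<integral>\<^sup>+z. H ((\<omega>, fst z), snd z) \<partial>\<nu> \<omega>"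
  note [measurable] = measurable_nn_integral_\<mu>[OF H] measurable_nn_integral_\<nu>[OF H]
  have I\<mu>: "?I\<mu> \<omega> = indicator {\<omega> \<in> space M. S (Suc n) \<omega> \<le> ennreal T} \<omega> * ennreal (exp (A \<omega> (capped (Suc n) \<omega>))) * indicator G \<omega>"
    if \<omega>: "\<omega> \<in> space M" for \<omega>
  proof -
    have "?I\<mu> \<omega> = (\<Sum>m\<in>jumps \<omega>. H ((\<omega>, time m \<omega>), X m \<omega>))"
      using measurable_mark_section[OF \<omega> H] by (subst nn_integral_\<mu>[OF \<omega>]) auto
    also have "\<dots> = (\<Sum>m\<in>jumps \<omega>. if m = Suc n then ennreal (exp (A \<omega> (time (Suc n) \<omega>))) * indicator G \<omega> else 0)"
    proof (rule sum.cong[OF refl])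
      fix m assume m: "m \<in> jumps \<omega>"
      show "H ((\<omega>, time m \<omega>), X m \<omega>) = (if m = Suc n then ennreal (exp (A \<omega> (time (Suc n) \<omega>))) * indicator G \<omega> else 0)"
        using time_Suc_unique[OF \<omega> m, of n] by (cases "\<omega> \<in> G"; cases "m = Suc n") (auto simp: H_def)
    qed
    also have "\<dots> = (if Suc n \<in> jumps \<omega> then ennreal (exp (A \<omega> (time (Suc n) \<omega>))) * indicator G \<omega> else 0)"
      using finite_jumps[OF \<omega>] by (subst sum.delta) auto
    finally show ?thesis using \<omega> by (auto simp: jumps_def capped_def indicator_def)
  qed
  have I\<nu>: "indicator {\<omega> \<in> space M. S n \<omega> \<le> ennreal T} \<omega> * ennreal (exp (A \<omega> (capped (Suc n) \<omega>))) * indicator G \<omega> = 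
      indicator {\<omega> \<in> space M. S n \<omega> \<le> ennreal T} \<omega> * ennreal (exp (A \<omega> (capped n \<omega>))) * indicator G \<omega> + ?I\<nu> \<omega>"
    if \<omega>: "\<omega> \<in> space M" for \<omega>
  proof (cases "S n \<omega> \<le> ennreal T \<and> \<omega> \<in> G")
    case True
    have "?I\<nu> \<omega> = (\<integral>\<^sup>+z. (if capped n \<omega> < fst z \<and> fst z \<le> capped (Suc n) \<omega> then ennreal (exp (A \<omega> (fst z))) else 0) \<partial>\<nu> \<omega>)"
    proof (rule nn_integral_cong)
      fix z assume "z \<in> space (\<nu> \<omega>)"
      then have t: "0 \<le> fst z" "fst z \<le> T" by (auto simp: space_\<nu>[OF \<omega>])
      have "S n \<omega> < ennreal (fst z) \<longleftrightarrow> capped n \<omega> < fst z"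
        using True S_eq_time[of n \<omega> T] by (simp add: capped_def ennreal_less_iff time_nonneg)
      moreover have "S (Suc n) \<omega> < ennreal (fst z) \<longleftrightarrow> capped (Suc n) \<omega> < fst z"
      proof (cases "S (Suc n) \<omega> \<le> ennreal T")
        case True
        then show ?thesis using S_eq_time[of "Suc n" \<omega> T] by (simp add: capped_def ennreal_less_iff time_nonneg)
      next
        case False
        then have "\<not> S (Suc n) \<omega> < ennreal (fst z)"
          using less_le_trans[OF _ ennreal_leI[OF t(2)]] less_imp_le by blast
        then show ?thesis using False t by (simp add: capped_def)
      qed
      ultimately show "H ((\<omega>, fst z), snd z) = (if capped n \<omega> < fst z \<and> fst z \<le> capped (Suc n) \<omega> then ennreal (exp (A \<omega> (fst z))) else 0)"
        using True by (auto simp: H_def)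
    qed
    then show ?thesis using True \<omega> nn_integral_exp_A[OF \<omega> capped_range(1) capped_mono[OF \<omega>] capped_range(2), of n] by simp
  next
    case False
    have "?I\<nu> \<omega> = (\<integral>\<^sup>+z. 0 \<partial>\<nu> \<omega>)"
    proof (rule nn_integral_cong)
      fix z assume "z \<in> space (\<nu> \<omega>)"
      then have "fst z \<le> T" by (auto simp: space_\<nu>[OF \<omega>])
      then have "ennreal (fst z) \<le> ennreal T" by (rule ennreal_leI)
      then show "H ((\<omega>, fst z), snd z) = 0" using False by (auto simp: H_def)
    qed
    then show ?thesis using False by (auto simp: indicator_def)
  qed
  have fin: "(\<integral>\<^sup>+\<omega>. ?I\<nu> \<omega> \<partial>M) \<noteq> \<infinity>"
  proof -
    have "?I\<nu> \<omega> \<le> ennreal (exp k)" if \<omega>: "\<omega> \<in> space M" for \<omega>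
    proof -
      have "?I\<nu> \<omega> \<le> indicator {\<omega> \<in> space M. S n \<omega> \<le> ennreal T} \<omega> * ennreal (exp (A \<omega> (capped (Suc n) \<omega>))) * indicator G \<omega>"
        unfolding I\<nu>[OF \<omega>] by simp
      also have "\<dots> \<le> ennreal (exp k)" using k[of \<omega>] by (auto simp: indicator_def)
      finally show ?thesis .
    qed
    then have "(\<integral>\<^sup>+\<omega>. ?I\<nu> \<omega> \<partial>M) \<le> (\<integral>\<^sup>+\<omega>. ennreal (exp k) \<partial>M)" by (intro nn_integral_mono)
    also have "\<dots> < \<infinity>" by (simp add: emeasure_space_1)
    finally show ?thesis by simp
  qed
  have "(\<integral>\<^sup>+\<omega>. ?I\<nu> \<omega> \<partial>M) + ?l = (\<integral>\<^sup>+\<omega>. indicator {\<omega> \<in> space M. S n \<omega> \<le> ennreal T} \<omega> * ennreal (exp (A \<omega> (capped n \<omega>))) * indicator G \<omega> + ?I\<nu> \<omega> \<partial>M)"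
    by (subst nn_integral_add) (auto simp: add.commute)
  also have "\<dots> = (\<integral>\<^sup>+\<omega>. indicator {\<omega> \<in> space M. S n \<omega> \<le> ennreal T} \<omega> * ennreal (exp (A \<omega> (capped (Suc n) \<omega>))) * indicator G \<omega> \<partial>M)"
    by (intro nn_integral_cong I\<nu>[symmetric])
  also have "\<dots> = (\<integral>\<^sup>+\<omega>. ?I\<mu> \<omega> + indicator {\<omega> \<in> space M. S n \<omega> \<le> ennreal T \<and> ennreal T < S (Suc n) \<omega>} \<omega> * ennreal (exp (A \<omega> T)) * indicator G \<omega> \<partial>M)"
  proof (rule nn_integral_cong)
    fix \<omega> assume \<omega>: "\<omega> \<in> space M"
    have "S n \<omega> \<le> ennreal T" if "S (Suc n) \<omega> \<le> ennreal T"
      using order.trans[OF S_incseq[OF \<omega>, of n "Suc n"] that] by simp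
    then show "indicator {\<omega> \<in> space M. S n \<omega> \<le> ennreal T} \<omega> * ennreal (exp (A \<omega> (capped (Suc n) \<omega>))) * indicator G \<omega> = 
      ?I\<mu> \<omega> + indicator {\<omega> \<in> space M. S n \<omega> \<le> ennreal T \<and> ennreal T < S (Suc n) \<omega>} \<omega> * ennreal (exp (A \<omega> T)) * indicator G \<omega>"
      unfolding I\<mu>[OF \<omega>] using \<omega> by (auto simp: indicator_def capped_def not_le)
  qed
  also have "\<dots> = (\<integral>\<^sup>+\<omega>. ?I\<mu> \<omega> \<partial>M) + ?r" by (subst nn_integral_add) auto
  also have "(\<integral>\<^sup>+\<omega>. ?I\<mu> \<omega> \<partial>M) = (\<integral>\<^sup>+\<omega>. ?I\<nu> \<omega> \<partial>M)" by (rule compensator_pair[OF H])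
  finally show ?thesis using fin by (simp add: ennreal_add_left_cancel)
qed

text \<open>
  The integrated form of the fact that, given the past up to \<open>S n\<close>, no further point occurs before
  \<open>T\<close> with probability \<open>exp (- (A\<^sub>T - A\<^bsub>S n\<^esub>))\<close>.
\<close>

lemma survival_identity:
  "(\<integral>\<^sup>+\<omega>. indicator {\<omega> \<in> space M. S n \<omega> \<le> ennreal T} \<omega> * ennreal (exp (A \<omega> (capped n \<omega>))) \<partial>M)
    = (\<integral>\<^sup>+\<omega>. indicator {\<omega> \<in> space M. S n \<omega> \<le> ennreal T \<and> ennreal T < S (Suc n) \<omega>} \<omega> * ennreal (exp (A \<omega> T)) \<partial>M)"
    (is "(\<integral>\<^sup>+\<omega>. ?f \<omega> \<partial>M) = (\<integral>\<^sup>+\<omega>. ?g \<omega> \<partial>M)")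
proof -
  obtain G where G: "\<And>k. G k \<in> sets (pre_sigma (S n))" "incseq G" "AE \<omega> in M. \<exists>k. \<omega> \<in> G k"
    "\<And>k \<omega>. \<omega> \<in> G k \<Longrightarrow> S n \<omega> \<le> ennreal T \<Longrightarrow> A \<omega> (capped (Suc n) \<omega>) \<le> real k"
    using bounded_hazard_sets[of n] by blast
  have [measurable]: "G k \<in> sets M" for k using G(1) sets_pre_sigma_subset by auto
  have [measurable]: "(\<lambda>\<omega>. A \<omega> T) \<in> borel_measurable M"
    using measurable_history[OF A_section_measurable[of T]] T_pos by simp
  have lim: "(\<integral>\<^sup>+\<omega>. h \<omega> \<partial>M) = (SUP k. \<integral>\<^sup>+\<omega>. h \<omega> * indicator (G k) \<omega> \<partial>M)" if [measurable]: "h \<in> borel_measurable M" for h :: "'a \<Rightarrow> ennreal"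
  proof -
    have inc: "incseq (\<lambda>k \<omega>. h \<omega> * indicator (G k) \<omega>)"
      using G(2) by (auto simp: incseq_def le_fun_def indicator_def)
    have "(\<integral>\<^sup>+\<omega>. h \<omega> \<partial>M) = (\<integral>\<^sup>+\<omega>. (SUP k. h \<omega> * indicator (G k) \<omega>) \<partial>M)"
      using G(3)
    proof (intro nn_integral_cong_AE, eventually_elim)
      fix \<omega> assume "\<exists>k. \<omega> \<in> G k"
      then obtain k where k: "\<omega> \<in> G k" by blast
      show "h \<omega> = (SUP k. h \<omega> * indicator (G k) \<omega>)"
      proof (rule antisym)
        show "h \<omega> \<le> (SUP k. h \<omega> * indicator (G k) \<omega>)" using k by (intro SUP_upper2[of k]) auto
        show "(SUP k. h \<omega> * indicator (G k) \<omega>) \<le> h \<omega>" by (intro SUP_least) (auto simp: indicator_def)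
      qed
    qed
    also have "\<dots> = (SUP k. \<integral>\<^sup>+\<omega>. h \<omega> * indicator (G k) \<omega> \<partial>M)"
      by (rule nn_integral_monotone_convergence_SUP[OF inc]) measurable
    finally show ?thesis .
  qed
  have "(\<integral>\<^sup>+\<omega>. ?f \<omega> \<partial>M) = (SUP k. \<integral>\<^sup>+\<omega>. ?f \<omega> * indicator (G k) \<omega> \<partial>M)" by (rule lim) measurable
  also have "\<dots> = (SUP k. \<integral>\<^sup>+\<omega>. ?g \<omega> * indicator (G k) \<omega> \<partial>M)"
  proof (rule SUP_cong[OF refl])
    fix k
    show "(\<integral>\<^sup>+\<omega>. ?f \<omega> * indicator (G k) \<omega> \<partial>M) = (\<integral>\<^sup>+\<omega>. ?g \<omega> * indicator (G k) \<omega> \<partial>M)"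
      by (rule survival_identity_bounded[OF G(1), of k "real k"]) (rule G(4))
  qed
  also have "\<dots> = (\<integral>\<^sup>+\<omega>. ?g \<omega> \<partial>M)" by (rule lim[symmetric]) measurable
  finally show ?thesis .
qed

text \<open>
  By the compensator formula the left-hand side is a sum over the points, in which the \<open>n\<close>-th point contributes
  \<open>C\<^bsup>n-1\<^esup> exp A\<close> evaluated at \<open>S n\<close>.  By \<open>survival_identity\<close> the value of \<open>exp A\<close> at \<open>S n\<close> may be replaced by
  \<open>exp A\<^sub>T\<close> on the event of exactly \<open>n\<close> points, and these events are disjoint.
\<close>

lemma exp_A_power_count_integrable:
  assumes C: "0 < C" and fin: "(\<integral>\<^sup>+\<omega>. ennreal (exp (A \<omega> T) * C ^ card (jumps \<omega>)) \<partial>M) < \<infinity>"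
  shows "(\<integral>\<^sup>+\<omega>. \<integral>\<^sup>+z. ennreal (exp (A \<omega> (fst z)) * C ^ count_before \<omega> (fst z)) \<partial>\<nu> \<omega> \<partial>M) < \<infinity>"
proof -
  have [measurable]: "(\<lambda>\<omega>. A \<omega> T) \<in> borel_measurable M"
    using measurable_history[OF A_section_measurable[of T]] T_pos by simp
  let ?l = "\<lambda>n \<omega>. indicator {\<omega> \<in> space M. S n \<omega> \<le> ennreal T} \<omega> * ennreal (exp (A \<omega> (capped n \<omega>)))"
  let ?r = "\<lambda>n \<omega>. indicator {\<omega> \<in> space M. S n \<omega> \<le> ennreal T \<and> ennreal T < S (Suc n) \<omega>} \<omega> * ennreal (exp (A \<omega> T))"
  let ?H = "\<lambda>y::('a \<times> real) \<times> 'e. ennreal (exp (A (fst (fst y)) (snd (fst y))) * C ^ count_before (fst (fst y)) (snd (fst y)))"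
  have "(\<lambda>z. ennreal (exp (A (fst z) (snd z)) * C ^ count_before (fst z) (snd z))) \<in> borel_measurable predictable_sigma"
    by measurable
  from measurable_compose[OF measurable_fst this] have H: "?H \<in> borel_measurable (predictable_sigma \<Otimes>\<^sub>M borel)" .
  have sum_le: "(\<Sum>n. ennreal (C ^ n) * ?r n \<omega>) \<le> ennreal (exp (A \<omega> T) * C ^ card (jumps \<omega>))" if \<omega>: "\<omega> \<in> space M" for \<omega>
  proof -
    let ?K = "card (jumps \<omega>)"
    have "ennreal (C ^ n) * ?r n \<omega> = 0" if "n \<noteq> ?K" for n
      using that jumps_eq_atLeastAtMost[OF \<omega>, of n] by (auto simp: indicator_def)
    then have "(\<Sum>n. ennreal (C ^ n) * ?r n \<omega>) = (\<Sum>n\<in>{?K}. ennreal (C ^ n) * ?r n \<omega>)"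
      by (intro suminf_finite) auto
    also have "\<dots> \<le> ennreal (C ^ ?K) * ennreal (exp (A \<omega> T))"
      by (auto simp: indicator_def intro!: mult_left_mono)
    also have "\<dots> = ennreal (exp (A \<omega> T) * C ^ ?K)" using C by (simp add: ennreal_mult[symmetric] mult.commute)
    finally show ?thesis .
  qed
  have "ennreal C * (\<integral>\<^sup>+\<omega>. \<integral>\<^sup>+z. ennreal (exp (A \<omega> (fst z)) * C ^ count_before \<omega> (fst z)) \<partial>\<nu> \<omega> \<partial>M)
     = ennreal C * (\<integral>\<^sup>+\<omega>. \<integral>\<^sup>+z. ennreal (exp (A \<omega> (fst z)) * C ^ count_before \<omega> (fst z)) \<partial>\<mu> \<omega> \<partial>M)"
    using compensator_pair[OF H] by simp
  also have "\<dots> = (\<integral>\<^sup>+\<omega>. ennreal C * (\<integral>\<^sup>+z. ennreal (exp (A \<omega> (fst z)) * C ^ count_before \<omega> (fst z)) \<partial>\<mu> \<omega>) \<partial>M)"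
    using measurable_nn_integral_\<mu>[OF H] by (subst nn_integral_cmult) auto
  also have "\<dots> \<le> (\<integral>\<^sup>+\<omega>. (\<Sum>n. ennreal (C ^ n) * ?l n \<omega>) \<partial>M)"
  proof (rule nn_integral_mono)
    fix \<omega> assume \<omega>: "\<omega> \<in> space M"
    have "ennreal C * (\<integral>\<^sup>+z. ennreal (exp (A \<omega> (fst z)) * C ^ count_before \<omega> (fst z)) \<partial>\<mu> \<omega>) = 
       ennreal C * (\<Sum>n\<in>jumps \<omega>. ennreal (exp (A \<omega> (time n \<omega>)) * C ^ count_before \<omega> (time n \<omega>)))"
      using measurable_mark_section[OF \<omega> H] by (subst nn_integral_\<mu>[OF \<omega>]) auto
    also have "\<dots> = (\<Sum>n\<in>jumps \<omega>. ennreal (C ^ n) * ?l n \<omega>)"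
      unfolding sum_distrib_left
    proof (rule sum.cong[OF refl])
      fix n assume n: "n \<in> jumps \<omega>"
      then have "C * C ^ count_before \<omega> (time n \<omega>) = C ^ n"
        using count_before_jump[OF \<omega> n] by (cases n) (auto simp: jumps_def)
      moreover have "capped n \<omega> = time n \<omega>" "?l n \<omega> = ennreal (exp (A \<omega> (time n \<omega>)))" using n \<omega> by (auto simp: capped_def jumps_def)
      ultimately show "ennreal C * ennreal (exp (A \<omega> (time n \<omega>)) * C ^ count_before \<omega> (time n \<omega>)) = ennreal (C ^ n) * ?l n \<omega>"
        using C by (simp add: ennreal_mult[symmetric])
    qed
    also have "\<dots> \<le> (\<Sum>n. ennreal (C ^ n) * ?l n \<omega>)" by (intro sum_le_suminf finite_jumps \<omega>) auto
    finally show "ennreal C * (\<integral>\<^sup>+z. ennreal (exp (A \<omega> (fst z)) * C ^ count_before \<omega> (fst z)) \<partial>\<mu> \<omega>) \<le> (\<Sum>n. ennreal (C ^ n) * ?l n \<omega>)" .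
  qed
  also have "\<dots> = (\<Sum>n. ennreal (C ^ n) * (\<integral>\<^sup>+\<omega>. ?l n \<omega> \<partial>M))"
    by (subst nn_integral_suminf) (auto intro!: suminf_cong nn_integral_cmult)
  also have "\<dots> = (\<Sum>n. ennreal (C ^ n) * (\<integral>\<^sup>+\<omega>. ?r n \<omega> \<partial>M))"
    unfolding survival_identity ..
  also have "\<dots> = (\<integral>\<^sup>+\<omega>. (\<Sum>n. ennreal (C ^ n) * ?r n \<omega>) \<partial>M)"
    by (subst nn_integral_suminf) (auto intro!: suminf_cong nn_integral_cmult[symmetric])
  also have "\<dots> \<le> (\<integral>\<^sup>+\<omega>. ennreal (exp (A \<omega> T) * C ^ card (jumps \<omega>)) \<partial>M)" by (intro nn_integral_mono sum_le)
  also note fin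
  finally show ?thesis using C by (auto simp: ennreal_mult_less_top)
qed

end

section \<open>Change of intensity\<close>

lemma nn_integral_triangle_swap:
  fixes m n :: "(real \<times> 'e) measure" and h f :: "real \<times> 'e \<Rightarrow> ennreal"
  assumes "sigma_finite_measure m" "sigma_finite_measure n"
    and [measurable]: "fst \<in> m \<rightarrow>\<^sub>M borel" "fst \<in> n \<rightarrow>\<^sub>M borel" "h \<in> borel_measurable m" "f \<in> borel_measurable n"
  shows "(\<integral>\<^sup>+z. h z * (\<integral>\<^sup>+y. (if fst z < fst y then f y else 0) \<partial>n) \<partial>m) =
    (\<integral>\<^sup>+y. f y * (\<integral>\<^sup>+z. (if fst z < fst y then h z else 0) \<partial>m) \<partial>n)"
proof -
  interpret m: sigma_finite_measure m by fact
  interpret n: sigma_finite_measure n by fact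
  interpret pair_sigma_finite m n ..
  have "(\<integral>\<^sup>+z. h z * (\<integral>\<^sup>+y. (if fst z < fst y then f y else 0) \<partial>n) \<partial>m) = (\<integral>\<^sup>+z. \<integral>\<^sup>+y. h z * (if fst z < fst y then f y else 0) \<partial>n \<partial>m)"
    by (intro nn_integral_cong nn_integral_cmult[symmetric]) measurable
  also have "\<dots> = (\<integral>\<^sup>+y. \<integral>\<^sup>+z. h z * (if fst z < fst y then f y else 0) \<partial>m \<partial>n)"
    by (rule Fubini'[symmetric]) measurable
  also have "\<dots> = (\<integral>\<^sup>+y. \<integral>\<^sup>+z. f y * (if fst z < fst y then h z else 0) \<partial>m \<partial>n)"
    by (intro nn_integral_cong) (simp add: mult.commute)
  also have "\<dots> = (\<integral>\<^sup>+y. f y * (\<integral>\<^sup>+z. (if fst z < fst y then h z else 0) \<partial>m) \<partial>n)"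
    by (intro nn_integral_cong nn_integral_cmult) measurable
  finally show ?thesis .
qed

text \<open>
  The factor \<open>\<rho>\<close> by which the intensity is multiplied; in the control problem it is the rate under a
  given control.
\<close>

locale intensity_change = survival_compensator M T \<Delta> S X A \<phi>
  for M :: "'a measure" and T and \<Delta> :: "'e :: topological_space" and S X A \<phi> +
  fixes \<rho> :: "('a \<times> real) \<times> 'e \<Rightarrow> real" and C :: real
  assumes \<rho>_measurable [measurable]: "\<rho> \<in> borel_measurable (predictable_sigma \<Otimes>\<^sub>M borel)"
    and \<rho>_nonneg: "\<And>\<omega> t x. \<omega> \<in> space M \<Longrightarrow> t \<in> {0..T} \<Longrightarrow> 0 \<le> \<rho> ((\<omega>, t), x)"
    and \<rho>_le: "\<And>\<omega> t x. \<omega> \<in> space M \<Longrightarrow> t \<in> {0..T} \<Longrightarrow> \<rho> ((\<omega>, t), x) \<le> C"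
    and C_pos: "0 < C"
    and exp_moment: "(\<integral>\<^sup>+\<omega>. ennreal (exp (A \<omega> T) * C ^ card (jumps \<omega>)) \<partial>M) < \<infinity>"
begin

definition rate :: "'a \<Rightarrow> real \<times> 'e \<Rightarrow> real" where
  "rate \<omega> z = \<rho> ((\<omega>, fst z), snd z)"

lemma rate_measurable: "\<omega> \<in> space M \<Longrightarrow> rate \<omega> \<in> borel_measurable mark_space"
  unfolding rate_def[abs_def] by (rule measurable_mark_section) measurable

lemma rate_bounds:
  assumes "\<omega> \<in> space M" "z \<in> {0..T} \<times> UNIV"
  shows "0 \<le> rate \<omega> z" "rate \<omega> z \<le> C" "\<bar>rate \<omega> z\<bar> \<le> C"
  using \<rho>_nonneg[OF assms(1), of "fst z" "snd z"] \<rho>_le[OF assms(1), of "fst z" "snd z"] assms(2)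
  by (auto simp: rate_def)

lemma rate_jump_bounds:
  assumes "\<omega> \<in> space M" "n \<in> jumps \<omega>"
  shows "0 \<le> rate \<omega> (time n \<omega>, X n \<omega>)" "rate \<omega> (time n \<omega>, X n \<omega>) \<le> C"
  using rate_bounds[OF assms(1), of "(time n \<omega>, X n \<omega>)"] time_jumps[OF assms] by auto

lemma one_minus_rate:
  assumes "\<omega> \<in> space M"
  shows "(\<lambda>z. 1 - rate \<omega> z) \<in> borel_measurable mark_space"
    and "z \<in> {0..T} \<times> UNIV \<Longrightarrow> \<bar>1 - rate \<omega> z\<bar> \<le> 1 + C"
  using rate_measurable[OF assms] rate_bounds(3)[OF assms, of z] by (auto simp: abs_le_iff)

definition log_density :: "'a \<Rightarrow> real \<Rightarrow> real" where
  "log_density \<omega> = cumul \<omega> (\<lambda>z. 1 - rate \<omega> z)"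

text \<open>
  The left limit at \<open>t\<close> of the density process \<open>density_at\<close>; unlike the latter it is predictable.
\<close>

definition density_before :: "'a \<Rightarrow> real \<Rightarrow> real" where
  "density_before \<omega> t = exp (log_density \<omega> t) * jump_prod \<omega> (rate \<omega>) t"

definition density_at :: "'a \<Rightarrow> real \<Rightarrow> real" where
  "density_at \<omega> t = exp (log_density \<omega> t) * (\<Prod>n\<in>{n \<in> jumps \<omega>. time n \<omega> \<le> t}. rate \<omega> (time n \<omega>, X n \<omega>))"

lemma density_before_nonneg: "\<omega> \<in> space M \<Longrightarrow> 0 \<le> density_before \<omega> t"
  unfolding density_before_def jump_prod_def using rate_jump_bounds by (auto intro!: mult_nonneg_nonneg prod_nonneg)

lemma density_at_nonneg: "\<omega> \<in> space M \<Longrightarrow> 0 \<le> density_at \<omega> t"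
  unfolding density_at_def using rate_jump_bounds by (auto intro!: mult_nonneg_nonneg prod_nonneg)

text \<open>
  In this form, with a nonnegative integrand and the strict past, predictability can be read off.
\<close>

lemma log_density_eq:
  assumes \<omega>: "\<omega> \<in> space M" and t: "0 \<le> t" "t \<le> T"
  shows "log_density \<omega> t = A \<omega> t - enn2real (\<integral>\<^sup>+y. (if fst y < t then ennreal (rate \<omega> y) else 0) \<partial>\<nu> \<omega>)"
proof -
  note [measurable] = rate_measurable[OF \<omega>]
  have "log_density \<omega> t = cumul \<omega> (\<lambda>_. 1) t - cumul \<omega> (rate \<omega>) t"
    unfolding log_density_def cumul_def using t
    by (intro set_integral_diff(2) set_integrable_\<nu>_bounded[OF \<omega>, of _ 1] set_integrable_\<nu>_bounded[OF \<omega>, of _ C] rate_bounds(3)[OF \<omega>]) auto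
  moreover have "cumul \<omega> (rate \<omega>) t = enn2real (\<integral>\<^sup>+y. ennreal (indicator ({0<..t} \<times> UNIV) y *\<^sub>R rate \<omega> y) \<partial>\<nu> \<omega>)"
    unfolding cumul_def set_lebesgue_integral_def
  proof (rule integral_eq_nn_integral)
    show "(\<lambda>y. indicator ({0<..t} \<times> UNIV) y *\<^sub>R rate \<omega> y) \<in> borel_measurable (\<nu> \<omega>)"
      using sets_slab[of 0 t \<omega>] t \<omega> sets_\<nu>[OF \<omega>] by (simp add: measurable_cong_sets[OF sets_\<nu>[OF \<omega>] refl])
    show "AE y in \<nu> \<omega>. 0 \<le> indicator ({0<..t} \<times> UNIV) y *\<^sub>R rate \<omega> y"
      using rate_bounds(1)[OF \<omega>] by (intro AE_I2) (auto simp: space_\<nu>[OF \<omega>])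
  qed
  moreover have "(\<integral>\<^sup>+y. ennreal (indicator ({0<..t} \<times> UNIV) y *\<^sub>R rate \<omega> y) \<partial>\<nu> \<omega>) = (\<integral>\<^sup>+y. (if fst y < t then ennreal (rate \<omega> y) else 0) \<partial>\<nu> \<omega>)"
  proof (rule nn_integral_cong_AE)
    have "AE y in \<nu> \<omega>. fst y \<notin> {0, t}" by (rule AE_\<nu>_time[OF \<omega> AE_dA_not_finite[OF \<omega>]]) simp
    with AE_space[of "\<nu> \<omega>"] show "AE y in \<nu> \<omega>. ennreal (indicator ({0<..t} \<times> UNIV) y *\<^sub>R rate \<omega> y) = (if fst y < t then ennreal (rate \<omega> y) else 0)"
      by eventually_elim (auto simp: space_\<nu>[OF \<omega>] indicator_def)
  qed
  ultimately show ?thesis using cumul_1[OF \<omega> t] by simp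
qed

lemma log_density_measurable [measurable]: "(\<lambda>z. log_density (fst z) (snd z)) \<in> borel_measurable predictable_sigma"
proof -
  have "(\<lambda>y. ennreal (\<rho> y)) \<in> borel_measurable (predictable_sigma \<Otimes>\<^sub>M borel)" by measurable
  note [measurable] = predictable_integral_\<nu>[OF this]
  have "(\<lambda>z. A (fst z) (snd z) - enn2real (\<integral>\<^sup>+y. (if fst y < snd z then ennreal (\<rho> ((fst z, fst y), snd y)) else 0) \<partial>\<nu> (fst z))) \<in> borel_measurable predictable_sigma"
    by measurable
  then show ?thesis
    by (subst measurable_cong[OF log_density_eq]) (auto simp: rate_def cong: if_cong)
qed

lemma density_before_measurable [measurable]: "(\<lambda>z. density_before (fst z) (snd z)) \<in> borel_measurable predictable_sigma"
proof -
  have "rate = (\<lambda>\<omega> y. \<rho> ((\<omega>, fst y), snd y))" by (simp add: fun_eq_iff rate_def)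
  then have "(\<lambda>z. jump_prod (fst z) (rate (fst z)) (snd z)) \<in> borel_measurable predictable_sigma"
    using predictable_jump_prod[OF \<rho>_measurable] by (simp only:)
  then show ?thesis unfolding density_before_def by measurable
qed

lemma log_density_le:
  assumes \<omega>: "\<omega> \<in> space M" and t: "0 \<le> t" "t \<le> T"
  shows "log_density \<omega> t \<le> A \<omega> t"
  unfolding log_density_eq[OF assms] by simp

lemma density_before_le:
  assumes \<omega>: "\<omega> \<in> space M" and t: "0 \<le> t" "t \<le> T"
  shows "density_before \<omega> t \<le> exp (A \<omega> t) * C ^ count_before \<omega> t"
proof -
  have "jump_prod \<omega> (rate \<omega>) t \<le> (\<Prod>n\<in>{n \<in> jumps \<omega>. time n \<omega> < t}. C)"
    unfolding jump_prod_def using rate_jump_bounds[OF \<omega>] by (intro prod_mono) auto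
  moreover have "0 \<le> jump_prod \<omega> (rate \<omega>) t"
    unfolding jump_prod_def using rate_jump_bounds[OF \<omega>] by (intro prod_nonneg) auto
  ultimately show ?thesis unfolding density_before_def using log_density_le[OF assms]
    by (intro mult_mono) (auto simp: count_before_def)
qed

lemma density_at_T_le:
  assumes \<omega>: "\<omega> \<in> space M"
  shows "density_at \<omega> T \<le> exp (A \<omega> T) * C ^ card (jumps \<omega>)"
proof -
  have J: "{n \<in> jumps \<omega>. time n \<omega> \<le> T} = jumps \<omega>" using time_jumps[OF \<omega>] by auto
  have "(\<Prod>n\<in>jumps \<omega>. rate \<omega> (time n \<omega>, X n \<omega>)) \<le> (\<Prod>n\<in>jumps \<omega>. C)"
    using rate_jump_bounds[OF \<omega>] by (intro prod_mono) auto
  moreover have "0 \<le> (\<Prod>n\<in>jumps \<omega>. rate \<omega> (time n \<omega>, X n \<omega>))"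
    using rate_jump_bounds[OF \<omega>] by (intro prod_nonneg) auto
  ultimately show ?thesis unfolding density_at_def J using log_density_le[OF \<omega>, of T] T_pos
    by (intro mult_mono) auto
qed

lemma density_at_T_measurable [measurable]: "(\<lambda>\<omega>. density_at \<omega> T) \<in> borel_measurable M"
proof -
  define h where "h n \<omega> = (if S n \<omega> \<le> ennreal T then \<rho> ((\<omega>, time n \<omega>), X n \<omega>) else 1)" for n \<omega>
  have [measurable]: "h n \<in> borel_measurable M" if "1 \<le> n" for n
    unfolding h_def by (rule mark_time_measurable_at_jump[OF that \<rho>_measurable])
  have [measurable]: "(\<lambda>\<omega>. log_density \<omega> T) \<in> borel_measurable M"
    using measurable_compose[OF measurable_predictable_section_M[of T] log_density_measurable] T_pos by simp
  have "(\<lambda>\<omega>. \<Prod>n\<in>jumps \<omega>. rate \<omega> (time n \<omega>, X n \<omega>)) \<in> borel_measurable M"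
  proof (rule borel_measurable_LIMSEQ_real)
    fix \<omega> assume \<omega>: "\<omega> \<in> space M"
    have "(\<Prod>n\<in>{1..m}. h n \<omega>) = (\<Prod>n\<in>jumps \<omega>. rate \<omega> (time n \<omega>, X n \<omega>))" if m: "Max (insert 0 (jumps \<omega>)) \<le> m" for m
    proof -
      have "jumps \<omega> \<subseteq> {1..m}" using m finite_jumps[OF \<omega>] by (auto simp: jumps_def)
      then have "(\<Prod>n\<in>{1..m}. h n \<omega>) = (\<Prod>n\<in>jumps \<omega>. h n \<omega>)"
        by (intro prod.mono_neutral_right) (auto simp: h_def jumps_def)
      also have "\<dots> = (\<Prod>n\<in>jumps \<omega>. rate \<omega> (time n \<omega>, X n \<omega>))"
        by (intro prod.cong) (auto simp: h_def jumps_def rate_def)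
      finally show ?thesis .
    qed
    then show "(\<lambda>m. \<Prod>n\<in>{1..m}. h n \<omega>) \<longlonglongrightarrow> (\<Prod>n\<in>jumps \<omega>. rate \<omega> (time n \<omega>, X n \<omega>))"
      by (intro tendsto_eventually eventually_sequentiallyI)
  qed (auto intro!: borel_measurable_prod)
  then have m: "(\<lambda>\<omega>. exp (log_density \<omega> T) * (\<Prod>n\<in>jumps \<omega>. rate \<omega> (time n \<omega>, X n \<omega>))) \<in> borel_measurable M" by measurable
  have eq: "density_at \<omega> T = exp (log_density \<omega> T) * (\<Prod>n\<in>jumps \<omega>. rate \<omega> (time n \<omega>, X n \<omega>))" if "\<omega> \<in> space M" for \<omega>
  proof -
    have "{n \<in> jumps \<omega>. time n \<omega> \<le> T} = jumps \<omega>" using time_jumps[OF that] by auto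
    then show ?thesis by (simp add: density_at_def)
  qed
  show ?thesis by (subst measurable_cong[OF eq]) (auto intro: m)
qed

lemma density_at_mark_measurable:
  assumes \<omega>: "\<omega> \<in> space M"
  shows "(\<lambda>z. density_at \<omega> (fst z)) \<in> borel_measurable mark_space"
proof -
  have [measurable]: "(\<lambda>z. log_density \<omega> (fst z)) \<in> borel_measurable mark_space"
    unfolding log_density_def by (rule cumul_measurable[OF \<omega> one_minus_rate[OF \<omega>]])
  have "density_at \<omega> t = exp (log_density \<omega> t) * (\<Prod>n\<in>jumps \<omega>. if time n \<omega> \<le> t then rate \<omega> (time n \<omega>, X n \<omega>) else 1)" for t
    unfolding density_at_def using finite_jumps[OF \<omega>]
    by (intro arg_cong2[where f="(*)"] refl prod.mono_neutral_cong_left) auto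
  then show ?thesis by simp
qed

lemma density_before_mark_measurable:
  assumes \<omega>: "\<omega> \<in> space M"
  shows "(\<lambda>z. density_before \<omega> (fst z)) \<in> borel_measurable mark_space"
  using measurable_mark_section[OF \<omega> measurable_compose[OF measurable_fst density_before_measurable]] by simp

lemma density_before_bounded:
  assumes \<omega>: "\<omega> \<in> space M"
  obtains B where "\<And>t. t \<in> {0..T} \<Longrightarrow> \<bar>density_before \<omega> t\<bar> \<le> B"
proof (rule that)
  fix t assume t: "t \<in> {0..T}"
  have "density_before \<omega> t \<le> exp (A \<omega> T) * max 1 C ^ card (jumps \<omega>)"
    unfolding density_before_def
  proof (rule mult_mono)
    show "exp (log_density \<omega> t) \<le> exp (A \<omega> T)"
      using log_density_le[OF \<omega>, of t] A_le[OF \<omega>, of t T] t by auto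
    show "jump_prod \<omega> (rate \<omega>) t \<le> max 1 C ^ card (jumps \<omega>)"
      using jump_prod_bound[where R="rate \<omega>" and K=C and t=t, OF \<omega> rate_bounds(3)[OF \<omega>]] by (auto simp: abs_le_iff)
    show "0 \<le> jump_prod \<omega> (rate \<omega>) t"
      unfolding jump_prod_def using rate_jump_bounds[OF \<omega>] by (intro prod_nonneg) auto
  qed simp
  then show "\<bar>density_before \<omega> t\<bar> \<le> exp (A \<omega> T) * max 1 C ^ card (jumps \<omega>)"
    using density_before_nonneg[OF \<omega>, of t] by simp
qed

text \<open>
  The difference of \<open>doleans_equation\<close> at \<open>T\<close> and at \<open>t\<close>, arranged so that all terms are nonnegative.
\<close>

lemma density_increment:
  assumes \<omega>: "\<omega> \<in> space M" and t: "0 \<le> t" "t \<le> T"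
  shows "ennreal (density_at \<omega> T) +
       (\<integral>\<^sup>+y. (if t < fst y then ennreal (density_before \<omega> (fst y)) else 0) \<partial>\<mu> \<omega>) +
       (\<integral>\<^sup>+y. (if t < fst y then ennreal (density_before \<omega> (fst y) * rate \<omega> y) else 0) \<partial>\<nu> \<omega>)
    = ennreal (density_at \<omega> t) +
       (\<integral>\<^sup>+y. (if t < fst y then ennreal (density_before \<omega> (fst y) * rate \<omega> y) else 0) \<partial>\<mu> \<omega>) +
       (\<integral>\<^sup>+y. (if t < fst y then ennreal (density_before \<omega> (fst y)) else 0) \<partial>\<nu> \<omega>)"
proof -
  let ?L = "density_before \<omega>"
  obtain B where B: "\<And>t. t \<in> {0..T} \<Longrightarrow> \<bar>?L t\<bar> \<le> B" using density_before_bounded[OF \<omega>] by blast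
  have B0: "0 \<le> B" using B[of 0] T_pos by auto
  note [measurable] = rate_measurable[OF \<omega>] density_before_mark_measurable[OF \<omega>]
  define f1 where "f1 y = ?L (fst y)" for y :: "real \<times> 'e"
  define f2 where "f2 y = ?L (fst y) * rate \<omega> y" for y
  have f [measurable]: "f1 \<in> borel_measurable mark_space" "f2 \<in> borel_measurable mark_space"
    unfolding f1_def f2_def by measurable
  have f1b: "\<bar>f1 y\<bar> \<le> B" if "y \<in> {0..T} \<times> UNIV" for y using B[of "fst y"] that by (auto simp: f1_def)
  have f2b: "\<bar>f2 y\<bar> \<le> B * C" if "y \<in> {0..T} \<times> UNIV" for y
    unfolding f2_def abs_mult using B[of "fst y"] rate_bounds(3)[OF \<omega> that] that B0 by (intro mult_mono) auto
  have fn: "0 \<le> f1 y" "0 \<le> f2 y" if "y \<in> {0..T} \<times> UNIV" for y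
    using density_before_nonneg[OF \<omega>] rate_bounds(1)[OF \<omega> that] by (auto simp: f1_def f2_def)
  have nu: "(\<integral>\<^sup>+y. (if t < fst y then ennreal (f y) else 0) \<partial>\<nu> \<omega>) = ennreal (set_lebesgue_integral (\<nu> \<omega>) ({t<..T} \<times> UNIV) f)
      \<and> 0 \<le> set_lebesgue_integral (\<nu> \<omega>) ({t<..T} \<times> UNIV) f"
    if m: "f \<in> borel_measurable mark_space" and b: "\<And>y. y \<in> {0..T} \<times> UNIV \<Longrightarrow> \<bar>f y\<bar> \<le> c" and n: "\<And>y. y \<in> {0..T} \<times> UNIV \<Longrightarrow> 0 \<le> f y" for f c
  proof -
    have "AE y in \<nu> \<omega>. 0 \<le> indicator ({t<..T} \<times> UNIV) y *\<^sub>R f y"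
      using n by (intro AE_I2) (auto simp: space_\<nu>[OF \<omega>])
    then have "(\<integral>\<^sup>+y. ennreal (indicator ({t<..T} \<times> UNIV) y *\<^sub>R f y) \<partial>\<nu> \<omega>) = ennreal (set_lebesgue_integral (\<nu> \<omega>) ({t<..T} \<times> UNIV) f)"
      "0 \<le> set_lebesgue_integral (\<nu> \<omega>) ({t<..T} \<times> UNIV) f"
      unfolding set_lebesgue_integral_def
      using set_integrable_\<nu>_bounded[OF \<omega> m b t(1) order.refl]
      by (auto intro!: nn_integral_eq_integral integral_nonneg_AE simp: set_integrable_def)
    moreover have "(\<integral>\<^sup>+y. ennreal (indicator ({t<..T} \<times> UNIV) y *\<^sub>R f y) \<partial>\<nu> \<omega>) = (\<integral>\<^sup>+y. (if t < fst y then ennreal (f y) else 0) \<partial>\<nu> \<omega>)"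
      by (intro nn_integral_cong) (auto simp: space_\<nu>[OF \<omega>] indicator_def)
    ultimately show ?thesis by simp
  qed
  have mu: "(\<integral>\<^sup>+y. (if t < fst y then ennreal (f y) else 0) \<partial>\<mu> \<omega>) = ennreal (\<Sum>n\<in>{n \<in> jumps \<omega>. t < time n \<omega>}. f (time n \<omega>, X n \<omega>))
      \<and> 0 \<le> (\<Sum>n\<in>{n \<in> jumps \<omega>. t < time n \<omega>}. f (time n \<omega>, X n \<omega>))"
    if [measurable]: "f \<in> borel_measurable mark_space" and n: "\<And>y. y \<in> {0..T} \<times> UNIV \<Longrightarrow> 0 \<le> f y" for f
  proof -
    have n': "0 \<le> f (time n \<omega>, X n \<omega>)" if "n \<in> jumps \<omega>" for n using n time_jumps[OF \<omega> that] by auto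
    have "(\<integral>\<^sup>+y. (if t < fst y then ennreal (f y) else 0) \<partial>\<mu> \<omega>) = (\<Sum>n\<in>jumps \<omega>. if t < time n \<omega> then ennreal (f (time n \<omega>, X n \<omega>)) else 0)"
      by (subst nn_integral_\<mu>[OF \<omega>]) auto
    also have "\<dots> = (\<Sum>n\<in>{n \<in> jumps \<omega>. t < time n \<omega>}. ennreal (f (time n \<omega>, X n \<omega>)))"
      using finite_jumps[OF \<omega>] by (intro sum.mono_neutral_cong_right) auto
    also have "\<dots> = ennreal (\<Sum>n\<in>{n \<in> jumps \<omega>. t < time n \<omega>}. f (time n \<omega>, X n \<omega>))"
      using n' by (intro sum_ennreal) auto
    finally show ?thesis using n' by (auto intro!: sum_nonneg)
  qed
  define q where "q n = ?L (time n \<omega>) * (rate \<omega> (time n \<omega>, X n \<omega>) - 1)" for n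
  define h where "h z = ?L (fst z) * (1 - rate \<omega> z)" for z
  have hm: "h \<in> borel_measurable mark_space" unfolding h_def by measurable
  have hb: "\<bar>h z\<bar> \<le> B * (1 + C)" if "z \<in> {0..T} \<times> UNIV" for z
    unfolding h_def abs_mult using B[of "fst z"] one_minus_rate(2)[OF \<omega> that] that B0 by (intro mult_mono) auto
  have eq: "density_at \<omega> v = 1 + (\<Sum>n\<in>{n \<in> jumps \<omega>. time n \<omega> \<le> v}. q n) + cumul \<omega> h v" if "0 \<le> v" "v \<le> T" for v
  proof -
    have cum: "cumul \<omega> h v = (\<integral>z\<in>{0<..v} \<times> UNIV. exp (log_density \<omega> (fst z)) * jump_prod \<omega> (rate \<omega>) (fst z) * (1 - rate \<omega> z) \<partial>\<nu> \<omega>)"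
      unfolding cumul_def h_def[abs_def] density_before_def ..
    show ?thesis
      unfolding cum density_at_def q_def density_before_def unfolding log_density_def
      by (rule doleans_equation[OF \<omega> rate_measurable[OF \<omega>] rate_bounds(3)[OF \<omega>] that])
  qed
  have "(\<Sum>n\<in>{n \<in> jumps \<omega>. time n \<omega> \<le> T}. q n) = (\<Sum>n\<in>{n \<in> jumps \<omega>. time n \<omega> \<le> t} \<union> {n \<in> jumps \<omega>. t < time n \<omega>}. q n)"
    using time_jumps[OF \<omega>] t by (intro sum.cong) auto
  also have "\<dots> = (\<Sum>n\<in>{n \<in> jumps \<omega>. time n \<omega> \<le> t}. q n) + (\<Sum>n\<in>{n \<in> jumps \<omega>. t < time n \<omega>}. q n)"
    using finite_jumps[OF \<omega>] by (intro sum.union_disjoint) auto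
  finally have sums: "(\<Sum>n\<in>{n \<in> jumps \<omega>. time n \<omega> \<le> T}. q n) = (\<Sum>n\<in>{n \<in> jumps \<omega>. time n \<omega> \<le> t}. q n) + (\<Sum>n\<in>{n \<in> jumps \<omega>. t < time n \<omega>}. q n)" .
  have q: "(\<Sum>n\<in>{n \<in> jumps \<omega>. t < time n \<omega>}. q n) = (\<Sum>n\<in>{n \<in> jumps \<omega>. t < time n \<omega>}. f2 (time n \<omega>, X n \<omega>)) - (\<Sum>n\<in>{n \<in> jumps \<omega>. t < time n \<omega>}. f1 (time n \<omega>, X n \<omega>))"
    by (simp add: q_def f1_def f2_def sum_subtractf algebra_simps)
  have "cumul \<omega> h T - cumul \<omega> h t = set_lebesgue_integral (\<nu> \<omega>) ({t<..T} \<times> UNIV) h"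
    by (rule cumul_diff[OF \<omega> hm hb t order.refl])
  also have "\<dots> = set_lebesgue_integral (\<nu> \<omega>) ({t<..T} \<times> UNIV) (\<lambda>z. f1 z - f2 z)"
    by (intro arg_cong2[where f="set_lebesgue_integral _"] refl) (auto simp: h_def f1_def f2_def algebra_simps)
  also have "\<dots> = set_lebesgue_integral (\<nu> \<omega>) ({t<..T} \<times> UNIV) f1 - set_lebesgue_integral (\<nu> \<omega>) ({t<..T} \<times> UNIV) f2"
    by (intro set_integral_diff(2) set_integrable_\<nu>_bounded[OF \<omega> f(1) f1b] set_integrable_\<nu>_bounded[OF \<omega> f(2) f2b] t order.refl)
  finally have hh: "cumul \<omega> h T - cumul \<omega> h t = set_lebesgue_integral (\<nu> \<omega>) ({t<..T} \<times> UNIV) f1 - set_lebesgue_integral (\<nu> \<omega>) ({t<..T} \<times> UNIV) f2" .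
  have "density_at \<omega> T + (\<Sum>n\<in>{n \<in> jumps \<omega>. t < time n \<omega>}. f1 (time n \<omega>, X n \<omega>)) + set_lebesgue_integral (\<nu> \<omega>) ({t<..T} \<times> UNIV) f2
     = density_at \<omega> t + (\<Sum>n\<in>{n \<in> jumps \<omega>. t < time n \<omega>}. f2 (time n \<omega>, X n \<omega>)) + set_lebesgue_integral (\<nu> \<omega>) ({t<..T} \<times> UNIV) f1"
    using eq[of T] eq[OF t] sums q hh T_pos by simp
  then show ?thesis
    using nu[OF f(1) f1b fn(1)] nu[OF f(2) f2b fn(2)] mu[OF f(1) fn(1)] mu[OF f(2) fn(2)] density_at_nonneg[OF \<omega>]
    unfolding f1_def f2_def by (simp add: ennreal_plus[symmetric] del: ennreal_plus)
qed

lemma density_before_nn_integral_finite: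
  "(\<integral>\<^sup>+\<omega>. \<integral>\<^sup>+z. ennreal (density_before \<omega> (fst z)) \<partial>\<nu> \<omega> \<partial>M) < \<infinity>"
proof -
  have "(\<integral>\<^sup>+\<omega>. \<integral>\<^sup>+z. ennreal (density_before \<omega> (fst z)) \<partial>\<nu> \<omega> \<partial>M) \<le>
    (\<integral>\<^sup>+\<omega>. \<integral>\<^sup>+z. ennreal (exp (A \<omega> (fst z)) * C ^ count_before \<omega> (fst z)) \<partial>\<nu> \<omega> \<partial>M)"
    by (intro nn_integral_mono ennreal_leI density_before_le) (auto simp: space_\<nu>)
  also have "\<dots> < \<infinity>" by (rule exp_A_power_count_integrable[OF C_pos exp_moment])
  finally show ?thesis .
qed

text \<open>
  The measure \<open>m\<close> stands for \<open>\<mu>\<close> or \<open>\<nu>\<close>, and \<open>F\<close> for a predictable function that coincides with the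
  density \<open>m\<close>-almost everywhere.  Integrating \<open>density_increment\<close> against \<open>H\<close> and exchanging the order of
  integration replaces each tail integral over \<open>(t, T]\<close> by an integral against
  \<open>W s = \<integral>\<^bsub>(0,s)\<^esub> H dm\<close>.  Since \<open>W\<close> is predictable, the corresponding terms on the two sides
  have equal means; since \<open>W\<close> is bounded, these means are finite and can be cancelled.
\<close>

lemma change_of_intensity_bounded:
  fixes m :: "'a \<Rightarrow> (real \<times> 'e) measure" and H F :: "('a \<times> real) \<times> 'e \<Rightarrow> ennreal"
  assumes m_finite: "\<And>\<omega>. \<omega> \<in> space M \<Longrightarrow> finite_measure (m \<omega>)"
    and m_sets: "\<And>\<omega>. \<omega> \<in> space M \<Longrightarrow> sets (m \<omega>) = sets mark_space"
    and m_pred: "\<And>H. H \<in> predictable_sigma \<Otimes>\<^sub>M borel \<rightarrow>\<^sub>M (borel :: ennreal measure) \<Longrightarrow>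
      (\<lambda>z. \<integral>\<^sup>+y. (if fst y < snd z then H ((fst z, fst y), snd y) else 0) \<partial>m (fst z)) \<in> borel_measurable predictable_sigma"
    and m_meas: "\<And>H. H \<in> predictable_sigma \<Otimes>\<^sub>M borel \<rightarrow>\<^sub>M (borel :: ennreal measure) \<Longrightarrow>
      (\<lambda>\<omega>. \<integral>\<^sup>+z. H ((\<omega>, fst z), snd z) \<partial>m \<omega>) \<in> borel_measurable M"
    and F: "F \<in> borel_measurable (predictable_sigma \<Otimes>\<^sub>M borel)"
    and F_eq: "\<And>\<omega>. \<omega> \<in> space M \<Longrightarrow> AE z in m \<omega>. ennreal (density_at \<omega> (fst z)) = F ((\<omega>, fst z), snd z)"
    and H: "H \<in> borel_measurable (predictable_sigma \<Otimes>\<^sub>M borel)"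
    and bound: "\<And>\<omega> s. \<omega> \<in> space M \<Longrightarrow> (\<integral>\<^sup>+y. (if fst y < s then H ((\<omega>, fst y), snd y) else 0) \<partial>m \<omega>) \<le> ennreal c"
  shows "(\<integral>\<^sup>+\<omega>. ennreal (density_at \<omega> T) * (\<integral>\<^sup>+z. H ((\<omega>, fst z), snd z) \<partial>m \<omega>) \<partial>M)
    = (\<integral>\<^sup>+\<omega>. \<integral>\<^sup>+z. H ((\<omega>, fst z), snd z) * F ((\<omega>, fst z), snd z) \<partial>m \<omega> \<partial>M)"
proof -
  define W where "W z = (\<integral>\<^sup>+y. (if fst y < snd z then H ((fst z, fst y), snd y) else 0) \<partial>m (fst z))" for z
  define K1 where "K1 y = ennreal (density_before (fst (fst y)) (snd (fst y))) * W (fst y)" for y :: "('a \<times> real) \<times> 'e"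
  define K2 where "K2 y = ennreal (density_before (fst (fst y)) (snd (fst y)) * \<rho> y) * W (fst y)" for y :: "('a \<times> real) \<times> 'e"
  have W [measurable]: "W \<in> borel_measurable predictable_sigma" unfolding W_def[abs_def] by (rule m_pred[OF H])
  have [measurable]: "(\<lambda>y::('a \<times> real) \<times> 'e. density_before (fst (fst y)) (snd (fst y))) \<in> borel_measurable (predictable_sigma \<Otimes>\<^sub>M borel)"
    by (rule measurable_compose[OF measurable_fst density_before_measurable])
  have K1 [measurable]: "K1 \<in> borel_measurable (predictable_sigma \<Otimes>\<^sub>M borel)" unfolding K1_def[abs_def] by measurable
  have K2 [measurable]: "K2 \<in> borel_measurable (predictable_sigma \<Otimes>\<^sub>M borel)" unfolding K2_def[abs_def] by measurable
  note [measurable] = H F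
  have HF [measurable]: "(\<lambda>y. H y * F y) \<in> borel_measurable (predictable_sigma \<Otimes>\<^sub>M borel)" by measurable
  define I where "I K m \<omega> = (\<integral>\<^sup>+z. K ((\<omega>, fst z), snd z) \<partial>m \<omega>)" for K :: "('a \<times> real) \<times> 'e \<Rightarrow> ennreal" and m :: "'a \<Rightarrow> (real \<times> 'e) measure" and \<omega>
  have Wb: "W (\<omega>, s) \<le> ennreal c" if "\<omega> \<in> space M" for \<omega> s unfolding W_def fst_conv snd_conv by (rule bound[OF that])
  have path: "ennreal (density_at \<omega> T) * I H m \<omega> + I K1 \<mu> \<omega> + I K2 \<nu> \<omega> = I (\<lambda>y. H y * F y) m \<omega> + I K2 \<mu> \<omega> + I K1 \<nu> \<omega>"
    if \<omega>: "\<omega> \<in> space M" for \<omega>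
  proof -
    let ?L = "\<lambda>y::real \<times> 'e. ennreal (density_before \<omega> (fst y))" and ?R = "\<lambda>y. ennreal (density_before \<omega> (fst y) * rate \<omega> y)"
    let ?h = "\<lambda>z. H ((\<omega>, fst z), snd z)"
    let ?tail = "\<lambda>f n z. \<integral>\<^sup>+y. (if fst z < fst y then f y else 0) \<partial>n"
    have sm: "sigma_finite_measure (m \<omega>)" "sigma_finite_measure (\<mu> \<omega>)" "sigma_finite_measure (\<nu> \<omega>)"
      using m_finite[OF \<omega>] finite_measure_\<mu>[OF \<omega>] finite_measure_\<nu>[OF \<omega>] by (auto intro: finite_measure.axioms)
    note [measurable_cong] = m_sets[OF \<omega>] sets_\<nu>[OF \<omega>]
    note [measurable] = rate_measurable[OF \<omega>] density_before_mark_measurable[OF \<omega>] density_at_mark_measurable[OF \<omega>]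
      measurable_mark_section[OF \<omega> H]
    have tail_meas: "?tail f n \<in> borel_measurable (m \<omega>)"
      if "sigma_finite_measure n" and s: "sets n = sets mark_space" and [measurable]: "f \<in> borel_measurable mark_space" for f n
    proof -
      interpret sigma_finite_measure n by fact
      note [measurable_cong] = s
      show ?thesis by measurable
    qed
    note [measurable] = tail_meas[OF sm(2) sets_\<mu>] tail_meas[OF sm(3) sets_\<nu>[OF \<omega>]]
    have swap: "(\<integral>\<^sup>+z. ?h z * ?tail f n z \<partial>m \<omega>) = (\<integral>\<^sup>+y. f y * W (\<omega>, fst y) \<partial>n)"
      if sn: "sigma_finite_measure n" and s: "sets n = sets mark_space" and [measurable]: "f \<in> borel_measurable mark_space" for f n
    proof -
      note [measurable_cong] = s
      have "(\<integral>\<^sup>+z. ?h z * ?tail f n z \<partial>m \<omega>) = (\<integral>\<^sup>+y. f y * (\<integral>\<^sup>+z. (if fst z < fst y then ?h z else 0) \<partial>m \<omega>) \<partial>n)"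
        by (rule nn_integral_triangle_swap[OF sm(1) sn]) measurable
      then show ?thesis unfolding W_def fst_conv snd_conv .
    qed
    have Lm: "?L \<in> borel_measurable mark_space" and Rm: "?R \<in> borel_measurable mark_space" by measurable
    have "ennreal (density_at \<omega> T) * I H m \<omega> + I K1 \<mu> \<omega> + I K2 \<nu> \<omega> =
      (\<integral>\<^sup>+z. ?h z * ennreal (density_at \<omega> T) \<partial>m \<omega>) + (\<integral>\<^sup>+z. ?h z * ?tail ?L (\<mu> \<omega>) z \<partial>m \<omega>) + (\<integral>\<^sup>+z. ?h z * ?tail ?R (\<nu> \<omega>) z \<partial>m \<omega>)"
      unfolding swap[OF sm(2) sets_\<mu> Lm] swap[OF sm(3) sets_\<nu>[OF \<omega>] Rm] I_def K1_def K2_def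
      by (subst nn_integral_multc) (auto simp: rate_def mult.commute)
    also have "\<dots> = (\<integral>\<^sup>+z. ?h z * (ennreal (density_at \<omega> T) + ?tail ?L (\<mu> \<omega>) z + ?tail ?R (\<nu> \<omega>) z) \<partial>m \<omega>)"
      unfolding distrib_left using Lm Rm by (simp add: nn_integral_add)
    also have "\<dots> = (\<integral>\<^sup>+z. ?h z * (ennreal (density_at \<omega> (fst z)) + ?tail ?R (\<mu> \<omega>) z + ?tail ?L (\<nu> \<omega>) z) \<partial>m \<omega>)"
      using sets_eq_imp_space_eq[OF m_sets[OF \<omega>]]
      by (intro nn_integral_cong arg_cong2[where f="(*)"] refl density_increment[OF \<omega>]) (auto simp: space_mark_space)
    also have "\<dots> = (\<integral>\<^sup>+z. ?h z * ennreal (density_at \<omega> (fst z)) \<partial>m \<omega>) + (\<integral>\<^sup>+z. ?h z * ?tail ?R (\<mu> \<omega>) z \<partial>m \<omega>) + (\<integral>\<^sup>+z. ?h z * ?tail ?L (\<nu> \<omega>) z \<partial>m \<omega>)"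
      unfolding distrib_left using Lm Rm by (simp add: nn_integral_add)
    also have "(\<integral>\<^sup>+z. ?h z * ennreal (density_at \<omega> (fst z)) \<partial>m \<omega>) = I (\<lambda>y. H y * F y) m \<omega>"
      unfolding I_def using F_eq[OF \<omega>] by (intro nn_integral_cong_AE) (auto elim!: eventually_mono)
    also have "(\<integral>\<^sup>+z. ?h z * ?tail ?R (\<mu> \<omega>) z \<partial>m \<omega>) = I K2 \<mu> \<omega>"
      unfolding swap[OF sm(2) sets_\<mu> Rm] I_def K2_def by (simp add: rate_def)
    also have "(\<integral>\<^sup>+z. ?h z * ?tail ?L (\<nu> \<omega>) z \<partial>m \<omega>) = I K1 \<nu> \<omega>"
      unfolding swap[OF sm(3) sets_\<nu>[OF \<omega>] Lm] I_def K1_def by simp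
    finally show ?thesis .
  qed
  have [measurable]: "I H m \<in> borel_measurable M" "I (\<lambda>y. H y * F y) m \<in> borel_measurable M"
    "I K1 \<mu> \<in> borel_measurable M" "I K2 \<mu> \<in> borel_measurable M" "I K1 \<nu> \<in> borel_measurable M" "I K2 \<nu> \<in> borel_measurable M"
    unfolding I_def[abs_def]
    by (rule m_meas[OF H] m_meas[OF HF] measurable_nn_integral_\<mu>[OF K1] measurable_nn_integral_\<mu>[OF K2]
        measurable_nn_integral_\<nu>[OF K1] measurable_nn_integral_\<nu>[OF K2])+
  have K1_fin: "(\<integral>\<^sup>+\<omega>. I K1 \<nu> \<omega> \<partial>M) < \<infinity>" and K2_fin: "(\<integral>\<^sup>+\<omega>. I K2 \<nu> \<omega> \<partial>M) < \<infinity>"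
  proof -
    let ?D = "\<lambda>y::('a \<times> real) \<times> 'e. ennreal (density_before (fst (fst y)) (snd (fst y)))"
    have D: "?D \<in> borel_measurable (predictable_sigma \<Otimes>\<^sub>M borel)" by measurable
    have fin: "(\<integral>\<^sup>+\<omega>. \<integral>\<^sup>+z. b * ennreal (density_before \<omega> (fst z)) \<partial>\<nu> \<omega> \<partial>M) < \<infinity>" if b: "b < \<infinity>" for b :: ennreal
    proof -
      have "(\<integral>\<^sup>+\<omega>. \<integral>\<^sup>+z. b * ennreal (density_before \<omega> (fst z)) \<partial>\<nu> \<omega> \<partial>M) = (\<integral>\<^sup>+\<omega>. b * (\<integral>\<^sup>+z. ennreal (density_before \<omega> (fst z)) \<partial>\<nu> \<omega>) \<partial>M)"
        using measurable_mark_section[OF _ D]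
        by (intro nn_integral_cong nn_integral_cmult) (auto simp: measurable_cong_sets[OF sets_\<nu> refl])
      also have "\<dots> = b * (\<integral>\<^sup>+\<omega>. (\<integral>\<^sup>+z. ennreal (density_before \<omega> (fst z)) \<partial>\<nu> \<omega>) \<partial>M)"
        using measurable_nn_integral_\<nu>[OF D] by (intro nn_integral_cmult) auto
      also have "\<dots> < \<infinity>" using density_before_nn_integral_finite b by (simp add: ennreal_mult_less_top)
      finally show ?thesis .
    qed
    have "(\<integral>\<^sup>+\<omega>. I K1 \<nu> \<omega> \<partial>M) \<le> (\<integral>\<^sup>+\<omega>. \<integral>\<^sup>+z. ennreal c * ennreal (density_before \<omega> (fst z)) \<partial>\<nu> \<omega> \<partial>M)"
      unfolding I_def K1_def by (intro nn_integral_mono) (auto simp: mult.commute intro!: mult_right_mono Wb)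
    also have "\<dots> < \<infinity>" by (rule fin) simp
    finally show "(\<integral>\<^sup>+\<omega>. I K1 \<nu> \<omega> \<partial>M) < \<infinity>" .
    have "(\<integral>\<^sup>+\<omega>. I K2 \<nu> \<omega> \<partial>M) \<le> (\<integral>\<^sup>+\<omega>. \<integral>\<^sup>+z. (ennreal C * ennreal c) * ennreal (density_before \<omega> (fst z)) \<partial>\<nu> \<omega> \<partial>M)"
    proof (intro nn_integral_mono, unfold I_def, rule nn_integral_mono)
      fix \<omega> z assume \<omega>: "\<omega> \<in> space M" and z: "z \<in> space (\<nu> \<omega>)"
      have "K2 ((\<omega>, fst z), snd z) = ennreal (density_before \<omega> (fst z)) * ennreal (rate \<omega> z) * W (\<omega>, fst z)"
        using rate_bounds(1)[OF \<omega>, of z] z density_before_nonneg[OF \<omega>] by (simp add: K2_def rate_def ennreal_mult space_\<nu>[OF \<omega>])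
      also have "\<dots> \<le> ennreal (density_before \<omega> (fst z)) * ennreal C * ennreal c"
        using rate_bounds(2)[OF \<omega>, of z] z Wb[OF \<omega>] by (intro mult_mono ennreal_leI) (auto simp: space_\<nu>[OF \<omega>])
      finally show "K2 ((\<omega>, fst z), snd z) \<le> (ennreal C * ennreal c) * ennreal (density_before \<omega> (fst z))" by (simp add: ac_simps)
    qed
    also have "\<dots> < \<infinity>" by (rule fin) (simp add: ennreal_mult_less_top)
    finally show "(\<integral>\<^sup>+\<omega>. I K2 \<nu> \<omega> \<partial>M) < \<infinity>" .
  qed
  have c1: "(\<integral>\<^sup>+\<omega>. I K1 \<mu> \<omega> \<partial>M) = (\<integral>\<^sup>+\<omega>. I K1 \<nu> \<omega> \<partial>M)" unfolding I_def by (rule compensator_pair[OF K1])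
  have c2: "(\<integral>\<^sup>+\<omega>. I K2 \<mu> \<omega> \<partial>M) = (\<integral>\<^sup>+\<omega>. I K2 \<nu> \<omega> \<partial>M)" unfolding I_def by (rule compensator_pair[OF K2])
  have "(\<integral>\<^sup>+\<omega>. ennreal (density_at \<omega> T) * I H m \<omega> \<partial>M) + (\<integral>\<^sup>+\<omega>. I K1 \<mu> \<omega> \<partial>M) + (\<integral>\<^sup>+\<omega>. I K2 \<nu> \<omega> \<partial>M)
      = (\<integral>\<^sup>+\<omega>. ennreal (density_at \<omega> T) * I H m \<omega> + I K1 \<mu> \<omega> + I K2 \<nu> \<omega> \<partial>M)"
    by (simp add: nn_integral_add)
  also have "\<dots> = (\<integral>\<^sup>+\<omega>. I (\<lambda>y. H y * F y) m \<omega> + I K2 \<mu> \<omega> + I K1 \<nu> \<omega> \<partial>M)"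
    by (intro nn_integral_cong path)
  also have "\<dots> = (\<integral>\<^sup>+\<omega>. I (\<lambda>y. H y * F y) m \<omega> \<partial>M) + (\<integral>\<^sup>+\<omega>. I K2 \<mu> \<omega> \<partial>M) + (\<integral>\<^sup>+\<omega>. I K1 \<nu> \<omega> \<partial>M)"
    by (simp add: nn_integral_add)
  finally have "((\<integral>\<^sup>+\<omega>. I K1 \<nu> \<omega> \<partial>M) + (\<integral>\<^sup>+\<omega>. I K2 \<nu> \<omega> \<partial>M)) + (\<integral>\<^sup>+\<omega>. ennreal (density_at \<omega> T) * I H m \<omega> \<partial>M) =
     ((\<integral>\<^sup>+\<omega>. I K1 \<nu> \<omega> \<partial>M) + (\<integral>\<^sup>+\<omega>. I K2 \<nu> \<omega> \<partial>M)) + (\<integral>\<^sup>+\<omega>. I (\<lambda>y. H y * F y) m \<omega> \<partial>M)"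
    unfolding c1 c2 by (simp add: ac_simps)
  moreover have "(\<integral>\<^sup>+\<omega>. I K1 \<nu> \<omega> \<partial>M) + (\<integral>\<^sup>+\<omega>. I K2 \<nu> \<omega> \<partial>M) \<noteq> \<infinity>" using K1_fin K2_fin by (simp add: less_top)
  ultimately show ?thesis by (simp add: ennreal_add_left_cancel I_def)
qed

end

context intensity_change
begin

text \<open>
  The times at which \<open>A\<close> is at most \<open>k\<close> and fewer than \<open>k\<close> points have occurred carry mass at most \<open>k\<close>,
  both for \<open>\<nu>\<close> (where the bound on \<open>A\<close> is used) and for \<open>\<mu>\<close> (where the bound on the number of points is used).
  Since every \<open>(\<omega>, t)\<close> satisfies both restrictions for large \<open>k\<close>, they serve as a localization.
\<close>

lemma low_activity_bound_\<nu>: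
  assumes \<omega>: "\<omega> \<in> space M"
  shows "(\<integral>\<^sup>+z. (if A \<omega> (fst z) \<le> real k \<and> count_before \<omega> (fst z) < k then 1 else 0) \<partial>\<nu> \<omega>) \<le> ennreal (real k)"
proof -
  let ?V = "{t \<in> {0..T}. A \<omega> t \<le> real k}"
  have V: "closed ?V"
    using continuous_closed_preimage[OF A_continuous[OF \<omega>], of "{..real k}"]
    by (simp add: vimage_def Int_def)
  have 0: "0 \<in> ?V" using A_0[OF \<omega>] T_pos by simp
  have bdd: "bdd_above ?V" by (rule bdd_aboveI[of _ T]) simp
  define s where "s = Sup ?V"
  have s: "s \<in> ?V" unfolding s_def using closed_contains_Sup[OF _ bdd V] 0 by auto
  have sub: "t \<le> s" if "t \<in> ?V" for t unfolding s_def using cSup_upper[OF that bdd] .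
  have "(\<integral>\<^sup>+z. (if A \<omega> (fst z) \<le> real k \<and> count_before \<omega> (fst z) < k then 1 else 0) \<partial>\<nu> \<omega>) \<le> (\<integral>\<^sup>+z. indicator ({0..s} \<times> UNIV) z \<partial>\<nu> \<omega>)"
    using sub by (intro nn_integral_mono) (auto simp: space_\<nu>[OF \<omega>] indicator_def)
  also have "\<dots> = emeasure (\<nu> \<omega>) ({0..s} \<times> UNIV)"
    using s sets_\<nu>[OF \<omega>] unfolding mark_space_def
    by (intro nn_integral_indicator) (auto intro!: pair_measureI simp: sets_restrict_space_iff)
  also have "\<dots> = ennreal (A \<omega> s - A \<omega> 0)"
    using s by (subst emeasure_\<nu>_times[OF \<omega>]) (auto intro!: emeasure_dA_Icc[OF \<omega>])
  also have "\<dots> \<le> ennreal (real k)" using s A_0[OF \<omega>] by (intro ennreal_leI) simp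
  finally show ?thesis .
qed

text \<open>
  Comparing powers of \<open>2\<close> reduces the claim to \<open>predictable_power_count\<close>.
\<close>

lemma count_before_measurable [measurable]:
  "Measurable.pred predictable_sigma (\<lambda>z. count_before (fst z) (snd z) < k)"
proof -
  have "Measurable.pred predictable_sigma (\<lambda>z. (2::real) ^ count_before (fst z) (snd z) < 2 ^ k)" by measurable
  then show ?thesis by (simp only: power_strict_increasing_iff[of 2 _ k] one_less_numeral_iff semiring_norm)
qed

lemma low_activity_measurable:
  "(\<lambda>y::('a \<times> real) \<times> 'e. (if A (fst (fst y)) (snd (fst y)) \<le> real k \<and> count_before (fst (fst y)) (snd (fst y)) < k then 1 else 0) :: ennreal)
    \<in> borel_measurable (predictable_sigma \<Otimes>\<^sub>M borel)"
proof -
  have "(\<lambda>z. (if A (fst z) (snd z) \<le> real k \<and> count_before (fst z) (snd z) < k then 1 else 0) :: ennreal) \<in> borel_measurable predictable_sigma"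
    by measurable
  from measurable_compose[OF measurable_fst this] show ?thesis .
qed

lemma low_activity_bound_\<mu>:
  assumes \<omega>: "\<omega> \<in> space M"
  shows "(\<integral>\<^sup>+z. (if A \<omega> (fst z) \<le> real k \<and> count_before \<omega> (fst z) < k then 1 else 0) \<partial>\<mu> \<omega>) \<le> ennreal (real k)"
proof -
  have "(\<integral>\<^sup>+z. (if A \<omega> (fst z) \<le> real k \<and> count_before \<omega> (fst z) < k then 1 else 0) \<partial>\<mu> \<omega>)
      = (\<Sum>n\<in>jumps \<omega>. if A \<omega> (time n \<omega>) \<le> real k \<and> count_before \<omega> (time n \<omega>) < k then 1 else 0)"
    using measurable_mark_section[OF \<omega> low_activity_measurable[of k]] by (subst nn_integral_\<mu>[OF \<omega>]) simp_all
  also have "\<dots> \<le> (\<Sum>n\<in>jumps \<omega>. if n \<in> {1..k} then 1 else 0)"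
  proof (rule sum_mono)
    fix n assume n: "n \<in> jumps \<omega>"
    then have "1 \<le> n" by (simp add: jumps_def)
    then show "(if A \<omega> (time n \<omega>) \<le> real k \<and> count_before \<omega> (time n \<omega>) < k then 1 else 0) \<le> (if n \<in> {1..k} then 1 else 0 :: ennreal)"
      unfolding count_before_jump[OF \<omega> n] by auto
  qed
  also have "\<dots> = (\<Sum>n\<in>{1..k} \<inter> jumps \<omega>. 1)"
    using finite_jumps[OF \<omega>] by (intro sum.mono_neutral_cong_right) auto
  also have "\<dots> = of_nat (card ({1..k} \<inter> jumps \<omega>))" by simp
  also have "\<dots> \<le> of_nat k" using card_mono[of "{1..k}" "{1..k} \<inter> jumps \<omega>"] by (intro of_nat_mono) simp
  finally show ?thesis by (simp add: ennreal_of_nat_eq_real_of_nat)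
qed

text \<open>
  Truncating \<open>H\<close> at \<open>k\<close> and restricting it to the times of low activity makes \<open>W\<close> bounded by
  \<open>k * k\<close>; then \<open>k\<close> tends to infinity.
\<close>

lemma change_of_intensity:
  fixes m :: "'a \<Rightarrow> (real \<times> 'e) measure" and H F :: "('a \<times> real) \<times> 'e \<Rightarrow> ennreal"
  assumes m_finite: "\<And>\<omega>. \<omega> \<in> space M \<Longrightarrow> finite_measure (m \<omega>)"
    and m_sets: "\<And>\<omega>. \<omega> \<in> space M \<Longrightarrow> sets (m \<omega>) = sets mark_space"
    and m_pred: "\<And>H. H \<in> predictable_sigma \<Otimes>\<^sub>M borel \<rightarrow>\<^sub>M (borel :: ennreal measure) \<Longrightarrow>
      (\<lambda>z. \<integral>\<^sup>+y. (if fst y < snd z then H ((fst z, fst y), snd y) else 0) \<partial>m (fst z)) \<in> borel_measurable predictable_sigma"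
    and m_meas: "\<And>H. H \<in> predictable_sigma \<Otimes>\<^sub>M borel \<rightarrow>\<^sub>M (borel :: ennreal measure) \<Longrightarrow>
      (\<lambda>\<omega>. \<integral>\<^sup>+z. H ((\<omega>, fst z), snd z) \<partial>m \<omega>) \<in> borel_measurable M"
    and m_low: "\<And>\<omega> k. \<omega> \<in> space M \<Longrightarrow>
      (\<integral>\<^sup>+z. (if A \<omega> (fst z) \<le> real k \<and> count_before \<omega> (fst z) < k then 1 else 0) \<partial>m \<omega>) \<le> ennreal (real k)"
    and F: "F \<in> borel_measurable (predictable_sigma \<Otimes>\<^sub>M borel)"
    and F_eq: "\<And>\<omega>. \<omega> \<in> space M \<Longrightarrow> AE z in m \<omega>. ennreal (density_at \<omega> (fst z)) = F ((\<omega>, fst z), snd z)"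
    and H: "H \<in> borel_measurable (predictable_sigma \<Otimes>\<^sub>M borel)"
  shows "(\<integral>\<^sup>+\<omega>. ennreal (density_at \<omega> T) * (\<integral>\<^sup>+z. H ((\<omega>, fst z), snd z) \<partial>m \<omega>) \<partial>M)
    = (\<integral>\<^sup>+\<omega>. \<integral>\<^sup>+z. H ((\<omega>, fst z), snd z) * F ((\<omega>, fst z), snd z) \<partial>m \<omega> \<partial>M)"
proof -
  define low :: "nat \<Rightarrow> ('a \<times> real) \<times> 'e \<Rightarrow> ennreal" where
    "low k y = (if A (fst (fst y)) (snd (fst y)) \<le> real k \<and> count_before (fst (fst y)) (snd (fst y)) < k then 1 else 0)" for k y
  define Hk where "Hk k y = min (H y) (of_nat k) * low k y" for k y
  have low [measurable]: "low k \<in> borel_measurable (predictable_sigma \<Otimes>\<^sub>M borel)" for k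
    unfolding low_def[abs_def] by (rule low_activity_measurable)
  note [measurable] = H F
  have Hk [measurable]: "Hk k \<in> borel_measurable (predictable_sigma \<Otimes>\<^sub>M borel)" for k
    unfolding Hk_def[abs_def] by measurable
  have low_mono: "low j y \<le> low k y" if "j \<le> k" for j k y
    using that by (auto simp: low_def)
  have Hk_mono: "Hk j y \<le> Hk k y" if "j \<le> k" for j k y
    unfolding Hk_def using that by (intro mult_mono min.mono low_mono of_nat_mono) auto
  have Hk_sup: "(SUP k. Hk k y) = H y" for y
  proof (rule antisym)
    show "(SUP k. Hk k y) \<le> H y"
      by (intro SUP_least) (auto simp: Hk_def low_def)
    obtain j1 where j1: "A (fst (fst y)) (snd (fst y)) \<le> real j1" using real_arch_simple by blast
    define j where "j = max j1 (Suc (count_before (fst (fst y)) (snd (fst y))))"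
    have j: "low k y = 1" if "j \<le> k" for k
    proof -
      have "real j1 \<le> real k" "count_before (fst (fst y)) (snd (fst y)) < k" using that by (auto simp: j_def)
      then show ?thesis using j1 by (simp add: low_def)
    qed
    show "H y \<le> (SUP k. Hk k y)"
    proof (rule dense_ge)
      fix x assume x: "x > (SUP k. Hk k y)"
      have Hx: "min (H y) (of_nat k) < x" if "j \<le> k" for k
      proof -
        have "Hk k y \<le> (SUP k. Hk k y)" by (rule SUP_upper) simp
        then show ?thesis using x j[OF that] by (simp add: Hk_def)
      qed
      show "H y \<le> x"
      proof (cases "x = \<infinity>")
        case False
        then obtain i where i: "x < of_nat i" using ennreal_Ex_less_of_nat[of x] by (auto simp: less_top)
        have "x < of_nat (max i j)" using i by (rule less_le_trans) (simp add: of_nat_mono)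
        moreover have "min (H y) (of_nat (max i j)) < x" by (rule Hx) simp
        ultimately have "H y < x" by (auto simp: min_def split: if_splits dest: less_trans)
        then show ?thesis by simp
      qed simp
    qed
  qed
  have bounded: "(\<integral>\<^sup>+y. (if fst y < s then Hk k ((\<omega>, fst y), snd y) else 0) \<partial>m \<omega>) \<le> ennreal (real k * real k)"
    if \<omega>: "\<omega> \<in> space M" for \<omega> s k
  proof -
    note [measurable_cong] = m_sets[OF \<omega>]
    note [measurable] = measurable_mark_section[OF \<omega> low[of k]]
    have "(\<integral>\<^sup>+y. (if fst y < s then Hk k ((\<omega>, fst y), snd y) else 0) \<partial>m \<omega>) \<le> (\<integral>\<^sup>+y. of_nat k * low k ((\<omega>, fst y), snd y) \<partial>m \<omega>)"
      by (intro nn_integral_mono) (auto simp: Hk_def intro!: mult_right_mono)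
    also have "\<dots> = of_nat k * (\<integral>\<^sup>+y. low k ((\<omega>, fst y), snd y) \<partial>m \<omega>)" by (intro nn_integral_cmult) measurable
    also have "\<dots> \<le> of_nat k * ennreal (real k)"
      using m_low[OF \<omega>, of k] by (intro mult_left_mono) (simp_all add: low_def)
    finally show ?thesis by (simp add: ennreal_of_nat_eq_real_of_nat ennreal_mult)
  qed
  have bnd: "(\<integral>\<^sup>+\<omega>. ennreal (density_at \<omega> T) * (\<integral>\<^sup>+z. Hk k ((\<omega>, fst z), snd z) \<partial>m \<omega>) \<partial>M)
    = (\<integral>\<^sup>+\<omega>. \<integral>\<^sup>+z. Hk k ((\<omega>, fst z), snd z) * F ((\<omega>, fst z), snd z) \<partial>m \<omega> \<partial>M)" for k
    by (rule change_of_intensity_bounded[OF m_finite m_sets m_pred m_meas F F_eq Hk bounded])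
  have HkF [measurable]: "(\<lambda>y. Hk k y * F y) \<in> borel_measurable (predictable_sigma \<Otimes>\<^sub>M borel)" for k by measurable
  have sup_int: "(\<integral>\<^sup>+z. H ((\<omega>, fst z), snd z) * G ((\<omega>, fst z), snd z) \<partial>m \<omega>) = (SUP k. \<integral>\<^sup>+z. Hk k ((\<omega>, fst z), snd z) * G ((\<omega>, fst z), snd z) \<partial>m \<omega>)"
    if \<omega>: "\<omega> \<in> space M" and G [measurable]: "G \<in> borel_measurable (predictable_sigma \<Otimes>\<^sub>M borel)" for \<omega> G
  proof -
    have HG: "(\<lambda>y. Hk k y * G y) \<in> borel_measurable (predictable_sigma \<Otimes>\<^sub>M borel)" for k by measurable
    have "(\<integral>\<^sup>+z. H ((\<omega>, fst z), snd z) * G ((\<omega>, fst z), snd z) \<partial>m \<omega>) = (\<integral>\<^sup>+z. (SUP k. Hk k ((\<omega>, fst z), snd z) * G ((\<omega>, fst z), snd z)) \<partial>m \<omega>)"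
      by (simp add: SUP_mult_right_ennreal[symmetric] Hk_sup)
    also have "\<dots> = (SUP k. \<integral>\<^sup>+z. Hk k ((\<omega>, fst z), snd z) * G ((\<omega>, fst z), snd z) \<partial>m \<omega>)"
      using Hk_mono measurable_mark_section[OF \<omega> HG]
      by (intro nn_integral_monotone_convergence_SUP)
         (auto simp: incseq_def le_fun_def measurable_cong_sets[OF m_sets[OF \<omega>] refl] intro!: mult_right_mono)
    finally show ?thesis .
  qed
  have "(\<integral>\<^sup>+\<omega>. ennreal (density_at \<omega> T) * (\<integral>\<^sup>+z. H ((\<omega>, fst z), snd z) \<partial>m \<omega>) \<partial>M)
      = (\<integral>\<^sup>+\<omega>. (SUP k. ennreal (density_at \<omega> T) * (\<integral>\<^sup>+z. Hk k ((\<omega>, fst z), snd z) \<partial>m \<omega>)) \<partial>M)"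
    using sup_int[of _ "\<lambda>_. 1"] by (intro nn_integral_cong) (simp add: SUP_mult_left_ennreal)
  also have "\<dots> = (SUP k. \<integral>\<^sup>+\<omega>. ennreal (density_at \<omega> T) * (\<integral>\<^sup>+z. Hk k ((\<omega>, fst z), snd z) \<partial>m \<omega>) \<partial>M)"
    using m_meas[OF Hk] Hk_mono
    by (intro nn_integral_monotone_convergence_SUP) (auto simp: incseq_def le_fun_def intro!: mult_left_mono nn_integral_mono)
  also have "\<dots> = (SUP k. \<integral>\<^sup>+\<omega>. \<integral>\<^sup>+z. Hk k ((\<omega>, fst z), snd z) * F ((\<omega>, fst z), snd z) \<partial>m \<omega> \<partial>M)"
    unfolding bnd ..
  also have "\<dots> = (\<integral>\<^sup>+\<omega>. (SUP k. \<integral>\<^sup>+z. Hk k ((\<omega>, fst z), snd z) * F ((\<omega>, fst z), snd z) \<partial>m \<omega>) \<partial>M)"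
    using m_meas[OF HkF] Hk_mono
    by (intro nn_integral_monotone_convergence_SUP[symmetric]) (auto simp: incseq_def le_fun_def intro!: mult_right_mono nn_integral_mono)
  also have "\<dots> = (\<integral>\<^sup>+\<omega>. \<integral>\<^sup>+z. H ((\<omega>, fst z), snd z) * F ((\<omega>, fst z), snd z) \<partial>m \<omega> \<partial>M)"
    using sup_int[OF _ F] by (intro nn_integral_cong) simp
  finally show ?thesis .
qed

text \<open>
  The two differ at the finitely many jump times only, and \<open>dA\<close> has no atoms.
\<close>

lemma density_at_eq_before:
  assumes \<omega>: "\<omega> \<in> space M"
  shows "AE z in \<nu> \<omega>. density_at \<omega> (fst z) = density_before \<omega> (fst z)"
proof -
  have "AE t in dA \<omega>. t \<notin> (\<lambda>n. time n \<omega>) ` jumps \<omega>"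
    by (rule AE_dA_not_finite[OF \<omega>]) (use finite_jumps[OF \<omega>] in simp)
  then have "AE t in dA \<omega>. density_at \<omega> t = density_before \<omega> t"
  proof eventually_elim
    fix t assume "t \<notin> (\<lambda>n. time n \<omega>) ` jumps \<omega>"
    then have "{n \<in> jumps \<omega>. time n \<omega> \<le> t} = {n \<in> jumps \<omega>. time n \<omega> < t}" by (auto simp: order.order_iff_strict)
    then show "density_at \<omega> t = density_before \<omega> t" by (simp add: density_at_def density_before_def jump_prod_def)
  qed
  then show ?thesis by (rule AE_\<nu>_time[OF \<omega>])
qed

lemma density_at_jump:
  assumes \<omega>: "\<omega> \<in> space M" and n: "n \<in> jumps \<omega>"
  shows "density_at \<omega> (time n \<omega>) = density_before \<omega> (time n \<omega>) * rate \<omega> (time n \<omega>, X n \<omega>)"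
proof -
  have "{m \<in> jumps \<omega>. time m \<omega> \<le> time n \<omega>} = insert n {m \<in> jumps \<omega>. time m \<omega> < time n \<omega>}"
  proof -
    have "time m \<omega> \<le> time n \<omega> \<longleftrightarrow> m = n \<or> time m \<omega> < time n \<omega>" if "m \<in> jumps \<omega>" for m
      using time_strict[OF \<omega> n that] time_strict[OF \<omega> that n] by linarith
    then show ?thesis using n by blast
  qed
  then show ?thesis using finite_jumps[OF \<omega>]
    by (simp add: density_at_def density_before_def jump_prod_def)
qed

lemma density_before_predictable [measurable]:
  "(\<lambda>y::('a \<times> real) \<times> 'e. density_before (fst (fst y)) (snd (fst y))) \<in> borel_measurable (predictable_sigma \<Otimes>\<^sub>M borel)"
  by (rule measurable_compose[OF measurable_fst density_before_measurable])

theorem change_of_intensity_\<nu>: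
  assumes H: "H \<in> predictable_sigma \<Otimes>\<^sub>M borel \<rightarrow>\<^sub>M (borel :: ennreal measure)"
  shows "(\<integral>\<^sup>+\<omega>. ennreal (density_at \<omega> T) * (\<integral>\<^sup>+z. H ((\<omega>, fst z), snd z) \<partial>\<nu> \<omega>) \<partial>M)
    = (\<integral>\<^sup>+\<omega>. \<integral>\<^sup>+z. H ((\<omega>, fst z), snd z) * ennreal (density_before \<omega> (fst z)) \<partial>\<nu> \<omega> \<partial>M)"
proof -
  let ?F = "\<lambda>y::('a \<times> real) \<times> 'e. ennreal (density_before (fst (fst y)) (snd (fst y)))"
  have F: "?F \<in> borel_measurable (predictable_sigma \<Otimes>\<^sub>M borel)" by measurable
  have eq: "AE z in \<nu> \<omega>. ennreal (density_at \<omega> (fst z)) = ?F ((\<omega>, fst z), snd z)" if \<omega>: "\<omega> \<in> space M" for \<omega>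
    using density_at_eq_before[OF \<omega>] by eventually_elim simp
  have "(\<integral>\<^sup>+\<omega>. ennreal (density_at \<omega> T) * (\<integral>\<^sup>+z. H ((\<omega>, fst z), snd z) \<partial>\<nu> \<omega>) \<partial>M)
    = (\<integral>\<^sup>+\<omega>. \<integral>\<^sup>+z. H ((\<omega>, fst z), snd z) * ?F ((\<omega>, fst z), snd z) \<partial>\<nu> \<omega> \<partial>M)"
    by (rule change_of_intensity[of \<nu>, OF finite_measure_\<nu> sets_\<nu> predictable_integral_\<nu> measurable_nn_integral_\<nu> low_activity_bound_\<nu> F eq H])
  then show ?thesis by simp
qed

text \<open>
  At a jump the density is its left limit times \<open>\<rho>\<close>.  This value is predictable, so the compensator
  formula replaces \<open>\<mu>\<close> by \<open>\<nu>\<close>, and the factor \<open>\<rho>\<close> remains.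
\<close>

theorem change_of_intensity_\<mu>:
  assumes H: "H \<in> predictable_sigma \<Otimes>\<^sub>M borel \<rightarrow>\<^sub>M (borel :: ennreal measure)"
  shows "(\<integral>\<^sup>+\<omega>. ennreal (density_at \<omega> T) * (\<integral>\<^sup>+z. H ((\<omega>, fst z), snd z) \<partial>\<mu> \<omega>) \<partial>M)
    = (\<integral>\<^sup>+\<omega>. \<integral>\<^sup>+z. H ((\<omega>, fst z), snd z) * ennreal (density_before \<omega> (fst z) * rate \<omega> z) \<partial>\<nu> \<omega> \<partial>M)"
proof -
  let ?F = "\<lambda>y. ennreal (density_before (fst (fst y)) (snd (fst y)) * \<rho> y)"
  have F: "?F \<in> borel_measurable (predictable_sigma \<Otimes>\<^sub>M borel)" by measurable
  have eq: "AE z in \<mu> \<omega>. ennreal (density_at \<omega> (fst z)) = ?F ((\<omega>, fst z), snd z)" if \<omega>: "\<omega> \<in> space M" for \<omega>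
  proof -
    note [measurable] = rate_measurable[OF \<omega>] density_before_mark_measurable[OF \<omega>] density_at_mark_measurable[OF \<omega>]
    have "AE z in \<mu> \<omega>. density_at \<omega> (fst z) = density_before \<omega> (fst z) * rate \<omega> z"
      using density_at_jump[OF \<omega>] by (subst AE_\<mu>[OF \<omega>]) auto
    then show ?thesis by eventually_elim (simp add: rate_def)
  qed
  have "(\<integral>\<^sup>+\<omega>. ennreal (density_at \<omega> T) * (\<integral>\<^sup>+z. H ((\<omega>, fst z), snd z) \<partial>\<mu> \<omega>) \<partial>M)
    = (\<integral>\<^sup>+\<omega>. \<integral>\<^sup>+z. H ((\<omega>, fst z), snd z) * ?F ((\<omega>, fst z), snd z) \<partial>\<mu> \<omega> \<partial>M)"
    by (rule change_of_intensity[of \<mu>, OF finite_measure_\<mu> sets_\<mu> predictable_integral_\<mu> measurable_nn_integral_\<mu> low_activity_bound_\<mu> F eq H])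
  also have "\<dots> = (\<integral>\<^sup>+\<omega>. \<integral>\<^sup>+z. H ((\<omega>, fst z), snd z) * ?F ((\<omega>, fst z), snd z) \<partial>\<nu> \<omega> \<partial>M)"
    using compensator_pair[of "\<lambda>y. H y * ?F y"] H F by simp
  finally show ?thesis by (simp add: rate_def)
qed

text \<open>
  The mean of \<open>density_increment\<close> at \<open>t = 0\<close>: the stochastic integrals with respect to \<open>\<mu>\<close> and \<open>\<nu>\<close> have equal
  means, which are finite because the density is dominated by the integrable exponential weight.
\<close>

theorem density_mean: "(\<integral>\<^sup>+\<omega>. ennreal (density_at \<omega> T) \<partial>M) = 1"
proof -
  let ?D = "\<lambda>y::('a \<times> real) \<times> 'e. ennreal (density_before (fst (fst y)) (snd (fst y)))"
  let ?R = "\<lambda>y. ennreal (density_before (fst (fst y)) (snd (fst y)) * \<rho> y)"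
  have D: "?D \<in> borel_measurable (predictable_sigma \<Otimes>\<^sub>M borel)" and R: "?R \<in> borel_measurable (predictable_sigma \<Otimes>\<^sub>M borel)"
    by measurable
  define a b where "a m \<omega> = (\<integral>\<^sup>+z. ?D ((\<omega>, fst z), snd z) \<partial>m \<omega>)"
    and "b m \<omega> = (\<integral>\<^sup>+z. ?R ((\<omega>, fst z), snd z) \<partial>m \<omega>)" for m :: "'a \<Rightarrow> (real \<times> 'e) measure" and \<omega>
  have [measurable]: "a \<mu> \<in> borel_measurable M" "b \<mu> \<in> borel_measurable M" "a \<nu> \<in> borel_measurable M" "b \<nu> \<in> borel_measurable M"
    unfolding a_def[abs_def] b_def[abs_def]
    by (rule measurable_nn_integral_\<mu>[OF D] measurable_nn_integral_\<mu>[OF R] measurable_nn_integral_\<nu>[OF D] measurable_nn_integral_\<nu>[OF R])+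
  have path: "ennreal (density_at \<omega> T) + a \<mu> \<omega> + b \<nu> \<omega> = 1 + b \<mu> \<omega> + a \<nu> \<omega>" if \<omega>: "\<omega> \<in> space M" for \<omega>
  proof -
    have "AE z in \<nu> \<omega>. fst z \<noteq> 0" by (rule AE_\<nu>_time[OF \<omega> AE_dA_neq[OF \<omega>]])
    then have nu: "AE z in \<nu> \<omega>. 0 < fst z" using AE_space[of "\<nu> \<omega>"] by eventually_elim (auto simp: space_\<nu>[OF \<omega>])
    have mu: "AE z in \<mu> \<omega>. 0 < fst z" using time_jumps(1)[OF \<omega>] by (subst AE_\<mu>[OF \<omega>]) auto
    have eqs: "(\<integral>\<^sup>+y. (if 0 < fst y then f y else 0) \<partial>\<mu> \<omega>) = (\<integral>\<^sup>+y. f y \<partial>\<mu> \<omega>)"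
      "(\<integral>\<^sup>+y. (if 0 < fst y then f y else 0) \<partial>\<nu> \<omega>) = (\<integral>\<^sup>+y. f y \<partial>\<nu> \<omega>)" for f :: "real \<times> 'e \<Rightarrow> ennreal"
      using mu nu by (auto intro!: nn_integral_cong_AE elim!: eventually_mono)
    have "{n \<in> jumps \<omega>. time n \<omega> \<le> 0} = {}" using time_jumps(1)[OF \<omega>] by force
    then have "density_at \<omega> 0 = 1" unfolding density_at_def log_density_def by (simp only: cumul_0) simp
    then show ?thesis
      using density_increment[OF \<omega>, of 0] T_pos unfolding eqs by (simp add: rate_def a_def b_def)
  qed
  have fa: "(\<integral>\<^sup>+\<omega>. a \<nu> \<omega> \<partial>M) < \<infinity>" using density_before_nn_integral_finite by (simp add: a_def)
  have fb: "(\<integral>\<^sup>+\<omega>. b \<nu> \<omega> \<partial>M) < \<infinity>"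
  proof -
    have "(\<integral>\<^sup>+\<omega>. b \<nu> \<omega> \<partial>M) \<le> (\<integral>\<^sup>+\<omega>. ennreal C * a \<nu> \<omega> \<partial>M)"
    proof (rule nn_integral_mono)
      fix \<omega> assume \<omega>: "\<omega> \<in> space M"
      have "b \<nu> \<omega> \<le> (\<integral>\<^sup>+z. ennreal C * ?D ((\<omega>, fst z), snd z) \<partial>\<nu> \<omega>)"
        unfolding b_def
      proof (rule nn_integral_mono)
        fix z assume z: "z \<in> space (\<nu> \<omega>)"
        then have "z \<in> {0..T} \<times> UNIV" by (simp add: space_\<nu>[OF \<omega>])
        from rate_bounds[OF \<omega> this] density_before_nonneg[OF \<omega>, of "fst z"] C_pos
        show "?R ((\<omega>, fst z), snd z) \<le> ennreal C * ?D ((\<omega>, fst z), snd z)"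
          by (auto simp: ennreal_mult[symmetric] rate_def mult.commute intro!: ennreal_leI mult_right_mono)
      qed
      also have "\<dots> = ennreal C * a \<nu> \<omega>"
        unfolding a_def using measurable_mark_section[OF \<omega> D] by (intro nn_integral_cmult) (simp add: measurable_cong_sets[OF sets_\<nu>[OF \<omega>] refl])
      finally show "b \<nu> \<omega> \<le> ennreal C * a \<nu> \<omega>" .
    qed
    also have "\<dots> = ennreal C * (\<integral>\<^sup>+\<omega>. a \<nu> \<omega> \<partial>M)" by (intro nn_integral_cmult) measurable
    also have "\<dots> < \<infinity>" using fa by (simp add: ennreal_mult_less_top)
    finally show ?thesis .
  qed
  have ca: "(\<integral>\<^sup>+\<omega>. a \<mu> \<omega> \<partial>M) = (\<integral>\<^sup>+\<omega>. a \<nu> \<omega> \<partial>M)" unfolding a_def by (rule compensator_pair[OF D])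
  have cb: "(\<integral>\<^sup>+\<omega>. b \<mu> \<omega> \<partial>M) = (\<integral>\<^sup>+\<omega>. b \<nu> \<omega> \<partial>M)" unfolding b_def by (rule compensator_pair[OF R])
  have "(\<integral>\<^sup>+\<omega>. ennreal (density_at \<omega> T) \<partial>M) + (\<integral>\<^sup>+\<omega>. a \<mu> \<omega> \<partial>M) + (\<integral>\<^sup>+\<omega>. b \<nu> \<omega> \<partial>M)
      = (\<integral>\<^sup>+\<omega>. ennreal (density_at \<omega> T) + a \<mu> \<omega> + b \<nu> \<omega> \<partial>M)" by (simp add: nn_integral_add)
  also have "\<dots> = (\<integral>\<^sup>+\<omega>. 1 + b \<mu> \<omega> + a \<nu> \<omega> \<partial>M)" by (intro nn_integral_cong path)
  also have "\<dots> = 1 + (\<integral>\<^sup>+\<omega>. b \<mu> \<omega> \<partial>M) + (\<integral>\<^sup>+\<omega>. a \<nu> \<omega> \<partial>M)" by (simp add: nn_integral_add emeasure_space_1)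
  finally have "((\<integral>\<^sup>+\<omega>. a \<nu> \<omega> \<partial>M) + (\<integral>\<^sup>+\<omega>. b \<nu> \<omega> \<partial>M)) + (\<integral>\<^sup>+\<omega>. ennreal (density_at \<omega> T) \<partial>M)
     = ((\<integral>\<^sup>+\<omega>. a \<nu> \<omega> \<partial>M) + (\<integral>\<^sup>+\<omega>. b \<nu> \<omega> \<partial>M)) + 1"
    unfolding ca cb by (simp only: ac_simps)
  moreover have "(\<integral>\<^sup>+\<omega>. a \<nu> \<omega> \<partial>M) + (\<integral>\<^sup>+\<omega>. b \<nu> \<omega> \<partial>M) \<noteq> \<infinity>" using fa fb by auto
  ultimately show ?thesis by (simp only: ennreal_add_left_cancel) auto
qed

end

section \<open>Expectations under the changed probability\<close>

text \<open>
  The convention that the integral of a non-integrable function is \<open>0\<close> makes this hold without any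
  integrability, so the integral against a kernel is measurable in the parameter.
\<close>

lemma real_integral_cases:
  fixes f :: "'a \<Rightarrow> real"
  assumes f: "f \<in> borel_measurable M"
  shows "integral\<^sup>L M f = (if (\<integral>\<^sup>+x. ennreal (f x) \<partial>M) < \<infinity> \<and> (\<integral>\<^sup>+x. ennreal (- f x) \<partial>M) < \<infinity>
    then enn2real (\<integral>\<^sup>+x. ennreal (f x) \<partial>M) - enn2real (\<integral>\<^sup>+x. ennreal (- f x) \<partial>M) else 0)"
proof (cases "integrable M f")
  case True
  then show ?thesis using real_lebesgue_integral_def[OF True] by (auto simp: real_integrable_def less_top)
next
  case False
  then show ?thesis using f by (simp add: not_integrable_integral_eq) (auto simp: real_integrable_def less_top)
qed

lemma kernel_integral:
  fixes h :: "'a \<Rightarrow> 'b \<Rightarrow> real"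
  assumes h: "\<And>\<omega>. \<omega> \<in> space P \<Longrightarrow> h \<omega> \<in> borel_measurable (k \<omega>)"
    and [measurable]: "(\<lambda>\<omega>. \<integral>\<^sup>+z. ennreal (h \<omega> z) \<partial>k \<omega>) \<in> borel_measurable P"
      "(\<lambda>\<omega>. \<integral>\<^sup>+z. ennreal (- h \<omega> z) \<partial>k \<omega>) \<in> borel_measurable P"
      "(\<lambda>\<omega>. \<integral>\<^sup>+z. ennreal \<bar>h \<omega> z\<bar> \<partial>k \<omega>) \<in> borel_measurable P"
    and fin: "(\<integral>\<^sup>+\<omega>. \<integral>\<^sup>+z. ennreal \<bar>h \<omega> z\<bar> \<partial>k \<omega> \<partial>P) < \<infinity>"
  shows "AE \<omega> in P. integrable (k \<omega>) (h \<omega>)"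
    and "integrable P (\<lambda>\<omega>. \<integral>z. h \<omega> z \<partial>k \<omega>)"
    and "(\<integral>\<omega>. \<integral>z. h \<omega> z \<partial>k \<omega> \<partial>P) = enn2real (\<integral>\<^sup>+\<omega>. \<integral>\<^sup>+z. ennreal (h \<omega> z) \<partial>k \<omega> \<partial>P)
      - enn2real (\<integral>\<^sup>+\<omega>. \<integral>\<^sup>+z. ennreal (- h \<omega> z) \<partial>k \<omega> \<partial>P)"
proof -
  define a b c where "a \<omega> = (\<integral>\<^sup>+z. ennreal (h \<omega> z) \<partial>k \<omega>)" and "b \<omega> = (\<integral>\<^sup>+z. ennreal (- h \<omega> z) \<partial>k \<omega>)"
    and "c \<omega> = (\<integral>\<^sup>+z. ennreal \<bar>h \<omega> z\<bar> \<partial>k \<omega>)" for \<omega>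
  have [measurable]: "a \<in> borel_measurable P" "b \<in> borel_measurable P" "c \<in> borel_measurable P"
    unfolding a_def[abs_def] b_def[abs_def] c_def[abs_def] by measurable
  have ac: "a \<omega> \<le> c \<omega>" "b \<omega> \<le> c \<omega>" for \<omega>
    unfolding a_def b_def c_def by (auto intro!: nn_integral_mono ennreal_leI)
  have int_c: "(\<integral>\<^sup>+\<omega>. c \<omega> \<partial>P) < \<infinity>" using fin by (simp add: c_def)
  then have c_fin: "AE \<omega> in P. c \<omega> \<noteq> \<infinity>" by (intro nn_integral_PInf_AE) auto
  have int_a: "(\<integral>\<^sup>+\<omega>. a \<omega> \<partial>P) < \<infinity>" "(\<integral>\<^sup>+\<omega>. b \<omega> \<partial>P) < \<infinity>"
    using int_c nn_integral_mono[of P a c] nn_integral_mono[of P b c] ac by (auto intro: le_less_trans)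
  have ab_fin: "AE \<omega> in P. a \<omega> < \<infinity> \<and> b \<omega> < \<infinity>"
    using c_fin
  proof eventually_elim
    fix \<omega> assume "c \<omega> \<noteq> \<infinity>"
    then have "c \<omega> < \<infinity>" by (simp add: less_top)
    then show "a \<omega> < \<infinity> \<and> b \<omega> < \<infinity>" using ac[of \<omega>] by (auto intro: le_less_trans)
  qed
  show "AE \<omega> in P. integrable (k \<omega>) (h \<omega>)"
    using c_fin AE_space[of P]
    by eventually_elim (simp add: integrable_iff_bounded c_def less_top h)
  have eq: "(\<integral>z. h \<omega> z \<partial>k \<omega>) = (if a \<omega> < \<infinity> \<and> b \<omega> < \<infinity> then enn2real (a \<omega>) - enn2real (b \<omega>) else 0)" if "\<omega> \<in> space P" for \<omega>
    using real_integral_cases[OF h[OF that]] unfolding a_def b_def by simp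
  have m: "(\<lambda>\<omega>. \<integral>z. h \<omega> z \<partial>k \<omega>) \<in> borel_measurable P"
    by (subst measurable_cong[OF eq]) auto
  have ae: "AE \<omega> in P. (\<integral>z. h \<omega> z \<partial>k \<omega>) = enn2real (a \<omega>) - enn2real (b \<omega>)"
    using ab_fin AE_space[of P] by eventually_elim (simp add: eq)
  have "AE \<omega> in P. ennreal (enn2real (a \<omega>)) = a \<omega>" "AE \<omega> in P. ennreal (enn2real (b \<omega>)) = b \<omega>"
    using ab_fin by (eventually_elim, simp)+
  then have ea: "(\<integral>\<^sup>+\<omega>. ennreal (enn2real (a \<omega>)) \<partial>P) = (\<integral>\<^sup>+\<omega>. a \<omega> \<partial>P)"
    "(\<integral>\<^sup>+\<omega>. ennreal (enn2real (b \<omega>)) \<partial>P) = (\<integral>\<^sup>+\<omega>. b \<omega> \<partial>P)"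
    by (auto intro: nn_integral_cong_AE)
  have ia: "integrable P (\<lambda>\<omega>. enn2real (a \<omega>))" "integrable P (\<lambda>\<omega>. enn2real (b \<omega>))"
    using int_a ea by (auto intro!: integrableI_nonneg)
  then have i: "integrable P (\<lambda>\<omega>. enn2real (a \<omega>) - enn2real (b \<omega>))" by simp
  show "integrable P (\<lambda>\<omega>. \<integral>z. h \<omega> z \<partial>k \<omega>)"
    using integrable_cong_AE[OF m borel_measurable_integrable[OF i] ae] i by blast
  have "(\<integral>\<omega>. \<integral>z. h \<omega> z \<partial>k \<omega> \<partial>P) = (\<integral>\<omega>. enn2real (a \<omega>) - enn2real (b \<omega>) \<partial>P)"
    by (rule integral_cong_AE[OF m borel_measurable_integrable[OF i] ae])
  also have "\<dots> = (\<integral>\<omega>. enn2real (a \<omega>) \<partial>P) - (\<integral>\<omega>. enn2real (b \<omega>) \<partial>P)" using ia by simp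
  also have "\<dots> = enn2real (\<integral>\<^sup>+\<omega>. a \<omega> \<partial>P) - enn2real (\<integral>\<^sup>+\<omega>. b \<omega> \<partial>P)"
    by (subst (1 2) integral_eq_nn_integral) (auto simp: ea)
  finally show "(\<integral>\<omega>. \<integral>z. h \<omega> z \<partial>k \<omega> \<partial>P) = enn2real (\<integral>\<^sup>+\<omega>. \<integral>\<^sup>+z. ennreal (h \<omega> z) \<partial>k \<omega> \<partial>P)
      - enn2real (\<integral>\<^sup>+\<omega>. \<integral>\<^sup>+z. ennreal (- h \<omega> z) \<partial>k \<omega> \<partial>P)"
    by (simp add: a_def b_def)
qed

text \<open>
  The Hamiltonian along \<open>Z\<close> is only almost everywhere equal to a measurable function; this evaluates its
  integral over the completion.
\<close>

lemma integral_completion_AE: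
  fixes f g :: "'a \<Rightarrow> real"
  assumes g: "g \<in> borel_measurable M" and eq: "AE x in M. f x = g x"
  shows "integral\<^sup>L (completion M) f = integral\<^sup>L M g"
proof -
  have g': "g \<in> borel_measurable (completion M)" by (rule measurable_completion[OF g])
  have "f \<in> borel_measurable (completion M)"
  proof (rule measurableI)
    fix B :: "real set" assume B: "B \<in> sets borel"
    have [measurable]: "Measurable.pred (completion M) (\<lambda>x. f x \<in> B \<and> g x \<notin> B)" "Measurable.pred (completion M) (\<lambda>x. f x \<notin> B \<and> g x \<in> B)"
      using eq by (auto intro!: sets_completion_AE elim!: eventually_mono)
    note [measurable] = g' B
    have "Measurable.pred (completion M) (\<lambda>x. (g x \<in> B \<and> \<not> (f x \<notin> B \<and> g x \<in> B)) \<or> (f x \<in> B \<and> g x \<notin> B))" by measurable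
    also have "(\<lambda>x. (g x \<in> B \<and> \<not> (f x \<notin> B \<and> g x \<in> B)) \<or> (f x \<in> B \<and> g x \<notin> B)) = (\<lambda>x. f x \<in> B)" by auto
    finally show "f -` B \<inter> space (completion M) \<in> sets (completion M)"
      by (simp add: pred_def vimage_def Int_def conj_commute)
  qed simp
  then have "integral\<^sup>L (completion M) f = integral\<^sup>L (completion M) g"
    using g' AE_completion[OF eq] by (intro integral_cong_AE)
  then show ?thesis using integral_completion[OF g] by simp
qed

context continuous_compensator
begin

lemma distr_\<nu>_time: "\<omega> \<in> space M \<Longrightarrow> distr (\<nu> \<omega>) (dA \<omega>) fst = dA \<omega>"
proof (rule measure_eqI)
  fix V assume \<omega>: "\<omega> \<in> space M" and "V \<in> sets (distr (\<nu> \<omega>) (dA \<omega>) fst)"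
  then have V: "V \<in> sets borel" "V \<subseteq> {0..T}" "V \<in> sets (dA \<omega>)" by (auto simp: sets_dA sets_restrict_space_iff)
  have "fst \<in> \<nu> \<omega> \<rightarrow>\<^sub>M dA \<omega>"
    using measurable_fst by (simp add: measurable_cong_sets[OF sets_\<nu>[OF \<omega>] sets_dA] mark_space_def)
  then have "emeasure (distr (\<nu> \<omega>) (dA \<omega>) fst) V = emeasure (\<nu> \<omega>) (fst -` V \<inter> space (\<nu> \<omega>))" using V by (simp add: emeasure_distr)
  also have "fst -` V \<inter> space (\<nu> \<omega>) = V \<times> UNIV" using V by (auto simp: space_\<nu>[OF \<omega>])
  also have "emeasure (\<nu> \<omega>) (V \<times> UNIV) = emeasure (dA \<omega>) V" by (rule emeasure_\<nu>_times[OF \<omega> V(1,2)])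
  finally show "emeasure (distr (\<nu> \<omega>) (dA \<omega>) fst) V = emeasure (dA \<omega>) V" .
qed simp

lemma integral_\<nu>_time:
  fixes f :: "real \<Rightarrow> real"
  assumes \<omega>: "\<omega> \<in> space M" and f: "f \<in> borel_measurable (dA \<omega>)"
  shows "(\<integral>z. f (fst z) \<partial>\<nu> \<omega>) = (\<integral>t. f t \<partial>dA \<omega>)"
proof -
  have "fst \<in> \<nu> \<omega> \<rightarrow>\<^sub>M dA \<omega>"
    using measurable_fst by (simp add: measurable_cong_sets[OF sets_\<nu>[OF \<omega>] sets_dA] mark_space_def)
  from integral_distr[OF this f] show ?thesis by (simp add: distr_\<nu>_time[OF \<omega>])
qed

lemma mark_integral_measurable:
  assumes \<omega>: "\<omega> \<in> space M" and f: "f \<in> borel_measurable mark_space"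
  shows "(\<lambda>t. \<integral>\<^sup>+x. f (t, x) \<partial>\<phi> \<omega> t) \<in> borel_measurable (dA \<omega>)"
proof (rule nn_integral_measurable_subprob_algebra2)
  show "(\<lambda>t. \<phi> \<omega> t) \<in> dA \<omega> \<rightarrow>\<^sub>M subprob_algebra borel"
    using measurable_path_dA[OF \<omega> \<phi>_measurable] by (simp add: measurable_prob_algebraD)
  show "(\<lambda>(t, x). f (t, x)) \<in> borel_measurable (dA \<omega> \<Otimes>\<^sub>M borel)"
    using f unfolding mark_space_def
    by (simp add: measurable_cong_sets[OF sets_pair_measure_cong[OF sets_dA refl] refl])
qed

lemma integral_\<nu>_disintegrate:
  fixes h :: "real \<times> 'e \<Rightarrow> real"
  assumes \<omega>: "\<omega> \<in> space M" and h: "h \<in> borel_measurable mark_space"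
    and fin: "(\<integral>\<^sup>+z. ennreal \<bar>h z\<bar> \<partial>\<nu> \<omega>) < \<infinity>"
  shows "AE t in dA \<omega>. integrable (\<phi> \<omega> t) (\<lambda>x. h (t, x))"
    and "integrable (dA \<omega>) (\<lambda>t. \<integral>x. h (t, x) \<partial>\<phi> \<omega> t)"
    and "(\<integral>z. h z \<partial>\<nu> \<omega>) = (\<integral>t. \<integral>x. h (t, x) \<partial>\<phi> \<omega> t \<partial>dA \<omega>)"
proof -
  have hx: "(\<lambda>x. h (t, x)) \<in> borel_measurable (\<phi> \<omega> t)" if "t \<in> space (dA \<omega>)" for t
    using measurable_compose[OF measurable_mark_Pair h, of t] that by (simp add: measurable_cong_sets[OF sets_\<phi>[OF \<omega>] refl])
  have hm: "(\<lambda>z. ennreal (h z)) \<in> borel_measurable mark_space" "(\<lambda>z. ennreal (- h z)) \<in> borel_measurable mark_space"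
    "(\<lambda>z. ennreal \<bar>h z\<bar>) \<in> borel_measurable mark_space"
    using h by measurable
  have "(\<integral>\<^sup>+t. \<integral>\<^sup>+x. ennreal \<bar>h (t, x)\<bar> \<partial>\<phi> \<omega> t \<partial>dA \<omega>) < \<infinity>"
    using fin unfolding nn_integral_\<nu>[OF \<omega> hm(3)] .
  note k = kernel_integral[OF hx hm[THEN mark_integral_measurable[OF \<omega>]] this]
  show "AE t in dA \<omega>. integrable (\<phi> \<omega> t) (\<lambda>x. h (t, x))" by (rule k(1))
  show "integrable (dA \<omega>) (\<lambda>t. \<integral>x. h (t, x) \<partial>\<phi> \<omega> t)" by (rule k(2))
  have "integrable (\<nu> \<omega>) h"
    using h fin by (simp add: integrable_iff_bounded measurable_cong_sets[OF sets_\<nu>[OF \<omega>] refl])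
  then have "(\<integral>z. h z \<partial>\<nu> \<omega>) = enn2real (\<integral>\<^sup>+z. ennreal (h z) \<partial>\<nu> \<omega>) - enn2real (\<integral>\<^sup>+z. ennreal (- h z) \<partial>\<nu> \<omega>)"
    by (rule real_lebesgue_integral_def)
  also have "\<dots> = (\<integral>t. \<integral>x. h (t, x) \<partial>\<phi> \<omega> t \<partial>dA \<omega>)"
    unfolding nn_integral_\<nu>[OF \<omega> hm(1)] nn_integral_\<nu>[OF \<omega> hm(2)] by (rule k(3)[symmetric])
  finally show "(\<integral>z. h z \<partial>\<nu> \<omega>) = (\<integral>t. \<integral>x. h (t, x) \<partial>\<phi> \<omega> t \<partial>dA \<omega>)" .
qed

end

context intensity_change
begin

text \<open>The probability under which \<open>\<mu>\<close> has the compensator \<open>\<rho> \<nu>\<close>, as \<open>girsanov\<close> states.\<close>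

definition P\<rho> :: "'a measure" where
  "P\<rho> = density M (\<lambda>\<omega>. ennreal (density_at \<omega> T))"

lemma sets_P\<rho> [measurable_cong, simp]: "sets P\<rho> = sets M" and space_P\<rho> [simp]: "space P\<rho> = space M"
  by (simp_all add: P\<rho>_def)

lemma prob_space_P\<rho>: "prob_space P\<rho>"
proof
  have "emeasure P\<rho> (space P\<rho>) = (\<integral>\<^sup>+\<omega>. ennreal (density_at \<omega> T) * indicator (space M) \<omega> \<partial>M)"
    by (simp add: P\<rho>_def emeasure_density)
  also have "\<dots> = (\<integral>\<^sup>+\<omega>. ennreal (density_at \<omega> T) \<partial>M)" by (intro nn_integral_cong) simp
  finally show "emeasure P\<rho> (space P\<rho>) = 1" using density_mean by simp
qed

lemma AE_P\<rho>: "AE \<omega> in M. P \<omega> \<Longrightarrow> AE \<omega> in P\<rho>. P \<omega>"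
  unfolding P\<rho>_def by (subst AE_density) (auto elim: eventually_mono)

lemma nn_integral_P\<rho>: "f \<in> borel_measurable M \<Longrightarrow> (\<integral>\<^sup>+\<omega>. f \<omega> \<partial>P\<rho>) = (\<integral>\<^sup>+\<omega>. ennreal (density_at \<omega> T) * f \<omega> \<partial>M)"
  unfolding P\<rho>_def by (rule nn_integral_density) auto

lemma nn_integral_P\<rho>_\<nu>:
  assumes H: "H \<in> predictable_sigma \<Otimes>\<^sub>M borel \<rightarrow>\<^sub>M (borel :: ennreal measure)"
  shows "(\<integral>\<^sup>+\<omega>. \<integral>\<^sup>+z. H ((\<omega>, fst z), snd z) \<partial>\<nu> \<omega> \<partial>P\<rho>)
    = (\<integral>\<^sup>+\<omega>. \<integral>\<^sup>+z. H ((\<omega>, fst z), snd z) * ennreal (density_before \<omega> (fst z)) \<partial>\<nu> \<omega> \<partial>M)"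
  unfolding nn_integral_P\<rho>[OF measurable_nn_integral_\<nu>[OF H]] by (rule change_of_intensity_\<nu>[OF H])

lemma nn_integral_P\<rho>_\<mu>:
  assumes H: "H \<in> predictable_sigma \<Otimes>\<^sub>M borel \<rightarrow>\<^sub>M (borel :: ennreal measure)"
  shows "(\<integral>\<^sup>+\<omega>. \<integral>\<^sup>+z. H ((\<omega>, fst z), snd z) \<partial>\<mu> \<omega> \<partial>P\<rho>)
    = (\<integral>\<^sup>+\<omega>. \<integral>\<^sup>+z. H ((\<omega>, fst z), snd z) * ennreal (\<rho> ((\<omega>, fst z), snd z)) \<partial>\<nu> \<omega> \<partial>P\<rho>)"
proof -
  have H': "(\<lambda>y. H y * ennreal (\<rho> y)) \<in> borel_measurable (predictable_sigma \<Otimes>\<^sub>M borel)" using H by measurable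
  have "(\<integral>\<^sup>+\<omega>. \<integral>\<^sup>+z. H ((\<omega>, fst z), snd z) \<partial>\<mu> \<omega> \<partial>P\<rho>) 
     = (\<integral>\<^sup>+\<omega>. \<integral>\<^sup>+z. H ((\<omega>, fst z), snd z) * ennreal (density_before \<omega> (fst z) * rate \<omega> z) \<partial>\<nu> \<omega> \<partial>M)"
    unfolding nn_integral_P\<rho>[OF measurable_nn_integral_\<mu>[OF H]] by (rule change_of_intensity_\<mu>[OF H])
  also have "\<dots> = (\<integral>\<^sup>+\<omega>. \<integral>\<^sup>+z. H ((\<omega>, fst z), snd z) * ennreal (\<rho> ((\<omega>, fst z), snd z)) * ennreal (density_before \<omega> (fst z)) \<partial>\<nu> \<omega> \<partial>M)"
  proof (intro nn_integral_cong)
    fix \<omega> z assume \<omega>: "\<omega> \<in> space M" and "z \<in> space (\<nu> \<omega>)"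
    then have "z \<in> {0..T} \<times> UNIV" by (simp add: space_\<nu>)
    from rate_bounds(1)[OF \<omega> this] density_before_nonneg[OF \<omega>, of "fst z"]
    show "H ((\<omega>, fst z), snd z) * ennreal (density_before \<omega> (fst z) * rate \<omega> z) =
      H ((\<omega>, fst z), snd z) * ennreal (\<rho> ((\<omega>, fst z), snd z)) * ennreal (density_before \<omega> (fst z))"
      by (simp add: rate_def ennreal_mult ac_simps)
  qed
  also have "\<dots> = (\<integral>\<^sup>+\<omega>. \<integral>\<^sup>+z. H ((\<omega>, fst z), snd z) * ennreal (\<rho> ((\<omega>, fst z), snd z)) \<partial>\<nu> \<omega> \<partial>P\<rho>)"
    by (rule nn_integral_P\<rho>_\<nu>[OF H', symmetric])
  finally show ?thesis .
qed

lemma expectation_kernel_integral: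
  fixes m :: "'a \<Rightarrow> (real \<times> 'e) measure" and h :: "('a \<times> real) \<times> 'e \<Rightarrow> real"
  assumes m_sets: "\<And>\<omega>. \<omega> \<in> space M \<Longrightarrow> sets (m \<omega>) = sets mark_space"
    and m_meas: "\<And>H. H \<in> predictable_sigma \<Otimes>\<^sub>M borel \<rightarrow>\<^sub>M (borel :: ennreal measure) \<Longrightarrow>
      (\<lambda>\<omega>. \<integral>\<^sup>+z. H ((\<omega>, fst z), snd z) \<partial>m \<omega>) \<in> borel_measurable M"
    and h: "h \<in> borel_measurable (predictable_sigma \<Otimes>\<^sub>M borel)"
    and fin: "(\<integral>\<^sup>+\<omega>. \<integral>\<^sup>+z. ennreal \<bar>h ((\<omega>, fst z), snd z)\<bar> \<partial>m \<omega> \<partial>P\<rho>) < \<infinity>"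
  shows "integrable P\<rho> (\<lambda>\<omega>. \<integral>z. h ((\<omega>, fst z), snd z) \<partial>m \<omega>)"
    and "(\<integral>\<omega>. \<integral>z. h ((\<omega>, fst z), snd z) \<partial>m \<omega> \<partial>P\<rho>) = 
      enn2real (\<integral>\<^sup>+\<omega>. \<integral>\<^sup>+z. ennreal (h ((\<omega>, fst z), snd z)) \<partial>m \<omega> \<partial>P\<rho>) - enn2real (\<integral>\<^sup>+\<omega>. \<integral>\<^sup>+z. ennreal (- h ((\<omega>, fst z), snd z)) \<partial>m \<omega> \<partial>P\<rho>)"
proof -
  have hm: "(\<lambda>y. ennreal (h y)) \<in> borel_measurable (predictable_sigma \<Otimes>\<^sub>M borel)" "(\<lambda>y. ennreal (- h y)) \<in> borel_measurable (predictable_sigma \<Otimes>\<^sub>M borel)"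
    "(\<lambda>y. ennreal \<bar>h y\<bar>) \<in> borel_measurable (predictable_sigma \<Otimes>\<^sub>M borel)"
    using h by measurable
  have hx: "(\<lambda>z. h ((\<omega>, fst z), snd z)) \<in> borel_measurable (m \<omega>)" if "\<omega> \<in> space P\<rho>" for \<omega>
    using that measurable_mark_section[of \<omega>, OF _ h] by (simp add: measurable_cong_sets[OF m_sets refl])
  have meas: "(\<lambda>\<omega>. \<integral>\<^sup>+z. H ((\<omega>, fst z), snd z) \<partial>m \<omega>) \<in> borel_measurable P\<rho>"
    if "H \<in> predictable_sigma \<Otimes>\<^sub>M borel \<rightarrow>\<^sub>M (borel :: ennreal measure)" for H
    using m_meas[OF that] by simp
  note k = kernel_integral[where k=m, OF hx hm[THEN meas] fin]
  show "integrable P\<rho> (\<lambda>\<omega>. \<integral>z. h ((\<omega>, fst z), snd z) \<partial>m \<omega>)" by (rule k(2))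
  show "(\<integral>\<omega>. \<integral>z. h ((\<omega>, fst z), snd z) \<partial>m \<omega> \<partial>P\<rho>) = 
      enn2real (\<integral>\<^sup>+\<omega>. \<integral>\<^sup>+z. ennreal (h ((\<omega>, fst z), snd z)) \<partial>m \<omega> \<partial>P\<rho>) - enn2real (\<integral>\<^sup>+\<omega>. \<integral>\<^sup>+z. ennreal (- h ((\<omega>, fst z), snd z)) \<partial>m \<omega> \<partial>P\<rho>)"
    by (rule k(3))
qed

theorem girsanov:
  fixes h :: "('a \<times> real) \<times> 'e \<Rightarrow> real"
  assumes h: "h \<in> borel_measurable (predictable_sigma \<Otimes>\<^sub>M borel)"
    and fin: "(\<integral>\<^sup>+\<omega>. \<integral>\<^sup>+z. ennreal \<bar>h ((\<omega>, fst z), snd z)\<bar> \<partial>\<nu> \<omega> \<partial>P\<rho>) < \<infinity>"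
  shows "integrable P\<rho> (\<lambda>\<omega>. \<integral>z. h ((\<omega>, fst z), snd z) \<partial>\<mu> \<omega>)"
    and "integrable P\<rho> (\<lambda>\<omega>. \<integral>z. h ((\<omega>, fst z), snd z) * \<rho> ((\<omega>, fst z), snd z) \<partial>\<nu> \<omega>)"
    and "(\<integral>\<omega>. \<integral>z. h ((\<omega>, fst z), snd z) \<partial>\<mu> \<omega> \<partial>P\<rho>) = (\<integral>\<omega>. \<integral>z. h ((\<omega>, fst z), snd z) * \<rho> ((\<omega>, fst z), snd z) \<partial>\<nu> \<omega> \<partial>P\<rho>)"
proof -
  note [measurable] = h
  have h\<rho>: "(\<lambda>y. h y * \<rho> y) \<in> borel_measurable (predictable_sigma \<Otimes>\<^sub>M borel)" by measurable
  have \<rho>: "0 \<le> \<rho> ((\<omega>, fst z), snd z)" "\<rho> ((\<omega>, fst z), snd z) \<le> C" if "\<omega> \<in> space M" "z \<in> space (\<nu> \<omega>)" for \<omega> z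
    using rate_bounds[of \<omega> z] that by (auto simp: space_\<nu> rate_def)
  have mult: "(\<integral>\<^sup>+\<omega>. \<integral>\<^sup>+z. ennreal (g ((\<omega>, fst z), snd z)) * ennreal (\<rho> ((\<omega>, fst z), snd z)) \<partial>\<nu> \<omega> \<partial>P\<rho>) =
      (\<integral>\<^sup>+\<omega>. \<integral>\<^sup>+z. ennreal (g ((\<omega>, fst z), snd z) * \<rho> ((\<omega>, fst z), snd z)) \<partial>\<nu> \<omega> \<partial>P\<rho>)" for g :: "('a \<times> real) \<times> 'e \<Rightarrow> real"
    using \<rho> by (intro nn_integral_cong) (simp add: ennreal_mult'')
  have fin\<rho>: "(\<integral>\<^sup>+\<omega>. \<integral>\<^sup>+z. ennreal \<bar>h ((\<omega>, fst z), snd z) * \<rho> ((\<omega>, fst z), snd z)\<bar> \<partial>\<nu> \<omega> \<partial>P\<rho>) < \<infinity>"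
  proof -
    have ha: "(\<lambda>y. ennreal \<bar>h y\<bar>) \<in> borel_measurable (predictable_sigma \<Otimes>\<^sub>M borel)" by measurable
    have "(\<integral>\<^sup>+\<omega>. \<integral>\<^sup>+z. ennreal \<bar>h ((\<omega>, fst z), snd z) * \<rho> ((\<omega>, fst z), snd z)\<bar> \<partial>\<nu> \<omega> \<partial>P\<rho>)
      \<le> (\<integral>\<^sup>+\<omega>. \<integral>\<^sup>+z. ennreal C * ennreal \<bar>h ((\<omega>, fst z), snd z)\<bar> \<partial>\<nu> \<omega> \<partial>P\<rho>)"
      using \<rho> C_pos by (intro nn_integral_mono) (auto simp: abs_mult ennreal_mult[symmetric] mult.commute intro!: ennreal_leI mult_right_mono)
    also have "\<dots> = (\<integral>\<^sup>+\<omega>. ennreal C * (\<integral>\<^sup>+z. ennreal \<bar>h ((\<omega>, fst z), snd z)\<bar> \<partial>\<nu> \<omega>) \<partial>P\<rho>)"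
      using measurable_mark_section[OF _ ha]
      by (intro nn_integral_cong nn_integral_cmult) (auto simp: measurable_cong_sets[OF sets_\<nu> refl])
    also have "\<dots> = ennreal C * (\<integral>\<^sup>+\<omega>. \<integral>\<^sup>+z. ennreal \<bar>h ((\<omega>, fst z), snd z)\<bar> \<partial>\<nu> \<omega> \<partial>P\<rho>)"
      using measurable_nn_integral_\<nu>[OF ha] by (intro nn_integral_cmult) simp
    also have "\<dots> < \<infinity>" using fin by (simp add: ennreal_mult_less_top)
    finally show ?thesis .
  qed
  have fin\<mu>: "(\<integral>\<^sup>+\<omega>. \<integral>\<^sup>+z. ennreal \<bar>h ((\<omega>, fst z), snd z)\<bar> \<partial>\<mu> \<omega> \<partial>P\<rho>) < \<infinity>"
  proof -
    have "(\<integral>\<^sup>+\<omega>. \<integral>\<^sup>+z. ennreal \<bar>h ((\<omega>, fst z), snd z)\<bar> \<partial>\<mu> \<omega> \<partial>P\<rho>) = (\<integral>\<^sup>+\<omega>. \<integral>\<^sup>+z. ennreal (\<bar>h ((\<omega>, fst z), snd z)\<bar> * \<rho> ((\<omega>, fst z), snd z)) \<partial>\<nu> \<omega> \<partial>P\<rho>)"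
      using nn_integral_P\<rho>_\<mu>[of "\<lambda>y. ennreal \<bar>h y\<bar>"] mult[of "\<lambda>y. \<bar>h y\<bar>"] by simp
    also have "\<dots> = (\<integral>\<^sup>+\<omega>. \<integral>\<^sup>+z. ennreal \<bar>h ((\<omega>, fst z), snd z) * \<rho> ((\<omega>, fst z), snd z)\<bar> \<partial>\<nu> \<omega> \<partial>P\<rho>)"
      using \<rho> by (intro nn_integral_cong) (simp add: abs_mult)
    finally show ?thesis using fin\<rho> by simp
  qed
  note mu = expectation_kernel_integral[OF sets_\<mu> measurable_nn_integral_\<mu> h fin\<mu>]
  note nu = expectation_kernel_integral[OF sets_\<nu> measurable_nn_integral_\<nu> h\<rho> fin\<rho>]
  show "integrable P\<rho> (\<lambda>\<omega>. \<integral>z. h ((\<omega>, fst z), snd z) \<partial>\<mu> \<omega>)" by (rule mu(1))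
  show "integrable P\<rho> (\<lambda>\<omega>. \<integral>z. h ((\<omega>, fst z), snd z) * \<rho> ((\<omega>, fst z), snd z) \<partial>\<nu> \<omega>)" by (rule nu(1))
  have "(\<integral>\<^sup>+\<omega>. \<integral>\<^sup>+z. ennreal (h ((\<omega>, fst z), snd z)) \<partial>\<mu> \<omega> \<partial>P\<rho>) = (\<integral>\<^sup>+\<omega>. \<integral>\<^sup>+z. ennreal (h ((\<omega>, fst z), snd z) * \<rho> ((\<omega>, fst z), snd z)) \<partial>\<nu> \<omega> \<partial>P\<rho>)"
    using nn_integral_P\<rho>_\<mu>[of "\<lambda>y. ennreal (h y)"] mult[of h] by simp
  moreover have "(\<integral>\<^sup>+\<omega>. \<integral>\<^sup>+z. ennreal (- h ((\<omega>, fst z), snd z)) \<partial>\<mu> \<omega> \<partial>P\<rho>) = (\<integral>\<^sup>+\<omega>. \<integral>\<^sup>+z. ennreal (- (h ((\<omega>, fst z), snd z) * \<rho> ((\<omega>, fst z), snd z))) \<partial>\<nu> \<omega> \<partial>P\<rho>)"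
    using nn_integral_P\<rho>_\<mu>[of "\<lambda>y. ennreal (- h y)"] mult[of "\<lambda>y. - h y"] by simp
  moreover have "(\<integral>\<omega>. \<integral>z. h ((\<omega>, fst z), snd z) \<partial>\<mu> \<omega> \<partial>P\<rho>) = 
      enn2real (\<integral>\<^sup>+\<omega>. \<integral>\<^sup>+z. ennreal (h ((\<omega>, fst z), snd z)) \<partial>\<mu> \<omega> \<partial>P\<rho>) - enn2real (\<integral>\<^sup>+\<omega>. \<integral>\<^sup>+z. ennreal (- h ((\<omega>, fst z), snd z)) \<partial>\<mu> \<omega> \<partial>P\<rho>)"
    by (rule mu(2))
  moreover have "(\<integral>\<omega>. \<integral>z. h ((\<omega>, fst z), snd z) * \<rho> ((\<omega>, fst z), snd z) \<partial>\<nu> \<omega> \<partial>P\<rho>) = 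
      enn2real (\<integral>\<^sup>+\<omega>. \<integral>\<^sup>+z. ennreal (h ((\<omega>, fst z), snd z) * \<rho> ((\<omega>, fst z), snd z)) \<partial>\<nu> \<omega> \<partial>P\<rho>) -
      enn2real (\<integral>\<^sup>+\<omega>. \<integral>\<^sup>+z. ennreal (- (h ((\<omega>, fst z), snd z) * \<rho> ((\<omega>, fst z), snd z))) \<partial>\<nu> \<omega> \<partial>P\<rho>)"
    by (rule nu(2))
  ultimately show "(\<integral>\<omega>. \<integral>z. h ((\<omega>, fst z), snd z) \<partial>\<mu> \<omega> \<partial>P\<rho>) = (\<integral>\<omega>. \<integral>z. h ((\<omega>, fst z), snd z) * \<rho> ((\<omega>, fst z), snd z) \<partial>\<nu> \<omega> \<partial>P\<rho>)"
    by simp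
qed

end

section \<open>The verification argument\<close>

locale controlled_bsde = control_problem M T \<Delta> S X A \<phi> \<xi> U r l
  for M :: "'a measure" and T and \<Delta> :: "'e :: topological_space" and S X A \<phi> \<xi>
    and U :: "'u measure" and r l +
  fixes C \<alpha> \<beta> :: real and Y :: "'a \<Rightarrow> real \<Rightarrow> real" and Z :: "'a \<Rightarrow> real \<Rightarrow> 'e \<Rightarrow> real"
    and u_star :: "'a \<Rightarrow> real \<Rightarrow> 'u"
  assumes assumption_A: "assumption_A" and assumption_B: "assumption_B C \<alpha> \<beta>"
    and weighted: "(Y, Z) \<in> weighted_L1 \<alpha> \<beta>" and solution: "bsde_solution Y Z"
    and minimizer: "hamiltonian_minimizer Z u_star"
begin

sublocale survival_compensator M T \<Delta> S X A \<phi>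
  using assumption_A by unfold_locales (auto simp: assumption_A_def)

lemma
  shows C_pos: "0 < C" and \<alpha>_ge: "1 \<le> \<alpha>" and \<alpha>_gt: "C < \<alpha>" and \<beta>_gt: "1 + C < \<beta>"
    and r_bounds: "\<And>\<omega> t x u. \<omega> \<in> space M \<Longrightarrow> t \<in> {0..T} \<Longrightarrow> u \<in> space U \<Longrightarrow> 0 \<le> r \<omega> t x u \<and> r \<omega> t x u \<le> C"
    and moment: "(\<integral>\<^sup>+\<omega>. ennreal (exp (A \<omega> T) * C powr N \<omega> T) \<partial>M) < \<infinity>"
  using assumption_B by (auto simp: assumption_B_def)

text \<open>
  Each term of the moment assumption is dominated by the whole sum.  The integrals are lower integrals, and
  monotonicity holds for these without measurability.
\<close>

lemma \<xi>_moment: "(\<integral>\<^sup>+\<omega>. ennreal (exp (\<beta> * A \<omega> T) * \<alpha> powr N \<omega> T * \<bar>\<xi> \<omega>\<bar>) \<partial>M) < \<infinity>"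
  and l_moment: "(\<integral>\<^sup>+\<omega>. \<integral>\<^sup>+s. ennreal (exp (A \<omega> s) * C powr N \<omega> s) * (SUP u\<in>space U. ennreal \<bar>l \<omega> s u\<bar>) \<partial>dA \<omega> \<partial>M) < \<infinity>"
proof -
  let ?F = "\<lambda>\<omega>. ennreal (exp (\<beta> * A \<omega> T) * \<alpha> powr N \<omega> T * \<bar>\<xi> \<omega>\<bar>)
        + (\<integral>\<^sup>+s. ennreal (exp (\<beta> * A \<omega> s) * \<alpha> powr N \<omega> s) * e2ennreal \<bar>INF u\<in>space U. ereal (l \<omega> s u)\<bar> \<partial>dA \<omega>)
        + (\<integral>\<^sup>+s. ennreal (exp (A \<omega> s) * C powr N \<omega> s) * (SUP u\<in>space U. ennreal \<bar>l \<omega> s u\<bar>) \<partial>dA \<omega>)"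
  have fin: "(\<integral>\<^sup>+\<omega>. ?F \<omega> \<partial>M) < \<infinity>" using assumption_B unfolding assumption_B_def by blast
  have "(\<integral>\<^sup>+\<omega>. ennreal (exp (\<beta> * A \<omega> T) * \<alpha> powr N \<omega> T * \<bar>\<xi> \<omega>\<bar>) \<partial>M) \<le> (\<integral>\<^sup>+\<omega>. ?F \<omega> \<partial>M)"
    by (intro nn_integral_mono) (simp add: add.assoc)
  then show "(\<integral>\<^sup>+\<omega>. ennreal (exp (\<beta> * A \<omega> T) * \<alpha> powr N \<omega> T * \<bar>\<xi> \<omega>\<bar>) \<partial>M) < \<infinity>" using fin by (rule le_less_trans)
  have "(\<integral>\<^sup>+\<omega>. \<integral>\<^sup>+s. ennreal (exp (A \<omega> s) * C powr N \<omega> s) * (SUP u\<in>space U. ennreal \<bar>l \<omega> s u\<bar>) \<partial>dA \<omega> \<partial>M) \<le> (\<integral>\<^sup>+\<omega>. ?F \<omega> \<partial>M)"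
    by (intro nn_integral_mono) simp
  then show "(\<integral>\<^sup>+\<omega>. \<integral>\<^sup>+s. ennreal (exp (A \<omega> s) * C powr N \<omega> s) * (SUP u\<in>space U. ennreal \<bar>l \<omega> s u\<bar>) \<partial>dA \<omega> \<partial>M) < \<infinity>"
    using fin by (rule le_less_trans)
qed

lemma Z_moment: "(\<integral>\<^sup>+\<omega>. \<integral>\<^sup>+z. ennreal (\<bar>Z \<omega> (fst z) (snd z)\<bar> * exp (\<beta> * A \<omega> (fst z)) * \<alpha> powr N \<omega> (fst z)) \<partial>\<nu> \<omega> \<partial>M) < \<infinity>"
proof -
  have fin: "(\<integral>\<^sup>+\<omega>. (\<integral>\<^sup>+(t, x). ennreal ((\<bar>Y \<omega> t\<bar> + \<bar>Z \<omega> t x\<bar>) * exp (\<beta> * A \<omega> t) * \<alpha> powr N \<omega> t) \<partial>\<nu> \<omega>) \<partial>M) < \<infinity>"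
    using weighted by (auto simp: weighted_L1_def)
  have "(\<integral>\<^sup>+\<omega>. \<integral>\<^sup>+z. ennreal (\<bar>Z \<omega> (fst z) (snd z)\<bar> * exp (\<beta> * A \<omega> (fst z)) * \<alpha> powr N \<omega> (fst z)) \<partial>\<nu> \<omega> \<partial>M)
     \<le> (\<integral>\<^sup>+\<omega>. (\<integral>\<^sup>+(t, x). ennreal ((\<bar>Y \<omega> t\<bar> + \<bar>Z \<omega> t x\<bar>) * exp (\<beta> * A \<omega> t) * \<alpha> powr N \<omega> t) \<partial>\<nu> \<omega>) \<partial>M)"
    by (intro nn_integral_mono) (auto simp: split_beta' intro!: ennreal_leI mult_right_mono)
  then show ?thesis using fin by (rule le_less_trans)
qed

lemma Z_measurable [measurable]: "(\<lambda>y. Z (fst (fst y)) (snd (fst y)) (snd y)) \<in> borel_measurable (predictable_sigma \<Otimes>\<^sub>M borel)"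
  using weighted by (auto simp: weighted_L1_def predictable_function_def split_beta')

lemma admissible_measurable: "v \<in> admissible \<Longrightarrow> (\<lambda>z. v (fst z) (snd z)) \<in> predictable_sigma \<rightarrow>\<^sub>M U"
  by (simp add: admissible_def predictable_process_def split_beta')

lemma admissible_space: "v \<in> admissible \<Longrightarrow> \<omega> \<in> space M \<Longrightarrow> t \<in> {0..T} \<Longrightarrow> v \<omega> t \<in> space U"
  using measurable_space[OF admissible_measurable, of v "(\<omega>, t)"] by simp

definition running :: "('a \<Rightarrow> real \<Rightarrow> 'u) \<Rightarrow> 'a \<times> real \<Rightarrow> real" where
  "running v z = l (fst z) (snd z) (v (fst z) (snd z))"

definition ctrl_rate :: "('a \<Rightarrow> real \<Rightarrow> 'u) \<Rightarrow> ('a \<times> real) \<times> 'e \<Rightarrow> real" where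
  "ctrl_rate v y = r (fst (fst y)) (snd (fst y)) (snd y) (v (fst (fst y)) (snd (fst y)))"

lemma running_measurable:
  assumes "v \<in> admissible"
  shows "running v \<in> borel_measurable predictable_sigma"
proof -
  have l: "(\<lambda>y. l (fst (fst y)) (snd (fst y)) (snd y)) \<in> borel_measurable (predictable_sigma \<Otimes>\<^sub>M U)"
    using l_predictable by (simp add: predictable_function_def split_beta')
  have "(\<lambda>z. (z, v (fst z) (snd z))) \<in> predictable_sigma \<rightarrow>\<^sub>M predictable_sigma \<Otimes>\<^sub>M U"
    using admissible_measurable[OF assms] by simp
  from measurable_compose[OF this l] show ?thesis by (simp add: running_def[abs_def])
qed

lemma ctrl_rate_measurable:
  assumes "v \<in> admissible"
  shows "ctrl_rate v \<in> borel_measurable (predictable_sigma \<Otimes>\<^sub>M borel)"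
proof -
  have r: "(\<lambda>y. r (fst (fst y)) (snd (fst y)) (fst (snd y)) (snd (snd y))) \<in> borel_measurable (predictable_sigma \<Otimes>\<^sub>M (borel \<Otimes>\<^sub>M U))"
    using r_predictable by (simp add: predictable_function_def split_beta')
  have "(\<lambda>y. (fst y, (snd y, v (fst (fst y)) (snd (fst y))))) \<in> predictable_sigma \<Otimes>\<^sub>M (borel :: 'e measure) \<rightarrow>\<^sub>M predictable_sigma \<Otimes>\<^sub>M (borel \<Otimes>\<^sub>M U)"
    by (intro measurable_Pair measurable_fst measurable_snd measurable_compose[OF measurable_fst admissible_measurable[OF assms]])
  from measurable_compose[OF this r] show ?thesis by (simp add: ctrl_rate_def[abs_def])
qed

lemma N_T: "\<omega> \<in> space M \<Longrightarrow> N \<omega> T = real (card (jumps \<omega>))"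
proof -
  assume \<omega>: "\<omega> \<in> space M"
  have "{n \<in> jumps \<omega>. time n \<omega> \<le> T} = jumps \<omega>" using time_jumps[OF \<omega>] by auto
  then show ?thesis using N_eq_card[OF \<omega>, of T] T_pos by simp
qed

lemma count_before_le_N:
  assumes \<omega>: "\<omega> \<in> space M" and t: "t \<in> {0..T}"
  shows "real (count_before \<omega> t) \<le> N \<omega> t"
  unfolding N_eq_card[OF \<omega> t] count_before_def using finite_jumps[OF \<omega>] by (auto intro!: card_mono)

lemma AE_count_before_eq_N:
  assumes \<omega>: "\<omega> \<in> space M"
  shows "AE t in dA \<omega>. real (count_before \<omega> t) = N \<omega> t"
proof -
  have "AE t in dA \<omega>. t \<notin> (\<lambda>n. time n \<omega>) ` jumps \<omega>"
    by (rule AE_dA_not_finite[OF \<omega>]) (use finite_jumps[OF \<omega>] in simp)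
  with AE_space[of "dA \<omega>"] show ?thesis
  proof eventually_elim
    fix t assume t: "t \<in> space (dA \<omega>)" "t \<notin> (\<lambda>n. time n \<omega>) ` jumps \<omega>"
    then have "{n \<in> jumps \<omega>. time n \<omega> \<le> t} = {n \<in> jumps \<omega>. time n \<omega> < t}" by (auto simp: order.order_iff_strict)
    then show "real (count_before \<omega> t) = N \<omega> t" using t by (simp add: count_before_def N_eq_card[OF \<omega>])
  qed
qed

lemma Y_0_constant:
  assumes "\<omega> \<in> space M" "\<omega>' \<in> space M"
  shows "Y \<omega> 0 = Y \<omega>' 0"
proof -
  have "\<forall>t\<in>{0..T}. (\<lambda>\<omega>. Y \<omega> t) \<in> borel_measurable (history (ennreal t))"
    using solution by (simp add: bsde_solution_def adapted_process_def)
  from bspec[OF this, of 0] have "(\<lambda>\<omega>. Y \<omega> 0) \<in> borel_measurable (history 0)"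
    using T_pos by simp
  from measurable_sets[OF this, of "{Y \<omega>' 0}"] have "{\<omega> \<in> space M. Y \<omega> 0 = Y \<omega>' 0} \<in> sets (history 0)"
    by (simp add: vimage_def Int_def conj_commute)
  then have "{\<omega> \<in> space M. Y \<omega> 0 = Y \<omega>' 0} = {} \<or> {\<omega> \<in> space M. Y \<omega> 0 = Y \<omega>' 0} = space M" by (rule history_0_trivial)
  then show ?thesis using assms by blast
qed

lemma u_star_admissible: "u_star \<in> admissible"
  using minimizer by (simp add: hamiltonian_minimizer_def)

end

locale admissible_control = controlled_bsde M T \<Delta> S X A \<phi> \<xi> U r l C \<alpha> \<beta> Y Z u_star
  for M :: "'a measure" and T and \<Delta> :: "'e :: topological_space" and S X A \<phi> \<xi>
    and U :: "'u measure" and r l C \<alpha> \<beta> Y Z u_star +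
  fixes u :: "'a \<Rightarrow> real \<Rightarrow> 'u"
  assumes u: "u \<in> admissible"
begin

sublocale intensity_change M T \<Delta> S X A \<phi> "ctrl_rate u" C
proof
  show "ctrl_rate u \<in> borel_measurable (predictable_sigma \<Otimes>\<^sub>M borel)" by (rule ctrl_rate_measurable[OF u])
  show "0 \<le> ctrl_rate u ((\<omega>, t), x)" "ctrl_rate u ((\<omega>, t), x) \<le> C" if "\<omega> \<in> space M" "t \<in> {0..T}" for \<omega> t x
    using r_bounds[OF that admissible_space[OF u that], of x] by (auto simp: ctrl_rate_def)
  have "(\<integral>\<^sup>+\<omega>. ennreal (exp (A \<omega> T) * C ^ card (jumps \<omega>)) \<partial>M) = (\<integral>\<^sup>+\<omega>. ennreal (exp (A \<omega> T) * C powr N \<omega> T) \<partial>M)"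
    using C_pos by (intro nn_integral_cong) (simp add: N_T powr_realpow)
  then show "(\<integral>\<^sup>+\<omega>. ennreal (exp (A \<omega> T) * C ^ card (jumps \<omega>)) \<partial>M) < \<infinity>" using moment by simp
qed (rule C_pos)

lemma controlled_prob_eq: "controlled_prob u = P\<rho>"
proof -
  have "L u \<omega> T = density_at \<omega> T" if \<omega>: "\<omega> \<in> space M" for \<omega>
  proof -
    have "{n \<in> jumps \<omega>. time n \<omega> \<le> T} = {n. 1 \<le> n \<and> S n \<omega> \<le> ennreal T}" using time_jumps[OF \<omega>] by (auto simp: jumps_def)
    then show ?thesis
      by (simp add: L_def density_at_def log_density_def cumul_def rate_def ctrl_rate_def time_def split_beta')
  qed
  then show ?thesis unfolding controlled_prob_def P\<rho>_def density_def
    by (intro measure_of_eq[OF sets.space_closed] nn_integral_cong) (auto simp: sets.sigma_sets_eq)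
qed

text \<open>
  Here \<open>1 < \<beta>\<close>, \<open>C < \<alpha>\<close> and \<open>1 \<le> \<alpha>\<close> are used: the density is dominated by the weight of the space
  that contains the solution.
\<close>

lemma density_before_le_weight:
  assumes \<omega>: "\<omega> \<in> space M" and t: "t \<in> {0..T}"
  shows "density_before \<omega> t \<le> exp (\<beta> * A \<omega> t) * \<alpha> powr N \<omega> t"
proof -
  have "density_before \<omega> t \<le> exp (A \<omega> t) * C ^ count_before \<omega> t" using t by (intro density_before_le[OF \<omega>]) auto
  also have "\<dots> \<le> exp (\<beta> * A \<omega> t) * \<alpha> powr N \<omega> t"
  proof (rule mult_mono)
    show "exp (A \<omega> t) \<le> exp (\<beta> * A \<omega> t)"
      using mult_right_mono[of 1 \<beta> "A \<omega> t"] A_nonneg[OF \<omega>, of t] t \<beta>_gt C_pos by simp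
    have "C ^ count_before \<omega> t \<le> \<alpha> ^ count_before \<omega> t" using C_pos \<alpha>_gt by (intro power_mono) auto
    also have "\<dots> = \<alpha> powr real (count_before \<omega> t)" using \<alpha>_ge by (simp add: powr_realpow)
    also have "\<dots> \<le> \<alpha> powr N \<omega> t" using \<alpha>_ge by (intro powr_mono count_before_le_N \<omega> t)
    finally show "C ^ count_before \<omega> t \<le> \<alpha> powr N \<omega> t" .
  qed (use C_pos in auto)
  finally show ?thesis .
qed

lemma density_at_T_le_weight:
  assumes \<omega>: "\<omega> \<in> space M"
  shows "density_at \<omega> T \<le> exp (\<beta> * A \<omega> T) * \<alpha> powr N \<omega> T"
proof -
  have "density_at \<omega> T \<le> exp (A \<omega> T) * C ^ card (jumps \<omega>)" by (rule density_at_T_le[OF \<omega>])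
  also have "\<dots> \<le> exp (\<beta> * A \<omega> T) * \<alpha> ^ card (jumps \<omega>)"
    using mult_right_mono[of 1 \<beta> "A \<omega> T"] A_nonneg[OF \<omega>, of T] T_pos \<beta>_gt C_pos \<alpha>_gt
    by (intro mult_mono power_mono) auto
  also have "\<alpha> ^ card (jumps \<omega>) = \<alpha> powr N \<omega> T" using \<alpha>_ge by (simp add: N_T[OF \<omega>] powr_realpow)
  finally show ?thesis .
qed

lemma \<xi>_integrable: "integrable P\<rho> \<xi>"
proof (rule integrableI_bounded)
  have m [measurable]: "\<xi> \<in> borel_measurable M" using measurable_history[OF \<xi>_measurable] .
  show "\<xi> \<in> borel_measurable P\<rho>" by simp
  have "(\<integral>\<^sup>+\<omega>. ennreal (norm (\<xi> \<omega>)) \<partial>P\<rho>) = (\<integral>\<^sup>+\<omega>. ennreal (density_at \<omega> T) * ennreal (norm (\<xi> \<omega>)) \<partial>M)"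
    by (rule nn_integral_P\<rho>) measurable
  also have "\<dots> \<le> (\<integral>\<^sup>+\<omega>. ennreal (exp (\<beta> * A \<omega> T) * \<alpha> powr N \<omega> T * \<bar>\<xi> \<omega>\<bar>) \<partial>M)"
    using density_at_T_le_weight density_at_nonneg
    by (intro nn_integral_mono) (auto simp: ennreal_mult[symmetric] intro!: ennreal_leI mult_right_mono)
  also note \<xi>_moment
  finally show "(\<integral>\<^sup>+\<omega>. ennreal (norm (\<xi> \<omega>)) \<partial>P\<rho>) < \<infinity>" .
qed

text \<open>
  The control \<open>v\<close> in the running cost may differ from the control \<open>u\<close> that defines the probability:
  both \<open>v = u\<close> and \<open>v = u_star\<close> are needed.
\<close>

lemma running_finite:
  assumes v: "v \<in> admissible"
  shows "(\<integral>\<^sup>+\<omega>. \<integral>\<^sup>+z. ennreal \<bar>running v (\<omega>, fst z)\<bar> \<partial>\<nu> \<omega> \<partial>P\<rho>) < \<infinity>"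
proof -
  note [measurable] = running_measurable[OF v]
  have "(\<lambda>z. ennreal \<bar>running v z\<bar>) \<in> borel_measurable predictable_sigma" by measurable
  then have H: "(\<lambda>y. ennreal \<bar>running v (fst y)\<bar>) \<in> borel_measurable (predictable_sigma \<Otimes>\<^sub>M (borel :: 'e measure))"
    by (rule measurable_compose[OF measurable_fst])
  have "(\<integral>\<^sup>+\<omega>. \<integral>\<^sup>+z. ennreal \<bar>running v (\<omega>, fst z)\<bar> \<partial>\<nu> \<omega> \<partial>P\<rho>) =
      (\<integral>\<^sup>+\<omega>. \<integral>\<^sup>+z. ennreal \<bar>running v (\<omega>, fst z)\<bar> * ennreal (density_before \<omega> (fst z)) \<partial>\<nu> \<omega> \<partial>M)"
    using nn_integral_P\<rho>_\<nu>[OF H] by simp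
  also have "\<dots> \<le> (\<integral>\<^sup>+\<omega>. \<integral>\<^sup>+s. ennreal (exp (A \<omega> s) * C powr N \<omega> s) * (SUP u\<in>space U. ennreal \<bar>l \<omega> s u\<bar>) \<partial>dA \<omega> \<partial>M)"
  proof (rule nn_integral_mono)
    fix \<omega> assume \<omega>: "\<omega> \<in> space M"
    have "(\<lambda>z. ennreal \<bar>running v z\<bar> * ennreal (density_before (fst z) (snd z))) \<in> borel_measurable predictable_sigma" by measurable
    from measurable_path_dA[OF \<omega> this]
    have "(\<lambda>s. ennreal \<bar>running v (\<omega>, s)\<bar> * ennreal (density_before \<omega> s)) \<in> borel_measurable (restrict_space borel {0..T})"
      by (simp add: measurable_cong_sets[OF sets_dA refl])
    from nn_integral_\<nu>_time[OF \<omega> this]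
    have "(\<integral>\<^sup>+z. ennreal \<bar>running v (\<omega>, fst z)\<bar> * ennreal (density_before \<omega> (fst z)) \<partial>\<nu> \<omega>)
      = (\<integral>\<^sup>+s. ennreal \<bar>running v (\<omega>, s)\<bar> * ennreal (density_before \<omega> s) \<partial>dA \<omega>)" .
    also have "\<dots> \<le> (\<integral>\<^sup>+s. ennreal (exp (A \<omega> s) * C powr N \<omega> s) * (SUP u\<in>space U. ennreal \<bar>l \<omega> s u\<bar>) \<partial>dA \<omega>)"
    proof (rule nn_integral_mono_AE)
      show "AE s in dA \<omega>. ennreal \<bar>running v (\<omega>, s)\<bar> * ennreal (density_before \<omega> s) \<le> ennreal (exp (A \<omega> s) * C powr N \<omega> s) * (SUP u\<in>space U. ennreal \<bar>l \<omega> s u\<bar>)"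
        using AE_count_before_eq_N[OF \<omega>] AE_space[of "dA \<omega>"]
      proof eventually_elim
        fix s assume c: "real (count_before \<omega> s) = N \<omega> s" and s: "s \<in> space (dA \<omega>)"
        have "density_before \<omega> s \<le> exp (A \<omega> s) * C powr N \<omega> s"
          using density_before_le[OF \<omega>, of s] s C_pos by (simp add: c[symmetric] powr_realpow)
        moreover have "ennreal \<bar>running v (\<omega>, s)\<bar> \<le> (SUP u\<in>space U. ennreal \<bar>l \<omega> s u\<bar>)"
          unfolding running_def using admissible_space[OF v \<omega>, of s] s by (intro SUP_upper2[of "v \<omega> s"]) auto
        ultimately show "ennreal \<bar>running v (\<omega>, s)\<bar> * ennreal (density_before \<omega> s) \<le> ennreal (exp (A \<omega> s) * C powr N \<omega> s) * (SUP u\<in>space U. ennreal \<bar>l \<omega> s u\<bar>)"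
          by (subst mult.commute) (intro mult_mono ennreal_leI, auto)
      qed
    qed
    finally show "(\<integral>\<^sup>+z. ennreal \<bar>running v (\<omega>, fst z)\<bar> * ennreal (density_before \<omega> (fst z)) \<partial>\<nu> \<omega>) \<le> \<dots>" .
  qed
  also note l_moment
  finally show ?thesis .
qed

definition Z_joint :: "('a \<times> real) \<times> 'e \<Rightarrow> real" where
  "Z_joint y = Z (fst (fst y)) (snd (fst y)) (snd y)"

lemma Z_joint_measurable [measurable]: "Z_joint \<in> borel_measurable (predictable_sigma \<Otimes>\<^sub>M borel)"
  unfolding Z_joint_def[abs_def] by (rule Z_measurable)

lemma Z_finite: "(\<integral>\<^sup>+\<omega>. \<integral>\<^sup>+z. ennreal \<bar>Z_joint ((\<omega>, fst z), snd z)\<bar> \<partial>\<nu> \<omega> \<partial>P\<rho>) < \<infinity>"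
proof -
  have H: "(\<lambda>y. ennreal \<bar>Z_joint y\<bar>) \<in> borel_measurable (predictable_sigma \<Otimes>\<^sub>M borel)" by measurable
  have "(\<integral>\<^sup>+\<omega>. \<integral>\<^sup>+z. ennreal \<bar>Z_joint ((\<omega>, fst z), snd z)\<bar> \<partial>\<nu> \<omega> \<partial>P\<rho>) = (\<integral>\<^sup>+\<omega>. \<integral>\<^sup>+z. ennreal \<bar>Z_joint ((\<omega>, fst z), snd z)\<bar> * ennreal (density_before \<omega> (fst z)) \<partial>\<nu> \<omega> \<partial>M)"
    by (rule nn_integral_P\<rho>_\<nu>[OF H])
  also have "\<dots> \<le> (\<integral>\<^sup>+\<omega>. \<integral>\<^sup>+z. ennreal (\<bar>Z \<omega> (fst z) (snd z)\<bar> * exp (\<beta> * A \<omega> (fst z)) * \<alpha> powr N \<omega> (fst z)) \<partial>\<nu> \<omega> \<partial>M)"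
  proof (intro nn_integral_mono)
    fix \<omega> z assume \<omega>: "\<omega> \<in> space M" and "z \<in> space (\<nu> \<omega>)"
    then have "fst z \<in> {0..T}" by (auto simp: space_\<nu>)
    from density_before_le_weight[OF \<omega> this] density_before_nonneg[OF \<omega>, of "fst z"]
    show "ennreal \<bar>Z_joint ((\<omega>, fst z), snd z)\<bar> * ennreal (density_before \<omega> (fst z)) \<le> ennreal (\<bar>Z \<omega> (fst z) (snd z)\<bar> * exp (\<beta> * A \<omega> (fst z)) * \<alpha> powr N \<omega> (fst z))"
      by (auto simp: ennreal_mult[symmetric] Z_joint_def mult.assoc intro!: ennreal_leI mult_left_mono)
  qed
  also note Z_moment
  finally show ?thesis .
qed

text \<open>
  The total cost of \<open>u\<close> along a path plus the compensated integral of \<open>Z\<close>.  The latter has mean \<open>0\<close> under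
  the controlled probability, so the mean of the payoff is the cost.
\<close>

definition payoff :: "'a \<Rightarrow> real" where
  "payoff \<omega> = (\<integral>t. l \<omega> t (u \<omega> t) \<partial>dA \<omega>) + \<xi> \<omega> + (\<integral>z. Z_joint ((\<omega>, fst z), snd z) * ctrl_rate u ((\<omega>, fst z), snd z) \<partial>\<nu> \<omega>) - (\<integral>z. Z_joint ((\<omega>, fst z), snd z) \<partial>\<mu> \<omega>)"

lemma payoff_expectation: "integrable P\<rho> payoff" "(\<integral>\<omega>. payoff \<omega> \<partial>P\<rho>) = cost u"
proof -
  have "running u \<in> borel_measurable predictable_sigma" by (rule running_measurable[OF u])
  then have h: "(\<lambda>y. running u (fst y)) \<in> borel_measurable (predictable_sigma \<Otimes>\<^sub>M (borel :: 'e measure))"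
    by (rule measurable_compose[OF measurable_fst])
  have eq: "(\<integral>z. running u (\<omega>, fst z) \<partial>\<nu> \<omega>) = (\<integral>t. l \<omega> t (u \<omega> t) \<partial>dA \<omega>)" if "\<omega> \<in> space P\<rho>" for \<omega>
    using integral_\<nu>_time[of \<omega> "\<lambda>t. running u (\<omega>, t)"] measurable_path_dA[OF _ running_measurable[OF u], of \<omega>] that
    by (simp add: running_def)
  have "integrable P\<rho> (\<lambda>\<omega>. \<integral>z. running u (fst ((\<omega>, fst z), snd z)) \<partial>\<nu> \<omega>)"
    by (rule expectation_kernel_integral(1)[OF sets_\<nu> measurable_nn_integral_\<nu> h]) (use running_finite[OF u] in simp_all)
  then have il: "integrable P\<rho> (\<lambda>\<omega>. \<integral>t. l \<omega> t (u \<omega> t) \<partial>dA \<omega>)"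
    by (subst (asm) Bochner_Integration.integrable_cong[OF refl, where g="\<lambda>\<omega>. \<integral>t. l \<omega> t (u \<omega> t) \<partial>dA \<omega>"]) (auto simp: eq)
  note g = girsanov[OF Z_joint_measurable Z_finite]
  show "integrable P\<rho> payoff" unfolding payoff_def[abs_def] using il \<xi>_integrable g by simp
  have "(\<integral>\<omega>. payoff \<omega> \<partial>P\<rho>) = (\<integral>\<omega>. (\<integral>t. l \<omega> t (u \<omega> t) \<partial>dA \<omega>) + \<xi> \<omega> \<partial>P\<rho>)"
    unfolding payoff_def[abs_def] using il \<xi>_integrable g by simp
  then show "(\<integral>\<omega>. payoff \<omega> \<partial>P\<rho>) = cost u" by (simp add: cost_def controlled_prob_eq)
qed

text \<open>
  A pathwise comparison.  The integrand \<open>drift v\<close> is \<open>l(t, v\<^sub>t) + \<integral> Z r(t, x, v\<^sub>t) d\<phi>\<close>.  The Hamiltonian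
  equals \<open>drift u_star\<close> by the choice of \<open>u_star\<close>, and it is at most \<open>drift u\<close> because it is an
  infimum.  Inserting this in the equation at time \<open>0\<close> compares \<open>Y\<^sub>0\<close> with the payoff.
\<close>

lemma solution_le_payoff: 
  "AE \<omega> in P\<rho>. Y \<omega> 0 \<le> payoff \<omega>" "u = u_star \<Longrightarrow> AE \<omega> in P\<rho>. Y \<omega> 0 = payoff \<omega>"
proof -
  have Z\<nu>: "AE \<omega> in P\<rho>. (\<integral>\<^sup>+(t, x). ennreal \<bar>Z \<omega> t x\<bar> \<partial>\<nu> \<omega>) < \<infinity>"
    using solution by (intro AE_P\<rho>) (simp add: bsde_solution_def)
  have bsde: "AE \<omega> in P\<rho>. \<forall>t\<in>{0..T}. Y \<omega> t + set_lebesgue_integral (\<mu> \<omega>) ({t<..T} \<times> UNIV) (\<lambda>(s, x). Z \<omega> s x) =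
        \<xi> \<omega> + set_lebesgue_integral (completion (dA \<omega>)) {t<..T} (\<lambda>s. real_of_ereal (hamiltonian \<omega> s (Z \<omega> s)))"
    using solution by (intro AE_P\<rho>) (simp add: bsde_solution_def)
  have min: "AE \<omega> in P\<rho>. AE t in dA \<omega>. hamiltonian \<omega> t (Z \<omega> t) =
        ereal (if integrable (\<phi> \<omega> t) (Z \<omega> t)
               then l \<omega> t (u_star \<omega> t) + (LINT x|\<phi> \<omega> t. Z \<omega> t x * r \<omega> t x (u_star \<omega> t)) else 0)"
    using minimizer by (intro AE_P\<rho>) (simp add: hamiltonian_minimizer_def)
  have l_fin: "AE \<omega> in P\<rho>. (\<integral>\<^sup>+z. ennreal \<bar>running v (\<omega>, fst z)\<bar> \<partial>\<nu> \<omega>) \<noteq> \<infinity>" if v: "v \<in> admissible" for v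
  proof -
    note [measurable] = running_measurable[OF v]
    have "(\<lambda>z. ennreal \<bar>running v z\<bar>) \<in> borel_measurable predictable_sigma" by measurable
    then have "(\<lambda>y. ennreal \<bar>running v (fst y)\<bar>) \<in> borel_measurable (predictable_sigma \<Otimes>\<^sub>M (borel :: 'e measure))"
      by (rule measurable_compose[OF measurable_fst])
    from measurable_nn_integral_\<nu>[OF this] running_finite[OF v] show ?thesis
      by (intro nn_integral_PInf_AE) auto
  qed
  have "AE \<omega> in P\<rho>. Y \<omega> 0 \<le> payoff \<omega> \<and> (u = u_star \<longrightarrow> Y \<omega> 0 = payoff \<omega>)"
    using Z\<nu> bsde min l_fin[OF u] l_fin[OF u_star_admissible] AE_space[of P\<rho>]
  proof eventually_elim
    fix \<omega>
    assume Zfin: "(\<integral>\<^sup>+(t, x). ennreal \<bar>Z \<omega> t x\<bar> \<partial>\<nu> \<omega>) < \<infinity>"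
      and eq: "\<forall>t\<in>{0..T}. Y \<omega> t + set_lebesgue_integral (\<mu> \<omega>) ({t<..T} \<times> UNIV) (\<lambda>(s, x). Z \<omega> s x) =
        \<xi> \<omega> + set_lebesgue_integral (completion (dA \<omega>)) {t<..T} (\<lambda>s. real_of_ereal (hamiltonian \<omega> s (Z \<omega> s)))"
      and ham: "AE t in dA \<omega>. hamiltonian \<omega> t (Z \<omega> t) =
        ereal (if integrable (\<phi> \<omega> t) (Z \<omega> t)
               then l \<omega> t (u_star \<omega> t) + (LINT x|\<phi> \<omega> t. Z \<omega> t x * r \<omega> t x (u_star \<omega> t)) else 0)"
      and lfin: "(\<integral>\<^sup>+z. ennreal \<bar>running u (\<omega>, fst z)\<bar> \<partial>\<nu> \<omega>) \<noteq> \<infinity>" "(\<integral>\<^sup>+z. ennreal \<bar>running u_star (\<omega>, fst z)\<bar> \<partial>\<nu> \<omega>) \<noteq> \<infinity>"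
      and "\<omega> \<in> space P\<rho>"
    then have \<omega>: "\<omega> \<in> space M" by simp
    define z where "z y = Z_joint ((\<omega>, fst y), snd y)" for y
    define drift where "drift v t = l \<omega> t (v \<omega> t) + (LINT x|\<phi> \<omega> t. Z \<omega> t x * r \<omega> t x (v \<omega> t))" for v t
    have z [measurable]: "z \<in> borel_measurable mark_space" unfolding z_def[abs_def] by (rule measurable_mark_section[OF \<omega>]) measurable
    have zfin: "(\<integral>\<^sup>+y. ennreal \<bar>z y\<bar> \<partial>\<nu> \<omega>) < \<infinity>" using Zfin by (simp add: z_def Z_joint_def split_beta')
    have Z_int: "AE t in dA \<omega>. integrable (\<phi> \<omega> t) (Z \<omega> t)"
      using integral_\<nu>_disintegrate(1)[OF \<omega> z zfin] by (simp add: z_def Z_joint_def)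
    have drift: "integrable (dA \<omega>) (drift v) \<and> (\<integral>t. drift v t \<partial>dA \<omega>) = (\<integral>t. l \<omega> t (v \<omega> t) \<partial>dA \<omega>) + (\<integral>y. z y * ctrl_rate v ((\<omega>, fst y), snd y) \<partial>\<nu> \<omega>)"
      if v: "v \<in> admissible" and fin: "(\<integral>\<^sup>+z. ennreal \<bar>running v (\<omega>, fst z)\<bar> \<partial>\<nu> \<omega>) \<noteq> \<infinity>" for v
    proof -
      have [measurable]: "(\<lambda>y. ctrl_rate v ((\<omega>, fst y), snd y)) \<in> borel_measurable mark_space"
        by (rule measurable_mark_section[OF \<omega> ctrl_rate_measurable[OF v]])
      have lm: "(\<lambda>t. running v (\<omega>, t)) \<in> borel_measurable (dA \<omega>)" by (rule measurable_path_dA[OF \<omega> running_measurable[OF v]])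
      then have "(\<lambda>t. running v (\<omega>, t)) \<in> borel_measurable (restrict_space borel {0..T})" by (simp add: measurable_cong_sets[OF sets_dA refl])
      then have "(\<lambda>t. ennreal \<bar>running v (\<omega>, t)\<bar>) \<in> borel_measurable (restrict_space borel {0..T})"
        by (intro measurable_compose[OF _ measurable_ennreal] borel_measurable_abs)
      from nn_integral_\<nu>_time[OF \<omega> this]
      have "(\<integral>\<^sup>+z. ennreal \<bar>running v (\<omega>, fst z)\<bar> \<partial>\<nu> \<omega>) = (\<integral>\<^sup>+t. ennreal \<bar>running v (\<omega>, t)\<bar> \<partial>dA \<omega>)" .
      then have li: "integrable (dA \<omega>) (\<lambda>t. l \<omega> t (v \<omega> t))"
        using lm fin by (simp add: integrable_iff_bounded less_top running_def)
      have zr: "(\<lambda>y. z y * ctrl_rate v ((\<omega>, fst y), snd y)) \<in> borel_measurable mark_space" by measurable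
      have zrfin: "(\<integral>\<^sup>+y. ennreal \<bar>z y * ctrl_rate v ((\<omega>, fst y), snd y)\<bar> \<partial>\<nu> \<omega>) < \<infinity>"
      proof -
        have "(\<integral>\<^sup>+y. ennreal \<bar>z y * ctrl_rate v ((\<omega>, fst y), snd y)\<bar> \<partial>\<nu> \<omega>) \<le> (\<integral>\<^sup>+y. ennreal C * ennreal \<bar>z y\<bar> \<partial>\<nu> \<omega>)"
        proof (rule nn_integral_mono)
          fix y assume "y \<in> space (\<nu> \<omega>)"
          then have t: "fst y \<in> {0..T}" by (auto simp: space_\<nu>[OF \<omega>])
          have "\<bar>ctrl_rate v ((\<omega>, fst y), snd y)\<bar> \<le> C"
            using r_bounds[OF \<omega> t admissible_space[OF v \<omega> t], of "snd y"] by (simp add: ctrl_rate_def)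
          then show "ennreal \<bar>z y * ctrl_rate v ((\<omega>, fst y), snd y)\<bar> \<le> ennreal C * ennreal \<bar>z y\<bar>"
            using C_pos mult_left_mono[of "\<bar>ctrl_rate v ((\<omega>, fst y), snd y)\<bar>" C "\<bar>z y\<bar>"]
            by (simp add: abs_mult ennreal_mult[symmetric] mult.commute ennreal_leI)
        qed
        also have "\<dots> = ennreal C * (\<integral>\<^sup>+y. ennreal \<bar>z y\<bar> \<partial>\<nu> \<omega>)"
          using z by (intro nn_integral_cmult) (simp add: measurable_cong_sets[OF sets_\<nu>[OF \<omega>] refl])
        also have "\<dots> < \<infinity>" using zfin by (simp add: ennreal_mult_less_top)
        finally show ?thesis .
      qed
      note d = integral_\<nu>_disintegrate(2,3)[OF \<omega> zr zrfin]
      have e: "(\<integral>x. z (t, x) * ctrl_rate v ((\<omega>, fst (t, x)), snd (t, x)) \<partial>\<phi> \<omega> t) = (LINT x|\<phi> \<omega> t. Z \<omega> t x * r \<omega> t x (v \<omega> t))" for t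
        by (simp add: z_def Z_joint_def ctrl_rate_def)
      show ?thesis unfolding drift_def[abs_def] using li d unfolding e by simp
    qed
    have du: "integrable (dA \<omega>) (drift u)" and ds: "integrable (dA \<omega>) (drift u_star)"
      using drift[OF u lfin(1)] drift[OF u_star_admissible lfin(2)] by auto
    have "AE t in dA \<omega>. real_of_ereal (hamiltonian \<omega> t (Z \<omega> t)) = drift u_star t \<and> drift u_star t \<le> drift u t"
      using ham Z_int AE_space[of "dA \<omega>"]
    proof eventually_elim
      fix t
      assume h: "hamiltonian \<omega> t (Z \<omega> t) = ereal (if integrable (\<phi> \<omega> t) (Z \<omega> t)
               then l \<omega> t (u_star \<omega> t) + (LINT x|\<phi> \<omega> t. Z \<omega> t x * r \<omega> t x (u_star \<omega> t)) else 0)"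
        and i: "integrable (\<phi> \<omega> t) (Z \<omega> t)" and "t \<in> space (dA \<omega>)"
      then have t: "t \<in> {0..T}" by simp
      have h': "hamiltonian \<omega> t (Z \<omega> t) = ereal (drift u_star t)" using h i by (simp add: drift_def)
      have "hamiltonian \<omega> t (Z \<omega> t) \<le> ereal (drift u t)"
        unfolding hamiltonian_def drift_def using i admissible_space[OF u \<omega> t] by (auto intro!: INF_lower2)
      then show "real_of_ereal (hamiltonian \<omega> t (Z \<omega> t)) = drift u_star t \<and> drift u_star t \<le> drift u t"
        unfolding h' by simp
    qed
    then have ham_eq: "AE t in dA \<omega>. real_of_ereal (hamiltonian \<omega> t (Z \<omega> t)) = drift u_star t"
      and le: "AE t in dA \<omega>. drift u_star t \<le> drift u t" by (auto elim: eventually_mono)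
    have "AE t in dA \<omega>. indicator {0<..T} t *\<^sub>R real_of_ereal (hamiltonian \<omega> t (Z \<omega> t)) = drift u_star t"
      using ham_eq AE_dA_neq[OF \<omega>, of 0] AE_space[of "dA \<omega>"] by eventually_elim auto
    then have "set_lebesgue_integral (completion (dA \<omega>)) {0<..T} (\<lambda>s. real_of_ereal (hamiltonian \<omega> s (Z \<omega> s))) = (\<integral>t. drift u_star t \<partial>dA \<omega>)"
      unfolding set_lebesgue_integral_def by (rule integral_completion_AE[OF borel_measurable_integrable[OF ds]])
    moreover have "set_lebesgue_integral (\<mu> \<omega>) ({0<..T} \<times> UNIV) (\<lambda>(s, x). Z \<omega> s x) = (\<integral>y. z y \<partial>\<mu> \<omega>)"
    proof -
      have "AE y in \<mu> \<omega>. 0 < fst y" using time_jumps(1)[OF \<omega>] by (subst AE_\<mu>[OF \<omega>]) auto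
      with AE_space[of "\<mu> \<omega>"] have ae: "AE y in \<mu> \<omega>. indicator ({0<..T} \<times> UNIV) y * z y = z y"
        by eventually_elim (auto simp: space_\<mu>)
      have eq': "(\<lambda>y. indicator ({0<..T} \<times> UNIV) y *\<^sub>R (case y of (s, x) \<Rightarrow> Z \<omega> s x)) = (\<lambda>y. indicator ({0<..T} \<times> UNIV) y * z y)"
        by (auto simp: z_def Z_joint_def fun_eq_iff)
      have "{0<..T} \<times> UNIV \<in> sets mark_space" unfolding mark_space_def by (intro pair_measureI) (auto simp: sets_restrict_space_iff)
      then have "(\<lambda>y. indicator ({0<..T} \<times> UNIV) y * z y) \<in> borel_measurable (\<mu> \<omega>)" by measurable
      then show ?thesis
        unfolding set_lebesgue_integral_def eq' using ae by (intro integral_cong_AE) auto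
    qed
    ultimately have Y0: "Y \<omega> 0 + (\<integral>y. z y \<partial>\<mu> \<omega>) = \<xi> \<omega> + (\<integral>t. drift u_star t \<partial>dA \<omega>)"
      using eq T_pos by force
    have pay: "payoff \<omega> = \<xi> \<omega> + (\<integral>t. drift u t \<partial>dA \<omega>) - (\<integral>y. z y \<partial>\<mu> \<omega>)"
      using drift[OF u lfin(1)] by (simp add: payoff_def z_def)
    have "(\<integral>t. drift u_star t \<partial>dA \<omega>) \<le> (\<integral>t. drift u t \<partial>dA \<omega>)" by (rule integral_mono_AE[OF ds du le])
    then show "Y \<omega> 0 \<le> payoff \<omega> \<and> (u = u_star \<longrightarrow> Y \<omega> 0 = payoff \<omega>)" using Y0 pay by auto
  qed
  then show "AE \<omega> in P\<rho>. Y \<omega> 0 \<le> payoff \<omega>" "u = u_star \<Longrightarrow> AE \<omega> in P\<rho>. Y \<omega> 0 = payoff \<omega>" by (auto elim: eventually_mono)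
qed

text \<open>
  The mean of the pathwise comparison under the controlled probability, where \<open>Y\<^sub>0\<close> is constant.
\<close>

lemma verification:
  assumes \<omega>: "\<omega> \<in> space M"
  shows "Y \<omega> 0 \<le> cost u" "u = u_star \<Longrightarrow> Y \<omega> 0 = cost u"
proof -
  interpret P: prob_space P\<rho> by (rule prob_space_P\<rho>)
  have Y: "AE \<omega>' in P\<rho>. Y \<omega>' 0 = Y \<omega> 0" using AE_space[of P\<rho>] by eventually_elim (simp add: Y_0_constant[OF _ \<omega>])
  have const: "(\<integral>\<omega>'. Y \<omega> 0 \<partial>P\<rho>) = Y \<omega> 0" using P.prob_space by simp
  have "AE \<omega>' in P\<rho>. Y \<omega> 0 \<le> payoff \<omega>'" using Y solution_le_payoff(1) by eventually_elim simp
  then have "(\<integral>\<omega>'. Y \<omega> 0 \<partial>P\<rho>) \<le> (\<integral>\<omega>'. payoff \<omega>' \<partial>P\<rho>)" by (intro integral_mono_AE payoff_expectation(1)) auto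
  then show "Y \<omega> 0 \<le> cost u" unfolding const payoff_expectation(2) .
  assume "u = u_star"
  from solution_le_payoff(2)[OF this] Y have "AE \<omega>' in P\<rho>. Y \<omega> 0 = payoff \<omega>'" by eventually_elim simp
  then have "(\<integral>\<omega>'. Y \<omega> 0 \<partial>P\<rho>) = (\<integral>\<omega>'. payoff \<omega>' \<partial>P\<rho>)"
    by (intro integral_cong_AE borel_measurable_integrable[OF payoff_expectation(1)]) auto
  then show "Y \<omega> 0 = cost u" unfolding const payoff_expectation(2) .
qed

end

theorem theorem16:
  fixes M :: "'a measure" and T C \<alpha> \<beta> :: real
    and \<Delta> :: "'e :: topological_space"
    and S :: "nat \<Rightarrow> 'a \<Rightarrow> ennreal" and X :: "nat \<Rightarrow> 'a \<Rightarrow> 'e"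
    and A :: "'a \<Rightarrow> real \<Rightarrow> real" and \<phi> :: "'a \<Rightarrow> real \<Rightarrow> 'e measure"
    and \<xi> :: "'a \<Rightarrow> real" and U :: "'u measure"
    and r :: "'a \<Rightarrow> real \<Rightarrow> 'e \<Rightarrow> 'u \<Rightarrow> real" and l :: "'a \<Rightarrow> real \<Rightarrow> 'u \<Rightarrow> real"
    and Y :: "'a \<Rightarrow> real \<Rightarrow> real" and Z :: "'a \<Rightarrow> real \<Rightarrow> 'e \<Rightarrow> real"
    and u_star :: "'a \<Rightarrow> real \<Rightarrow> 'u"
  assumes "control_problem M T \<Delta> S X A \<phi> \<xi> U r l"
    and "compensated_point_process.assumption_A M T S X A"
    and "control_problem.assumption_B M T S X A \<xi> U r l C \<alpha> \<beta>"
    and "control_problem.assumption_C M T S X A \<phi> U r l"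
    and "(Y, Z) \<in> compensated_point_process.weighted_L1 M T S X A \<phi> \<alpha> \<beta>"
    and "control_problem.bsde_solution M T S X A \<phi> \<xi> U r l Y Z"
    and "control_problem.hamiltonian_minimizer M T S X A \<phi> U r l Z u_star"
  shows "control_problem.optimal M T S X A \<phi> \<xi> U r l u_star \<and>
    (\<forall>\<omega>\<in>space M. Y \<omega> 0 = control_problem.cost M T S X A \<phi> \<xi> r l u_star) \<and>
    control_problem.cost M T S X A \<phi> \<xi> r l u_star =
      (INF u\<in>control_problem.admissible M T S X U. control_problem.cost M T S X A \<phi> \<xi> r l u)"
proof -
  interpret control_problem M T \<Delta> S X A \<phi> \<xi> U r l by fact
  interpret B: controlled_bsde M T \<Delta> S X A \<phi> \<xi> U r l C \<alpha> \<beta> Y Z u_star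
    by unfold_locales (use assms in auto)
  have ac: "admissible_control M T \<Delta> S X A \<phi> \<xi> U r l C \<alpha> \<beta> Y Z u_star u" if "u \<in> admissible" for u
    by (intro admissible_control.intro B.controlled_bsde_axioms admissible_control_axioms.intro that)
  have le: "Y \<omega> 0 \<le> cost u" if "\<omega> \<in> space M" "u \<in> admissible" for \<omega> u
    by (rule admissible_control.verification(1)[OF ac[OF that(2)] that(1)])
  have eq: "Y \<omega> 0 = cost u_star" if "\<omega> \<in> space M" for \<omega>
    by (rule admissible_control.verification(2)[OF ac[OF B.u_star_admissible] that refl])
  obtain \<omega> where \<omega>: "\<omega> \<in> space M" using not_empty by blast
  have opt: "cost u_star \<le> cost u" if "u \<in> admissible" for u
    using le[OF \<omega> that] eq[OF \<omega>] by simp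
  have "(INF u\<in>admissible. cost u) = cost u_star"
    using opt B.u_star_admissible by (intro cInf_eq_minimum) auto
  then show ?thesis using opt eq B.u_star_admissible by (simp add: optimal_def)
qed

end
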